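(* Let $b\colon\mathbb{T}\to\mathbb{R}$ be smooth away from finitely many points $\{\bar y_1,\dots,\bar y_N\}$ and such that for some $c>0$ one has $|b'(y)|\ge c$ wherever $b'$ is defined. Suppose that for each $1\le i\le N$ there exist $\alpha_i,h_i\in(0,1)$ and $\beta_i,c_i\in\mathbb{R}$ such that $$b(\bar y_i+h)-b(\bar y_i)=c_i|h|^{\alpha_i}\log^{\beta_i}(|h|^{-1})\qquad\forall h\in[-h_i,h_i]\setminus\{0\}.$$ Then $u(x,y)=(b(y),0)$ is dissipation enhancing with rate function $\lambda(\nu)=\nu^{1/3}$.
   Context: $\mathbb{T}=\mathbb{R}/\mathbb{Z}$; $\log^{\beta}(s)$ means $(\log s)^\beta$. For $b\colon\mathbb{T}\to\mathbb{R}$, the flow $u(x,y)=(b(y),0)$ on $\mathbb{T}^2$ is dissipation enhancing with rate function $\lambda\colon(0,1)\to(0,\infty)$ if $\lim_{\nu\to0}\nu/\lambda(\nu)=0$ and there exist constants $C,c>0$ (independent of $\nu$) such that for all $\nu\in(0,1)$ and all $f_0\in L^2(\mathbb{T}^2)$ with $\int_{\mathbb{T}}f_0(x,y)\,dx=0$ for all $y\in\mathbb{T}$, the solution of $\partial_tf+b(y)\partial_xf=\nu\Delta f$, $f|_{t=0}=f_0$ on $\mathbb{T}^2$ satisfies $\|f(t)\|_{L^2}\le Ce^{-c\lambda(\nu)t}\|f_0\|_{L^2}$ for all $t\ge0$. *)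

theory Defs
  imports "HOL-Analysis.Analysis"
begin

text \<open>
  Functions on the circle \<open>\<real>/\<int>\<close> are 1-periodic functions on \<^typ>\<open>real\<close>, functions on the
  2-torus are functions on \<^typ>\<open>real \<times> real\<close> that are 1-periodic in both coordinates, and
  integrals over the torus are integrals over the unit cell.
\<close>

definition periodic1 :: "(real \<Rightarrow> 'a) \<Rightarrow> bool" where
  "periodic1 g \<longleftrightarrow> (\<forall>y. g (y + 1) = g y)"

definition periodic2 :: "(real \<times> real \<Rightarrow> 'a) \<Rightarrow> bool" where
  "periodic2 f \<longleftrightarrow> (\<forall>x y. f (x + 1, y) = f (x, y) \<and> f (x, y + 1) = f (x, y))"

definition cell :: "(real \<times> real) set" where
  "cell = {0..<1} \<times> {0..<1}"

text \<open>Elements of \<open>L\<^sup>2\<close> are given by everywhere-defined periodic Borel representatives.\<close>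

definition L2_torus :: "(real \<times> real \<Rightarrow> complex) \<Rightarrow> bool" where
  "L2_torus f \<longleftrightarrow> periodic2 f \<and> f \<in> borel_measurable borel \<and>
     set_integrable lborel cell (\<lambda>p. (cmod (f p))\<^sup>2)"

definition L2_norm :: "(real \<times> real \<Rightarrow> complex) \<Rightarrow> real" where
  "L2_norm f = sqrt (LINT p:cell|lborel. (cmod (f p))\<^sup>2)"

text \<open>The pairing with test functions is bilinear: no complex conjugation.\<close>

definition pairing :: "(real \<times> real \<Rightarrow> complex) \<Rightarrow> (real \<times> real \<Rightarrow> complex) \<Rightarrow> complex" where
  "pairing f \<phi> = (LINT p:cell|lborel. f p * \<phi> p)"

text \<open>For open \<open>U\<close> this is \<open>C\<^sup>\<infinity>\<close> regularity of \<open>g\<close> on \<open>U\<close>.\<close>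

definition smooth_on :: "(real \<Rightarrow> real) \<Rightarrow> real set \<Rightarrow> bool" where
  "smooth_on g U \<longleftrightarrow> (\<forall>n. \<forall>y\<in>U. (deriv ^^ n) g differentiable (at y))"

definition partial_x :: "(real \<times> real \<Rightarrow> complex) \<Rightarrow> real \<times> real \<Rightarrow> complex" where
  "partial_x \<phi> = (\<lambda>(x, y). vector_derivative (\<lambda>s. \<phi> (s, y)) (at x))"

definition partial_y :: "(real \<times> real \<Rightarrow> complex) \<Rightarrow> real \<times> real \<Rightarrow> complex" where
  "partial_y \<phi> = (\<lambda>(x, y). vector_derivative (\<lambda>s. \<phi> (x, s)) (at y))"

definition laplacian :: "(real \<times> real \<Rightarrow> complex) \<Rightarrow> real \<times> real \<Rightarrow> complex" where
  "laplacian \<phi> p = (partial_x ^^ 2) \<phi> p + (partial_y ^^ 2) \<phi> p"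

text \<open>
  Total differentiability of all \<open>\<partial>\<^sub>x\<^sup>i \<partial>\<^sub>y\<^sup>j \<phi>\<close> makes all of them exist and be continuous, so this
  is the space of \<open>C\<^sup>\<infinity>\<close> functions on the torus.
\<close>

definition test_function :: "(real \<times> real \<Rightarrow> complex) \<Rightarrow> bool" where
  "test_function \<phi> \<longleftrightarrow> periodic2 \<phi> \<and>
     (\<forall>i j p. (partial_x ^^ i) ((partial_y ^^ j) \<phi>) differentiable (at p))"

text \<open>
  Solutions of \<open>\<partial>\<^sub>t f + b(y) \<partial>\<^sub>x f = \<nu> \<Delta> f\<close> with initial datum \<open>f\<^sub>0\<close>: curves in
  \<open>C([0,\<infinity>); L\<^sup>2)\<close> satisfying the equation in the weak sense. The transport term is moved onto
  the test function using that \<open>b\<close> does not depend on \<open>x\<close>. The notion is meant for bounded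
  Borel \<open>b\<close>, for which such a solution exists and is unique for every datum in \<open>L\<^sup>2\<close>.
\<close>

definition solution ::
  "(real \<Rightarrow> real) \<Rightarrow> real \<Rightarrow> (real \<times> real \<Rightarrow> complex) \<Rightarrow> (real \<Rightarrow> real \<times> real \<Rightarrow> complex) \<Rightarrow> bool" where
  "solution b \<nu> f\<^sub>0 f \<longleftrightarrow>
     (\<forall>t\<ge>0. L2_torus (f t)) \<and>
     (\<forall>t\<ge>0. ((\<lambda>s. L2_norm (\<lambda>p. f s p - f t p)) \<longlongrightarrow> 0) (at t within {0..})) \<and>
     (\<forall>\<phi>. test_function \<phi> \<longrightarrow> (\<forall>t\<ge>0.
        pairing (f t) \<phi> = pairing f\<^sub>0 \<phi> +
          (LINT s:{0..t}|lborel. pairing (f s)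
             (\<lambda>(x, y). complex_of_real (b y) * partial_x \<phi> (x, y)
                        + complex_of_real \<nu> * laplacian \<phi> (x, y)))))"

text \<open>
  The velocity field is the shear flow \<open>u(x,y) = (b(y), 0)\<close>. Data and solutions are
  complex-valued, which contains the real-valued case.
\<close>

definition dissipation_enhancing :: "(real \<Rightarrow> real) \<Rightarrow> (real \<Rightarrow> real) \<Rightarrow> bool" where
  "dissipation_enhancing b rate \<longleftrightarrow>
     (\<forall>\<nu>\<in>{0<..<1}. rate \<nu> > 0) \<and>
     ((\<lambda>\<nu>. \<nu> / rate \<nu>) \<longlongrightarrow> 0) (at_right 0) \<and>
     (\<exists>C>0. \<exists>c>0. \<forall>\<nu>\<in>{0<..<1}. \<forall>f\<^sub>0 f.
        L2_torus f\<^sub>0 \<longrightarrow>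
        (AE y in lborel. (LINT x:{0..<1}|lborel. f\<^sub>0 (x, y)) = 0) \<longrightarrow>
        solution b \<nu> f\<^sub>0 f \<longrightarrow>
        (\<forall>t\<ge>0. L2_norm (f t) \<le> C * exp (- c * rate \<nu> * t) * L2_norm f\<^sub>0))"

end

theory Submission
  imports Defs "HOL-Real_Asymp.Real_Asymp"
begin

text \<open>
  Of the cusp condition only the continuity of \<open>b\<close> at the points \<open>ybar i\<close> matters: a continuous
  profile with \<open>\<bar>b'\<bar> \<ge> c\<close> off finitely many points already mixes at rate \<open>\<nu>\<^bsup>1/3\<^esup>\<close>.
  In the \<open>x\<close>-frequency \<open>k \<noteq> 0\<close> the key is the estimate \<open>\<parallel>g\<parallel> \<le> C \<nu>\<^bsup>-1/3\<^esup> \<parallel>F\<parallel>\<close>, uniform in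
  \<open>k\<close> and \<open>\<tau>\<close>, for the resolvent equation
  \<open>i \<tau> g + \<nu> (4 \<pi>\<^sup>2 k\<^sup>2 g - g'') + 2 \<pi> i k b g = F\<close>. Put \<open>\<mu> = - \<tau> / (2 \<pi> k)\<close> and let \<open>Z\<close> consist of the
  singular points and the zeros of \<open>b - \<mu>\<close>. Then \<open>\<bar>b - \<mu>\<bar> \<ge> c dist(\<cdot>, Z)\<close> and \<open>Z\<close> has boundedly many
  points per period, so testing with \<open>\<theta> g\<close>, where
  \<open>\<theta> = sgn (b - \<mu>) min (1, dist(\<cdot>, Z) / \<delta>)\<close> and \<open>\<delta> = \<epsilon> \<nu>\<^bsup>1/3\<^esup>\<close>, controls \<open>g\<close> away from \<open>Z\<close>; near \<open>Z\<close> one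
  uses the smallness of the set and a sup bound on \<open>g\<close>. The slope of \<open>\<theta>\<close> is \<open>1/\<delta>\<close> no matter how steep
  \<open>b\<close> is, so the cusps cause no loss. The resolvent estimate is transferred to the
  evolution by a Fourier series in time of the mode multiplied by a sine vanishing at both ends of a
  time interval of length \<open>\<sim> \<nu>\<^bsup>-1/3\<^esup>\<close>; together with the monotonicity of the energy this gives a
  definite decay over each such interval.
\<close>

subsection \<open>Square-integrable functions\<close>

text \<open>The decay has to be shown for every weak solution in C([0,\<infinity>); L2), and no
  semigroup or generator is constructed. Hence the analysis runs on Fourier coefficients: testing
  with characters gives an ODE for each coefficient, and g, g', g'' enter the resolvent estimate
  only through square summability of c, q c and q^2 c, where q is the frequency. The basis for this
  is Parseval's identity on the circle. The exponent 1/3 is a balance. With r = \<nu>^(1/3) and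
  multiplier scale \<delta> = e r, the transport term yields at least a multiple of \<delta> |g|^2
  away from the bad set, while commuting the multiplier with the diffusion costs r^3 \<delta>^(-1)
  |g'| |g|. When r |g'| is comparable to |g|, both are of order r |g|^2, and every term leads to a
  bound |g|^2 \<le> C r^(-1) |F| |g|. A frequency |k| \<ge> 1 only enlarges the gain, whence the
  uniformity in k. The number e is fixed independently of r, so that the bad set carries at most
  half of a weighted norm.\<close>

definition sq_int :: "'a measure \<Rightarrow> ('a \<Rightarrow> complex) \<Rightarrow> bool" where
  "sq_int M f \<longleftrightarrow> f \<in> borel_measurable M \<and> integrable M (\<lambda>x. (cmod (f x))\<^sup>2)"

definition norm_sq :: "'a measure \<Rightarrow> ('a \<Rightarrow> complex) \<Rightarrow> real" where
  "norm_sq M f = (\<integral>x. (cmod (f x))\<^sup>2 \<partial>M)"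

lemma sq_int_measurable [measurable_dest]: "sq_int M f \<Longrightarrow> f \<in> borel_measurable M"
  by (simp add: sq_int_def)

lemma norm_sq_nonneg [simp]: "0 \<le> norm_sq M f"
  by (simp add: norm_sq_def)

lemma sq_int_mult_integrable:
  assumes f: "sq_int M f" and g: "sq_int M g"
  shows "integrable M (\<lambda>x. f x * g x)"
proof (rule Bochner_Integration.integrable_bound)
  show "integrable M (\<lambda>x. (cmod (f x))\<^sup>2 + (cmod (g x))\<^sup>2)"
    using f g by (simp add: sq_int_def)
  show "(\<lambda>x. f x * g x) \<in> borel_measurable M"
    using f g by measurable
  have "cmod (f x * g x) \<le> norm ((cmod (f x))\<^sup>2 + (cmod (g x))\<^sup>2)" for x
    using sum_squares_bound[of "cmod (f x)" "cmod (g x)"]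
      mult_nonneg_nonneg[of "cmod (f x)" "cmod (g x)"]
    by (simp add: norm_mult del: mult_nonneg_nonneg)
  then show "AE x in M. cmod (f x * g x) \<le> norm ((cmod (f x))\<^sup>2 + (cmod (g x))\<^sup>2)"
    by simp
qed

lemma sq_int_cnj [simp]: "sq_int M (\<lambda>x. cnj (f x)) \<longleftrightarrow> sq_int M f"
proof -
  have m: "(\<lambda>x. cnj (h x)) \<in> borel_measurable M" if "h \<in> borel_measurable M" for h
    by (rule measurable_compose[OF that]) (intro borel_measurable_continuous_onI continuous_intros)
  have "(\<lambda>x. cnj (f x)) \<in> borel_measurable M \<longleftrightarrow> f \<in> borel_measurable M"
  proof
    assume "(\<lambda>x. cnj (f x)) \<in> borel_measurable M"
    then have "(\<lambda>x. cnj (cnj (f x))) \<in> borel_measurable M" by (rule m)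
    then show "f \<in> borel_measurable M" by simp
  qed (rule m)
  then show ?thesis by (simp add: sq_int_def)
qed

lemma sq_int_mult_cnj_integrable:
  "sq_int M f \<Longrightarrow> sq_int M g \<Longrightarrow> integrable M (\<lambda>x. f x * cnj (g x))"
  by (rule sq_int_mult_integrable) auto

lemma sq_int_bounded_mult:
  assumes f: "sq_int M f" and h: "h \<in> borel_measurable M"
    and B: "\<And>x. x \<in> space M \<Longrightarrow> cmod (h x) \<le> B"
  shows "sq_int M (\<lambda>x. h x * f x)" "norm_sq M (\<lambda>x. h x * f x) \<le> B\<^sup>2 * norm_sq M f"
proof -
  have le: "(cmod (h x * f x))\<^sup>2 \<le> B\<^sup>2 * (cmod (f x))\<^sup>2" if "x \<in> space M" for x
    using B[OF that] by (simp add: norm_mult power_mult_distrib mult_right_mono power_mono)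
  have i: "integrable M (\<lambda>x. B\<^sup>2 * (cmod (f x))\<^sup>2)"
    using f by (simp add: sq_int_def)
  have "integrable M (\<lambda>x. (cmod (h x * f x))\<^sup>2)"
    by (rule Bochner_Integration.integrable_bound[OF i]) (use f h le in \<open>auto intro!: AE_I2\<close>)
  then show s: "sq_int M (\<lambda>x. h x * f x)"
    using f h by (auto simp: sq_int_def)
  have "norm_sq M (\<lambda>x. h x * f x) \<le> (\<integral>x. B\<^sup>2 * (cmod (f x))\<^sup>2 \<partial>M)"
    unfolding norm_sq_def using s i le by (intro integral_mono) (auto simp: sq_int_def)
  then show "norm_sq M (\<lambda>x. h x * f x) \<le> B\<^sup>2 * norm_sq M f"
    by (simp add: norm_sq_def)
qed

lemma sq_int_cmult: "sq_int M f \<Longrightarrow> sq_int M (\<lambda>x. c * f x)"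
  by (rule sq_int_bounded_mult(1)[where B = "cmod c"]) auto

lemma norm_sq_cmult: "norm_sq M (\<lambda>x. c * f x) = (cmod c)\<^sup>2 * norm_sq M f"
  by (simp add: norm_sq_def norm_mult power_mult_distrib)

lemma sq_int_add:
  assumes f: "sq_int M f" and g: "sq_int M g"
  shows "sq_int M (\<lambda>x. f x + g x)"
proof -
  have i: "integrable M (\<lambda>x. 2 * (cmod (f x))\<^sup>2 + 2 * (cmod (g x))\<^sup>2)"
    using f g by (simp add: sq_int_def)
  have le: "(cmod (f x + g x))\<^sup>2 \<le> norm (2 * (cmod (f x))\<^sup>2 + 2 * (cmod (g x))\<^sup>2)" for x
  proof -
    have "(cmod (f x + g x))\<^sup>2 \<le> (cmod (f x) + cmod (g x))\<^sup>2"
      by (intro power_mono norm_triangle_ineq) auto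
    also have "\<dots> \<le> 2 * (cmod (f x))\<^sup>2 + 2 * (cmod (g x))\<^sup>2"
      using sum_squares_bound[of "cmod (f x)" "cmod (g x)"] by (simp add: power2_sum)
    finally show ?thesis by simp
  qed
  have "integrable M (\<lambda>x. (cmod (f x + g x))\<^sup>2)"
    by (rule Bochner_Integration.integrable_bound[OF i]) (use f g le in \<open>auto intro!: AE_I2\<close>)
  then show ?thesis using f g by (auto simp: sq_int_def)
qed

lemma sq_int_diff:
  assumes f: "sq_int M f" and g: "sq_int M g"
  shows "sq_int M (\<lambda>x. f x - g x)"
  using sq_int_add[OF f sq_int_cmult[OF g, of "-1"]] by simp

lemma sq_int_sum: "(\<And>i. i \<in> I \<Longrightarrow> sq_int M (f i)) \<Longrightarrow> sq_int M (\<lambda>x. \<Sum>i\<in>I. f i x)"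
proof (induction I rule: infinite_finite_induct)
  case (insert i I)
  then show ?case using sq_int_add[of M "f i" "\<lambda>x. \<Sum>i\<in>I. f i x"] by simp
qed (simp_all add: sq_int_def)

lemma sq_int_of_bounded:
  assumes "finite_measure M" "f \<in> borel_measurable M" "\<And>x. x \<in> space M \<Longrightarrow> cmod (f x) \<le> B"
  shows "sq_int M f"
proof -
  interpret finite_measure M by fact
  have "sq_int M (\<lambda>_. 1)" by (simp add: sq_int_def)
  from sq_int_bounded_mult(1)[OF this assms(2,3)] show ?thesis by simp
qed

lemma sq_int_integrable: "finite_measure M \<Longrightarrow> sq_int M f \<Longrightarrow> integrable M f"
  using sq_int_mult_integrable[of M f "\<lambda>_. 1", OF _ sq_int_of_bounded[of M "\<lambda>_. 1" 1]] by simp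

lemma norm_sq_eq_integral: "complex_of_real (norm_sq M f) = (\<integral>x. f x * cnj (f x) \<partial>M)"
  unfolding norm_sq_def by (simp add: complex_norm_square flip: integral_complex_of_real of_real_power)

text \<open>Discriminant of the nonnegative quadratic obtained by integrating (x |f| + |g|)^2.
  Working with moduli keeps the argument real.\<close>

lemma Cauchy_Schwarz_integral:
  assumes f: "sq_int M f" and g: "sq_int M g"
  shows "(cmod (\<integral>x. f x * g x \<partial>M))\<^sup>2 \<le> norm_sq M f * norm_sq M g"
proof -
  define a b where "a = norm_sq M f" and "b = norm_sq M g"
  define I where "I = (\<integral>x. cmod (f x) * cmod (g x) \<partial>M)"
  have ifg: "integrable M (\<lambda>x. cmod (f x) * cmod (g x))"
    using integrable_norm[OF sq_int_mult_integrable[OF f g]] by (simp add: norm_mult)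
  have quad: "0 \<le> a * x\<^sup>2 + 2 * I * x + b" for x
  proof -
    have "0 \<le> (\<integral>y. (x * cmod (f y) + cmod (g y))\<^sup>2 \<partial>M)" by simp
    also have "\<dots> = (\<integral>y. x\<^sup>2 * (cmod (f y))\<^sup>2 + 2 * x * (cmod (f y) * cmod (g y)) + (cmod (g y))\<^sup>2 \<partial>M)"
      by (simp add: power2_sum power_mult_distrib algebra_simps)
    also have "\<dots> = x\<^sup>2 * a + 2 * x * I + b"
      using f g ifg by (simp add: a_def b_def I_def norm_sq_def sq_int_def)
    finally show ?thesis by (simp add: algebra_simps)
  qed
  have "I\<^sup>2 \<le> a * b"
  proof (cases "a = 0")
    case True
    have "I = 0"
    proof (rule ccontr)
      assume "I \<noteq> 0"
      \<comment> \<open>For \<open>a = 0\<close> the quadratic is linear, and at this point it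
        equals -1.\<close>
      then show False using quad[of "- (b + 1) / (2 * I)"] True by (simp add: field_simps)
    qed
    then show ?thesis using True by simp
  next
    case False
    then have "a > 0" using norm_sq_nonneg[of M f] by (simp add: a_def order_less_le)
    then show ?thesis using quad[of "- I / a"] by (simp add: field_simps power2_eq_square)
  qed
  moreover have "cmod (\<integral>x. f x * g x \<partial>M) \<le> I"
    using integral_norm_bound[of M "\<lambda>x. f x * g x"] by (simp add: I_def norm_mult)
  ultimately show ?thesis
    using power_mono[of "cmod (\<integral>x. f x * g x \<partial>M)" I 2] by (simp add: a_def b_def)
qed

lemma Cauchy_Schwarz_integral_cnj:
  assumes f: "sq_int M f" and g: "sq_int M g"
  shows "cmod (\<integral>x. f x * cnj (g x) \<partial>M) \<le> sqrt (norm_sq M f) * sqrt (norm_sq M g)"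
proof -
  have "(cmod (\<integral>x. f x * cnj (g x) \<partial>M))\<^sup>2 \<le> norm_sq M f * norm_sq M g"
    using Cauchy_Schwarz_integral[OF f, of "\<lambda>x. cnj (g x)"] g by (simp add: norm_sq_def)
  then show ?thesis
    by (metis norm_ge_zero real_le_rsqrt real_sqrt_mult)
qed

lemma Re_integral_cnj_le:
  assumes f: "sq_int M f" and g: "sq_int M g"
  shows "Re (\<integral>x. f x * cnj (g x) \<partial>M) \<le> sqrt (norm_sq M f) * sqrt (norm_sq M g)"
  using Cauchy_Schwarz_integral_cnj[OF f g] complex_Re_le_cmod order_trans by blast

lemma norm_sq_add:
  assumes f: "sq_int M f" and g: "sq_int M g"
  shows "norm_sq M (\<lambda>x. f x + g x) = norm_sq M f + 2 * Re (\<integral>x. f x * cnj (g x) \<partial>M) + norm_sq M g"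
proof -
  note i = sq_int_mult_cnj_integrable[OF f f] sq_int_mult_cnj_integrable[OF f g]
    sq_int_mult_cnj_integrable[OF g f] sq_int_mult_cnj_integrable[OF g g]
  have "(\<integral>x. g x * cnj (f x) \<partial>M) = (\<integral>x. cnj (f x * cnj (g x)) \<partial>M)"
    by (simp add: mult.commute)
  also have "\<dots> = cnj (\<integral>x. f x * cnj (g x) \<partial>M)"
    by (rule Bochner_Integration.integral_cnj)
  finally have sym: "(\<integral>x. g x * cnj (f x) \<partial>M) = cnj (\<integral>x. f x * cnj (g x) \<partial>M)" .
  have "complex_of_real (norm_sq M (\<lambda>x. f x + g x)) =
      (\<integral>x. f x * cnj (f x) + f x * cnj (g x) + (g x * cnj (f x) + g x * cnj (g x)) \<partial>M)"
    unfolding norm_sq_eq_integral by (simp add: algebra_simps)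
  also have "\<dots> = norm_sq M f + (\<integral>x. f x * cnj (g x) \<partial>M)
      + (cnj (\<integral>x. f x * cnj (g x) \<partial>M) + norm_sq M g)"
    using i by (simp add: norm_sq_eq_integral sym)
  finally show ?thesis
    by (simp add: complex_eq_iff)
qed

lemma norm_sq_diff_commute: "norm_sq M (\<lambda>x. f x - g x) = norm_sq M (\<lambda>x. g x - f x)"
  by (simp add: norm_sq_def norm_minus_commute)

lemma Minkowski_norm_sq:
  assumes f: "sq_int M f" and g: "sq_int M g"
  shows "sqrt (norm_sq M (\<lambda>x. f x + g x)) \<le> sqrt (norm_sq M f) + sqrt (norm_sq M g)"
proof -
  from Re_integral_cnj_le[OF f g] have "norm_sq M (\<lambda>x. f x + g x) \<le> (sqrt (norm_sq M f) + sqrt (norm_sq M g))\<^sup>2"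
    by (simp add: norm_sq_add[OF f g] power2_sum)
  then show ?thesis
    by (intro real_le_lsqrt) auto
qed

lemma norm_sq_add_le:
  assumes f: "sq_int M f" and g: "sq_int M g"
  shows "norm_sq M (\<lambda>x. f x + g x) \<le> 2 * norm_sq M f + 2 * norm_sq M g"
proof -
  note Re_integral_cnj_le[OF f g]
  moreover have "2 * (sqrt (norm_sq M f) * sqrt (norm_sq M g)) \<le> norm_sq M f + norm_sq M g"
    using sum_squares_bound[of "sqrt (norm_sq M f)" "sqrt (norm_sq M g)"] by simp
  ultimately show ?thesis
    by (simp add: norm_sq_add[OF f g])
qed

subsection \<open>Fourier series on the circle\<close>

text \<open>The half-open period matches \<open>cell\<close>, so that the measure on the torus is
  exactly the product of two copies.\<close>

definition circ :: "real measure" where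
  "circ = restrict_space lborel {0..<1}"

definition fmode :: "int \<Rightarrow> real \<Rightarrow> complex" where
  "fmode m y = cis (2 * pi * of_int m * y)"

text \<open>An enumeration of the integers, which turns two-sided Fourier series into ordinary
  series.\<close>

definition freq :: "nat \<Rightarrow> int" where
  "freq = int_decode"

definition fcoef :: "(real \<Rightarrow> complex) \<Rightarrow> nat \<Rightarrow> complex" where
  "fcoef g j = (\<integral>y. g y * cnj (fmode (freq j) y) \<partial>circ)"

lemma space_circ [simp]: "space circ = {0..<1}"
  by (simp add: circ_def space_restrict_space)

lemma measurable_circ [measurable (raw)]: "f \<in> borel_measurable borel \<Longrightarrow> f \<in> borel_measurable circ"
  by (simp add: circ_def measurable_restrict_space1)

lemma emeasure_circ: "A \<in> sets borel \<Longrightarrow> emeasure circ (A \<inter> {0..<1}) = emeasure lborel (A \<inter> {0..<1})"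
  unfolding circ_def by (subst emeasure_restrict_space) auto

lemma sets_circ: "A \<in> sets borel \<Longrightarrow> A \<inter> {0..<1} \<in> sets circ"
  by (auto simp: circ_def sets_restrict_space)

lemma prob_space_circ: "emeasure circ (space circ) = 1"
  using emeasure_circ[of UNIV] by simp

lemma finite_measure_circ: "finite_measure circ"
  by (rule finite_measureI) (simp add: prob_space_circ del: space_circ)

interpretation circ: finite_measure circ
  by (rule finite_measure_circ)

lemma measure_circ: "measure circ {0..<1} = 1"
  using prob_space_circ by (simp add: measure_def)

lemma integral_circ: "(\<integral>y. f y \<partial>circ) = (LINT y:{0..<1}|lborel. f y)"
  for f :: "real \<Rightarrow> 'a :: {banach, second_countable_topology}"
  unfolding circ_def set_lebesgue_integral_def by (subst integral_restrict_space) auto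

lemma integrable_circ: "integrable circ f \<longleftrightarrow> set_integrable lborel {0..<1} f"
  for f :: "real \<Rightarrow> 'a :: {banach, second_countable_topology}"
  unfolding circ_def set_integrable_def by (subst integrable_restrict_space) auto

text \<open>The endpoint 1 is a null set; passing to the closed interval makes the fundamental
  theorem of calculus applicable. Measurability is known on {0..<1} only, so the value at 1 is added
  by hand.\<close>

lemma integral_circ_closed:
  fixes f :: "real \<Rightarrow> 'a :: {banach, second_countable_topology}"
  assumes "f \<in> borel_measurable circ"
  shows "(\<integral>y. f y \<partial>circ) = (\<integral>y. indicator {0..1} y *\<^sub>R f y \<partial>lborel)"
proof -
  have m: "(\<lambda>y. indicator {0..<1} y *\<^sub>R f y) \<in> borel_measurable borel"
    using assms unfolding circ_def by (subst (asm) borel_measurable_restrict_space_iff) auto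
  have eq: "AE y in lborel. indicator {0..<1} y *\<^sub>R f y = indicator {0..1} y *\<^sub>R f y"
    using AE_lborel_singleton[of "1::real"] by eventually_elim (auto simp: indicator_def)
  have m': "(\<lambda>y. indicator {0..1} y *\<^sub>R f y) \<in> borel_measurable borel"
  proof -
    have "(\<lambda>y. indicator {0..1} y *\<^sub>R f y) =
        (\<lambda>y. indicator {0..<1} y *\<^sub>R f y + indicator {1} y *\<^sub>R f 1)"
      by (auto simp: fun_eq_iff indicator_def)
    then show ?thesis using m by simp
  qed
  show ?thesis
    unfolding integral_circ set_lebesgue_integral_def
    by (rule integral_cong_AE) (use m m' eq in auto)
qed

lemma borel_measurable_circ_continuous_on:
  fixes f :: "real \<Rightarrow> 'a :: topological_space"
  assumes "continuous_on {0..1} f"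
  shows "f \<in> borel_measurable circ"
  unfolding circ_def measurable_cong_sets[OF sets_restrict_space_cong[OF sets_lborel] refl]
  by (rule borel_measurable_continuous_on_restrict) (rule continuous_on_subset[OF assms], auto)

lemma integral_circ_FTC:
  fixes F :: "real \<Rightarrow> 'a :: euclidean_space"
  assumes "\<And>x. 0 \<le> x \<Longrightarrow> x \<le> 1 \<Longrightarrow> (F has_vector_derivative f x) (at x within {0..1})"
    and c: "continuous_on {0..1} f"
  shows "(\<integral>y. f y \<partial>circ) = F 1 - F 0"
  using integral_FTC_atLeastAtMost[of 0 1 F f] assms borel_measurable_circ_continuous_on[OF c]
  by (simp add: integral_circ_closed)

lemma cmod_fmode [simp]: "cmod (fmode m y) = 1"
  by (simp add: fmode_def)

lemma fmode_measurable [measurable]: "fmode m \<in> borel_measurable borel"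
  unfolding fmode_def by (intro borel_measurable_continuous_onI continuous_intros)

lemma fmode_mult: "fmode m y * fmode n y = fmode (m + n) y"
  by (simp add: fmode_def cis_mult algebra_simps)

lemma cnj_fmode: "cnj (fmode m y) = fmode (- m) y"
  by (simp add: fmode_def cis_cnj)

lemma fmode_shift: "fmode m (y + h) = fmode m h * fmode m y"
  by (simp add: fmode_def cis_mult algebra_simps)

lemma fmode_int [simp]: "fmode m 0 = 1" "fmode m 1 = 1"
  using cis_multiple_2pi[of "of_int m"] by (simp_all add: fmode_def ac_simps)

lemma fmode_zero [simp]: "fmode 0 y = 1"
  by (simp add: fmode_def)

lemma periodic1_fmode: "periodic1 (fmode m)"
  by (simp add: periodic1_def fmode_shift)

lemma sq_int_fmode: "sq_int circ (fmode m)"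
  by (rule sq_int_of_bounded[OF finite_measure_circ, where B = 1]) auto

lemma fmode_has_vector_derivative:
  "(fmode m has_vector_derivative (2 * pi * of_int m * \<i>) * fmode m y) (at y within A)"
proof -
  define a where "a = 2 * pi * of_int m * \<i>"
  have eq: "fmode m = (\<lambda>y. exp (a * of_real y))"
    by (simp add: fun_eq_iff fmode_def cis_conv_exp a_def mult_ac)
  have "((\<lambda>z. exp (a * z)) has_field_derivative a * exp (a * of_real y)) (at (of_real y))"
    by (auto intro!: derivative_eq_intros)
  from has_vector_derivative_real_field[OF this] show ?thesis
    by (simp add: eq a_def)
qed

lemma integral_fmode: "(\<integral>y. fmode m y \<partial>circ) = (if m = 0 then 1 else 0)"
proof (cases "m = 0")
  case True
  then show ?thesis by (simp add: measure_circ)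
next
  case False
  define a where "a = 2 * pi * of_int m * \<i>"
  have a: "a \<noteq> 0" using False by (simp add: a_def)
  have "(\<integral>y. a * fmode m y \<partial>circ) = fmode m 1 - fmode m 0"
    unfolding a_def
    by (rule integral_circ_FTC, rule fmode_has_vector_derivative)
      (auto simp: fmode_def intro!: continuous_intros)
  then show ?thesis using a False by simp
qed

lemma integral_fmode_cnj: "(\<integral>y. fmode m y * cnj (fmode n y) \<partial>circ) = (if m = n then 1 else 0)"
  by (simp add: cnj_fmode fmode_mult integral_fmode)

lemma freq_eq [simp]: "freq i = freq j \<longleftrightarrow> i = j"
  by (simp add: freq_def int_decode_eq)

lemma surj_freq: "\<exists>j. freq j = m"
  unfolding freq_def using int_encode_inverse by blast

lemma fcoef_integrable: "sq_int circ g \<Longrightarrow> integrable circ (\<lambda>y. g y * cnj (fmode m y))"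
  by (rule sq_int_mult_cnj_integrable) (auto intro: sq_int_fmode)

lemma fcoef_add: "sq_int circ f \<Longrightarrow> sq_int circ g \<Longrightarrow> fcoef (\<lambda>y. f y + g y) j = fcoef f j + fcoef g j"
  unfolding fcoef_def by (simp add: distrib_right fcoef_integrable)

lemma fcoef_cmult: "fcoef (\<lambda>y. c * f y) j = c * fcoef f j"
  unfolding fcoef_def by (simp add: mult.assoc)

lemma fcoef_diff: "sq_int circ f \<Longrightarrow> sq_int circ g \<Longrightarrow> fcoef (\<lambda>y. f y - g y) j = fcoef f j - fcoef g j"
  unfolding fcoef_def by (simp add: left_diff_distrib fcoef_integrable)

definition fsum :: "nat \<Rightarrow> (nat \<Rightarrow> complex) \<Rightarrow> real \<Rightarrow> complex" where
  "fsum n c y = (\<Sum>j<n. c j * fmode (freq j) y)"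

lemma sq_int_fsum: "sq_int circ (fsum n c)"
  unfolding fsum_def by (intro sq_int_sum sq_int_cmult sq_int_fmode)

lemma integral_mult_cnj_fsum:
  assumes "sq_int circ g"
  shows "(\<integral>y. g y * cnj (fsum n c y) \<partial>circ) = (\<Sum>j<n. fcoef g j * cnj (c j))"
proof -
  have "(\<integral>y. g y * cnj (fsum n c y) \<partial>circ) =
      (\<integral>y. (\<Sum>j<n. cnj (c j) * (g y * cnj (fmode (freq j) y))) \<partial>circ)"
    by (simp add: fsum_def sum_distrib_left mult_ac)
  also have "\<dots> = (\<Sum>j<n. cnj (c j) * (\<integral>y. g y * cnj (fmode (freq j) y) \<partial>circ))"
    by (subst Bochner_Integration.integral_sum)
      (auto intro!: Bochner_Integration.integrable_mult_right fcoef_integrable assms simp del: integrable_mult_right_iff)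
  finally show ?thesis by (simp add: fcoef_def mult.commute)
qed

lemma fcoef_fsum: "fcoef (fsum n c) j = (if j < n then c j else 0)"
proof -
  have "fcoef (fsum n c) j = (\<integral>y. (\<Sum>i<n. c i * (fmode (freq i) y * cnj (fmode (freq j) y))) \<partial>circ)"
    by (simp add: fcoef_def fsum_def sum_distrib_right mult.assoc)
  also have "\<dots> = (\<Sum>i<n. c i * (\<integral>y. fmode (freq i) y * cnj (fmode (freq j) y) \<partial>circ))"
    by (subst Bochner_Integration.integral_sum)
      (auto intro!: Bochner_Integration.integrable_mult_right fcoef_integrable sq_int_fmode simp del: integrable_mult_right_iff)
  also have "\<dots> = (\<Sum>i<n. if i = j then c i else 0)"
    by (intro sum.cong) (auto simp: integral_fmode_cnj)
  finally show ?thesis by simp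
qed

text \<open>The residual is orthogonal to the partial sum, so this is Pythagoras; Bessel's
  inequality follows at once.\<close>

lemma norm_sq_residual:
  assumes g: "sq_int circ g"
  shows "norm_sq circ (\<lambda>y. g y - fsum n (fcoef g) y) = norm_sq circ g - (\<Sum>j<n. (cmod (fcoef g j))\<^sup>2)"
proof -
  let ?p = "fsum n (fcoef g)" and ?r = "\<lambda>y. g y - fsum n (fcoef g) y"
  let ?s = "\<Sum>j<n. (cmod (fcoef g j))\<^sup>2"
  note p = sq_int_fsum[of n "fcoef g"]
  have r: "sq_int circ ?r" by (rule sq_int_diff[OF g p])
  have "(\<integral>y. ?p y * cnj (?p y) \<partial>circ) = complex_of_real ?s"
    unfolding integral_mult_cnj_fsum[OF p] by (simp add: fcoef_fsum complex_norm_square flip: of_real_power)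
  then have np: "norm_sq circ ?p = ?s"
    using norm_sq_eq_integral[of circ ?p] of_real_eq_iff by metis
  have "(\<integral>y. ?r y * cnj (?p y) \<partial>circ) = 0"
    unfolding integral_mult_cnj_fsum[OF r] by (simp add: fcoef_diff[OF g p] fcoef_fsum)
  then show ?thesis
    using norm_sq_add[OF r p] np by simp
qed

lemma Bessel: "sq_int circ g \<Longrightarrow> (\<Sum>j<n. (cmod (fcoef g j))\<^sup>2) \<le> norm_sq circ g"
  using norm_sq_residual[of g n] norm_sq_nonneg[of circ "\<lambda>y. g y - fsum n (fcoef g) y"] by simp

lemma Bessel_finite:
  assumes "sq_int circ g" "finite A"
  shows "(\<Sum>j\<in>A. (cmod (fcoef g j))\<^sup>2) \<le> norm_sq circ g"
proof -
  obtain n where "A \<subseteq> {..<n}" using finite_nat_iff_bounded[of A] assms(2) by auto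
  then have "(\<Sum>j\<in>A. (cmod (fcoef g j))\<^sup>2) \<le> (\<Sum>j<n. (cmod (fcoef g j))\<^sup>2)"
    by (intro sum_mono2) auto
  then show ?thesis using Bessel[OF assms(1), of n] by simp
qed

text \<open>Parseval's identity as a property of a single function. The class of functions having it
  is closed under linear combinations and dominated limits, and completeness of the characters is
  proved by enlarging this class from one explicit function to all of L2.\<close>

definition parseval :: "(real \<Rightarrow> complex) \<Rightarrow> bool" where
  "parseval g \<longleftrightarrow> sq_int circ g \<and> (\<lambda>j. (cmod (fcoef g j))\<^sup>2) sums norm_sq circ g"

text \<open>Bessel bounds the increasing partial sums from above, so it suffices to come close to
  the norm on finite sets of indices. These can be symmetric ranges of frequencies, whatever the
  enumeration \<open>freq\<close>.\<close>

lemma parsevalI: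
  assumes g: "sq_int circ g"
    and *: "\<And>e. e > 0 \<Longrightarrow> \<exists>A. finite A \<and> norm_sq circ g - e \<le> (\<Sum>j\<in>A. (cmod (fcoef g j))\<^sup>2)"
  shows "parseval g"
proof -
  have "(\<lambda>n. \<Sum>j<n. (cmod (fcoef g j))\<^sup>2) \<longlonglongrightarrow> norm_sq circ g"
  proof (rule LIMSEQ_I)
    fix r :: real assume "r > 0"
    then obtain A where A: "finite A" "norm_sq circ g - r / 2 \<le> (\<Sum>j\<in>A. (cmod (fcoef g j))\<^sup>2)"
      using *[of "r / 2"] by auto
    obtain N where N: "A \<subseteq> {..<N}" using finite_nat_iff_bounded[of A] A(1) by auto
    show "\<exists>N. \<forall>n\<ge>N. norm ((\<Sum>j<n. (cmod (fcoef g j))\<^sup>2) - norm_sq circ g) < r"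
    proof (intro exI allI impI)
      fix n assume "n \<ge> N"
      then have "(\<Sum>j\<in>A. (cmod (fcoef g j))\<^sup>2) \<le> (\<Sum>j<n. (cmod (fcoef g j))\<^sup>2)"
        using N by (intro sum_mono2) auto
      then show "norm ((\<Sum>j<n. (cmod (fcoef g j))\<^sup>2) - norm_sq circ g) < r"
        using A(2) Bessel[OF g, of n] \<open>r > 0\<close> by simp
    qed
  qed
  then show ?thesis using g by (simp add: parseval_def sums_def)
qed

text \<open>The residual depends linearly on the function, which the series of squares does not;
  closure properties are therefore proved in this form.\<close>

lemma parseval_residual:
  "parseval g \<longleftrightarrow> sq_int circ g \<and> (\<lambda>n. norm_sq circ (\<lambda>y. g y - fsum n (fcoef g) y)) \<longlonglongrightarrow> 0"
proof (cases "sq_int circ g")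
  case True
  have "((\<lambda>n. \<Sum>j<n. (cmod (fcoef g j))\<^sup>2) \<longlonglongrightarrow> norm_sq circ g) \<longleftrightarrow>
      (\<lambda>n. (\<Sum>j<n. (cmod (fcoef g j))\<^sup>2) - norm_sq circ g) \<longlonglongrightarrow> 0"
    by (rule LIM_zero_iff[symmetric])
  also have "\<dots> \<longleftrightarrow> (\<lambda>n. - ((\<Sum>j<n. (cmod (fcoef g j))\<^sup>2) - norm_sq circ g)) \<longlonglongrightarrow> 0"
    by (rule tendsto_minus_cancel_left[of _ 0, simplified])
  finally show ?thesis
    using True by (simp add: parseval_def sums_def norm_sq_residual)
qed (simp add: parseval_def)

lemma parseval_add:
  assumes f: "parseval f" and g: "parseval g"
  shows "parseval (\<lambda>y. f y + g y)"
proof -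
  have sq: "sq_int circ f" "sq_int circ g" using f g by (auto simp: parseval_def)
  let ?r = "\<lambda>h n. norm_sq circ (\<lambda>y. h y - fsum n (fcoef h) y)"
  have "?r (\<lambda>y. f y + g y) n \<le> 2 * ?r f n + 2 * ?r g n" for n
  proof -
    have "(\<lambda>y. f y + g y - fsum n (fcoef (\<lambda>y. f y + g y)) y) =
        (\<lambda>y. (f y - fsum n (fcoef f) y) + (g y - fsum n (fcoef g) y))"
      by (simp add: fun_eq_iff fsum_def fcoef_add[OF sq] distrib_right sum.distrib)
    then show ?thesis
      using norm_sq_add_le[OF sq_int_diff[OF sq(1) sq_int_fsum] sq_int_diff[OF sq(2) sq_int_fsum]]
      by simp
  qed
  moreover have "(\<lambda>n. 2 * ?r f n + 2 * ?r g n) \<longlonglongrightarrow> 2 * 0 + 2 * 0"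
    using f g by (intro tendsto_intros) (auto simp: parseval_residual)
  ultimately have "?r (\<lambda>y. f y + g y) \<longlonglongrightarrow> 0"
    by (intro tendsto_sandwich[of "\<lambda>_. 0" "?r (\<lambda>y. f y + g y)" sequentially
          "\<lambda>n. 2 * ?r f n + 2 * ?r g n" 0]) auto
  then show ?thesis using sq by (simp add: parseval_residual sq_int_add)
qed

lemma parseval_cmult: "parseval f \<Longrightarrow> parseval (\<lambda>y. c * f y)"
  by (auto simp: parseval_def sq_int_cmult norm_sq_cmult fcoef_cmult norm_mult power_mult_distrib
      intro: sums_mult)

lemma parseval_sum: "(\<And>i. i \<in> I \<Longrightarrow> parseval (f i)) \<Longrightarrow> parseval (\<lambda>y. \<Sum>i\<in>I. f i y)"
proof (induction I rule: infinite_finite_induct)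
  case (insert i I)
  then show ?case using parseval_add[of "f i" "\<lambda>y. \<Sum>i\<in>I. f i y"] by simp
qed (simp_all add: parseval_def sq_int_def norm_sq_def fcoef_def)

lemma parseval_const: "parseval (\<lambda>y. c)"
proof -
  obtain j where j: "freq j = 0" using surj_freq by blast
  have "parseval (\<lambda>y. 1)"
  proof (rule parsevalI)
    show "sq_int circ (\<lambda>y. 1)" by (rule sq_int_of_bounded[OF finite_measure_circ, where B = 1]) auto
    fix e :: real assume "e > 0"
    then show "\<exists>A. finite A \<and> norm_sq circ (\<lambda>y. 1) - e \<le> (\<Sum>j\<in>A. (cmod (fcoef (\<lambda>y. 1) j))\<^sup>2)"
      by (intro exI[of _ "{j}"]) (simp add: fcoef_def j norm_sq_def measure_circ)
  qed
  from parseval_cmult[OF this, of c] show ?thesis by simp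
qed

lemma parseval_cong:
  assumes "parseval f" "\<And>y. y \<in> {0..<1} \<Longrightarrow> f y = g y"
  shows "parseval g"
proof -
  have "fcoef f j = fcoef g j" for j
    unfolding fcoef_def by (rule Bochner_Integration.integral_cong) (auto simp: assms(2))
  moreover have "norm_sq circ f = norm_sq circ g"
    unfolding norm_sq_def by (rule Bochner_Integration.integral_cong) (auto simp: assms(2))
  moreover have "sq_int circ f \<longleftrightarrow> sq_int circ g"
    unfolding sq_int_def by (intro conj_cong measurable_cong Bochner_Integration.integrable_cong) (auto simp: assms(2))
  ultimately show ?thesis using assms(1) by (simp add: parseval_def)
qed

text \<open>Dominated pointwise limits are L2 limits, and passing to the residual does not increase
  the norm. Up to a factor 2, the residual of \<open>g\<close> is thus at most that of
  \<open>s i\<close> plus an error that is small in \<open>i\<close> uniformly in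
  \<open>n\<close>.\<close>

lemma parseval_limit:
  assumes s: "\<And>i. parseval (s i)" and g: "g \<in> borel_measurable circ"
    and h: "integrable circ (\<lambda>y. (h y :: real)\<^sup>2)"
    and lim: "\<And>y. y \<in> {0..<1} \<Longrightarrow> (\<lambda>i. s i y) \<longlonglongrightarrow> g y"
    and bd: "\<And>i y. y \<in> {0..<1} \<Longrightarrow> cmod (s i y) \<le> h y"
  shows "parseval g"
proof -
  have s': "\<And>i. sq_int circ (s i)" using s by (simp add: parseval_def)
  have gh: "cmod (g y) \<le> h y" if "y \<in> {0..<1}" for y
    by (rule LIMSEQ_le_const2[OF tendsto_norm[OF lim[OF that]]]) (intro exI allI impI bd that)
  have gs: "sq_int circ g"
    unfolding sq_int_def
  proof (intro conjI g Bochner_Integration.integrable_bound[OF h])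
    show "AE y in circ. norm ((cmod (g y))\<^sup>2) \<le> norm ((h y)\<^sup>2)"
      by (rule AE_I2) (use gh in \<open>auto intro!: power_mono\<close>)
  qed (use g in measurable)
  have "(\<lambda>i. \<integral>y. (cmod (g y - s i y))\<^sup>2 \<partial>circ) \<longlonglongrightarrow> (\<integral>y. 0 \<partial>circ)"
  proof (rule integral_dominated_convergence[where w = "\<lambda>y. 4 * (h y)\<^sup>2"])
    show "(\<lambda>y. (cmod (g y - s i y))\<^sup>2) \<in> borel_measurable circ" for i
      using gs s'[of i] by measurable
    show "AE y in circ. (\<lambda>i. (cmod (g y - s i y))\<^sup>2) \<longlonglongrightarrow> 0"
    proof (rule AE_I2)
      fix y assume "y \<in> space circ"
      then have "(\<lambda>i. (cmod (g y - s i y))\<^sup>2) \<longlonglongrightarrow> (cmod (g y - g y))\<^sup>2"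
        by (intro tendsto_intros lim) auto
      then show "(\<lambda>i. (cmod (g y - s i y))\<^sup>2) \<longlonglongrightarrow> 0" by simp
    qed
    show "AE y in circ. norm ((cmod (g y - s i y))\<^sup>2) \<le> 4 * (h y)\<^sup>2" for i
    proof (rule AE_I2)
      fix y assume "y \<in> space circ"
      then have "cmod (g y - s i y) \<le> 2 * h y"
        using norm_triangle_ineq4[of "g y" "s i y"] gh[of y] bd[of y i] by simp
      then have "(cmod (g y - s i y))\<^sup>2 \<le> (2 * h y)\<^sup>2" by (intro power_mono) auto
      then show "norm ((cmod (g y - s i y))\<^sup>2) \<le> 4 * (h y)\<^sup>2" by (simp add: power_mult_distrib)
    qed
  qed (use h in auto)
  then have conv: "(\<lambda>i. norm_sq circ (\<lambda>y. g y - s i y)) \<longlonglongrightarrow> 0" by (simp add: norm_sq_def)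
  let ?r = "\<lambda>h n. norm_sq circ (\<lambda>y. h y - fsum n (fcoef h) y)"
  have le: "?r g n \<le> 2 * norm_sq circ (\<lambda>y. g y - s i y) + 2 * ?r (s i) n" for i n
  proof -
    let ?d = "\<lambda>y. g y - s i y"
    have d: "sq_int circ ?d" by (rule sq_int_diff[OF gs s'])
    have "(\<lambda>y. g y - fsum n (fcoef g) y) =
        (\<lambda>y. (?d y - fsum n (fcoef ?d) y) + (s i y - fsum n (fcoef (s i)) y))"
      by (simp add: fun_eq_iff fsum_def fcoef_diff[OF gs s'] left_diff_distrib sum_subtractf)
    moreover have "?r ?d n \<le> norm_sq circ ?d"
      unfolding norm_sq_residual[OF d] by (simp add: sum_nonneg)
    ultimately show ?thesis
      using norm_sq_add_le[OF sq_int_diff[OF d sq_int_fsum] sq_int_diff[OF s' sq_int_fsum], of n "fcoef ?d" i n "fcoef (s i)"]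
      by simp
  qed
  have "?r g \<longlonglongrightarrow> 0"
  proof (rule LIMSEQ_I)
    fix r :: real assume r: "r > 0"
    obtain i where i: "norm_sq circ (\<lambda>y. g y - s i y) < r / 4"
      using LIMSEQ_D[OF conv, of "r / 4"] r by fastforce
    have "?r (s i) \<longlonglongrightarrow> 0" using s[of i] by (simp add: parseval_residual)
    then obtain N where N: "\<And>n. n \<ge> N \<Longrightarrow> ?r (s i) n < r / 4"
      using LIMSEQ_D[of "?r (s i)" 0 "r / 4"] r by fastforce
    show "\<exists>N. \<forall>n\<ge>N. norm (?r g n - 0) < r"
    proof (intro exI allI impI)
      fix n assume "n \<ge> N"
      then show "norm (?r g n - 0) < r" using le[of n i] i N[of n] r by simp
    qed
  qed
  then show ?thesis using gs by (simp add: parseval_residual)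
qed

section \<open>Translations and completeness of the characters\<close>

lemma integral_circ_shift:
  fixes f :: "real \<Rightarrow> 'a :: euclidean_space"
  assumes per: "periodic1 f" and f: "f \<in> borel_measurable borel" and i: "integrable circ f"
    and a: "0 \<le> a" "a \<le> 1"
  shows "integrable circ (\<lambda>y. f (y + a))" "(\<integral>y. f (y + a) \<partial>circ) = (\<integral>y. f y \<partial>circ)"
proof -
  have i0: "integrable lborel (\<lambda>y. indicator {0..<1} y *\<^sub>R f y)"
    using i by (simp add: integrable_circ set_integrable_def)
  have p: "f (y + 1) = f y" for y using per by (simp add: periodic1_def)
  \<comment> \<open>The period is cut at \<open>a\<close>: after the shift, [a, 1) fills [0, 1 - a)
    and [0, a) wraps around to [1 - a, 1).\<close>
  define g where "g = (\<lambda>y. indicator {a..<1} y *\<^sub>R f y)"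
  define h where "h = (\<lambda>y. indicator {0..<a} y *\<^sub>R f y)"
  have int_sub: "integrable lborel (\<lambda>y. indicator A y *\<^sub>R f y)" if "A \<subseteq> {0..<1}" "A \<in> sets borel" for A
  proof -
    have "set_integrable lborel A f"
      using i0 that by (intro set_integrable_subset[of lborel "{0..<1}" f A]) (auto simp: set_integrable_def)
    then show ?thesis by (simp add: set_integrable_def)
  qed
  have g: "integrable lborel g" and h: "integrable lborel h"
    unfolding g_def h_def using a by (auto intro!: int_sub)
  have gi: "integrable lborel (\<lambda>y. g (y + a))" "(\<integral>y. g (y + a) \<partial>lborel) = (\<integral>y. g y \<partial>lborel)"
    using lborel_integrable_real_affine[OF g, of 1 a] lborel_integral_real_affine[of 1 g a]
    by (simp_all add: add.commute)
  have hi: "integrable lborel (\<lambda>y. h (y + (a - 1)))" "(\<integral>y. h (y + (a - 1)) \<partial>lborel) = (\<integral>y. h y \<partial>lborel)"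
    using lborel_integrable_real_affine[OF h, of 1 "a - 1"] lborel_integral_real_affine[of 1 h "a - 1"]
    by (simp_all add: add.commute)
  have eq1: "(\<lambda>y. indicator {0..<1} y *\<^sub>R f (y + a)) = (\<lambda>y. g (y + a) + h (y + (a - 1)))"
  proof
    fix y
    show "indicator {0..<1} y *\<^sub>R f (y + a) = g (y + a) + h (y + (a - 1))"
      using a p[of "y + (a - 1)"] by (auto simp: g_def h_def indicator_def)
  qed
  have eq2: "(\<lambda>y. indicator {0..<1} y *\<^sub>R f y) = (\<lambda>y. g y + h y)"
    using a by (auto simp: g_def h_def indicator_def fun_eq_iff)
  show "integrable circ (\<lambda>y. f (y + a))"
    unfolding integrable_circ set_integrable_def eq1 using gi hi by simp
  show "(\<integral>y. f (y + a) \<partial>circ) = (\<integral>y. f y \<partial>circ)"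
    unfolding integral_circ set_lebesgue_integral_def eq1 eq2 using g h gi hi by simp
qed

lemma sq_int_norm_sq_shift:
  assumes per: "periodic1 g" and m: "g \<in> borel_measurable borel" and g: "sq_int circ g"
    and a: "0 \<le> a" "a \<le> 1"
  shows "sq_int circ (\<lambda>y. g (y + a))" "norm_sq circ (\<lambda>y. g (y + a)) = norm_sq circ g"
    "fcoef (\<lambda>y. g (y + a)) j = fmode (freq j) a * fcoef g j"
proof -
  note m[measurable]
  have 1: "periodic1 (\<lambda>y. (cmod (g y))\<^sup>2)" using per by (simp add: periodic1_def)
  have 2: "(\<lambda>y. (cmod (g y))\<^sup>2) \<in> borel_measurable borel" by measurable
  note s = integral_circ_shift[OF 1 2 _ a]
  have "(\<lambda>y. g (y + a)) \<in> borel_measurable borel" by measurable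
  then show sq: "sq_int circ (\<lambda>y. g (y + a))"
    using s(1) g by (auto simp: sq_int_def)
  show "norm_sq circ (\<lambda>y. g (y + a)) = norm_sq circ g"
    using s(2) g by (auto simp: norm_sq_def sq_int_def)
  have 3: "periodic1 (\<lambda>y. g y * cnj (fmode (freq j) y))"
    using per periodic1_fmode[of "freq j"] by (simp add: periodic1_def)
  have 4: "(\<lambda>y. g y * cnj (fmode (freq j) y)) \<in> borel_measurable borel"
    unfolding cnj_fmode by measurable
  have "fcoef g j = (\<integral>y. g (y + a) * cnj (fmode (freq j) (y + a)) \<partial>circ)"
    unfolding fcoef_def by (rule integral_circ_shift(2)[OF 3 4 fcoef_integrable[OF g] a, symmetric])
  also have "\<dots> = (\<integral>y. cnj (fmode (freq j) a) * (g (y + a) * cnj (fmode (freq j) y)) \<partial>circ)"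
    by (simp add: fmode_shift mult_ac)
  also have "\<dots> = cnj (fmode (freq j) a) * fcoef (\<lambda>y. g (y + a)) j"
    by (simp add: fcoef_def)
  finally have "fmode (freq j) a * fcoef g j = (fmode (freq j) a * cnj (fmode (freq j) a)) * fcoef (\<lambda>y. g (y + a)) j"
    by simp
  then show "fcoef (\<lambda>y. g (y + a)) j = fmode (freq j) a * fcoef g j"
    by (simp add: cnj_fmode fmode_mult)
qed

lemma fcoef_sawtooth:
  "fcoef (\<lambda>y. of_real y) j = (if freq j = 0 then 1 / 2 else \<i> / (2 * pi * of_int (freq j)))"
proof (cases "freq j = 0")
  case True
  have "(\<integral>y. complex_of_real y \<partial>circ) = complex_of_real (1\<^sup>2 / 2) - complex_of_real (0\<^sup>2 / 2)"
    by (rule integral_circ_FTC)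
      (auto intro!: derivative_eq_intros continuous_intros simp: has_vector_derivative_def scaleR_conv_of_real)
  then show ?thesis using True by (simp add: fcoef_def)
next
  case False
  define m where "m = - freq j"
  define a where "a = 2 * pi * of_int m * \<i>"
  have a: "a \<noteq> 0" using False by (simp add: a_def m_def)
  \<comment> \<open>(y / a - 1 / a^2) exp (a y) is an antiderivative of y exp (a y); over a full
    period only the boundary contribution 1 / a survives.\<close>
  have "(\<integral>y. of_real y * fmode m y \<partial>circ) =
      (of_real 1 / a - 1 / a\<^sup>2) * fmode m 1 - (of_real 0 / a - 1 / a\<^sup>2) * fmode m 0"
  proof (rule integral_circ_FTC)
    fix x :: real
    show "((\<lambda>y. (of_real y / a - 1 / a\<^sup>2) * fmode m y) has_vector_derivative of_real x * fmode m x) (at x within {0..1})"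
      by (rule derivative_eq_intros fmode_has_vector_derivative[of m, folded a_def] refl)+
        (use a in \<open>simp_all add: field_simps power2_eq_square\<close>)
  qed (auto simp: fmode_def intro!: continuous_intros)
  also have "\<dots> = 1 / a" by (simp add: field_simps)
  finally have "fcoef (\<lambda>y. of_real y) j = 1 / a" by (simp add: fcoef_def cnj_fmode m_def)
  moreover have "1 / a = \<i> / (2 * pi * of_int (freq j))"
    using False by (simp add: a_def m_def divide_simps)
  ultimately show ?thesis using False by simp
qed

lemma sum_symmetric_int:
  fixes f :: "int \<Rightarrow> real"
  assumes "\<And>m. f (- m) = f m"
  shows "sum f {- int N..int N} = f 0 + 2 * (\<Sum>n=1..N. f (int n))"
proof -
  have "{- int N..int N} = insert 0 (int ` {1..N} \<union> uminus ` int ` {1..N})"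
  proof (intro set_eqI iffI)
    fix m assume m: "m \<in> {- int N..int N}"
    have "m > 0 \<Longrightarrow> m = int (nat m) \<and> nat m \<in> {1..N}" "m < 0 \<Longrightarrow> m = - int (nat (- m)) \<and> nat (- m) \<in> {1..N}"
      using m by auto
    then show "m \<in> insert 0 (int ` {1..N} \<union> uminus ` int ` {1..N})"
      by (cases m "0 :: int" rule: linorder_cases) blast+
  qed auto
  moreover have "int ` {1..N} \<inter> uminus ` int ` {1..N} = {}" "0 \<notin> int ` {1..N} \<union> uminus ` int ` {1..N}" by auto
  ultimately show ?thesis
    by (simp add: sum.union_disjoint sum.reindex assms)
qed

text \<open>The Parseval identity of the sawtooth is Euler's \<open>\<Sum> 1 / n\<^sup>2 = \<pi>\<^sup>2 / 6\<close>; differences of its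
  translates are indicators of intervals, from which completeness follows by approximation.\<close>

lemma parseval_sawtooth: "parseval (\<lambda>y. of_real y)"
proof (rule parsevalI)
  show "sq_int circ (\<lambda>y. complex_of_real y)"
    by (rule sq_int_of_bounded[OF finite_measure_circ, where B = 1]) auto
  have "(\<integral>y. complex_of_real (y\<^sup>2) \<partial>circ) = complex_of_real (1 ^ 3 / 3) - complex_of_real (0 ^ 3 / 3)"
    by (rule integral_circ_FTC)
      (auto intro!: derivative_eq_intros continuous_intros simp: has_vector_derivative_def scaleR_conv_of_real power2_eq_square)
  then have "(\<integral>y. y\<^sup>2 \<partial>circ) = 1 ^ 3 / 3 - 0 ^ 3 / 3"
    by (simp only: integral_complex_of_real of_real_diff[symmetric] of_real_eq_iff)
  then have n: "norm_sq circ (\<lambda>y. complex_of_real y) = 1 / 3"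
    by (simp add: norm_sq_def)
  fix e :: real assume e: "e > 0"
  obtain N where N: "pi\<^sup>2 / 6 - e < (\<Sum>n<N. 1 / (real n + 1)\<^sup>2)"
  proof -
    have "(\<lambda>N. \<Sum>n<N. 1 / (real n + 1)\<^sup>2) \<longlonglongrightarrow> pi\<^sup>2 / 6"
      using inverse_squares_sums by (simp add: sums_def add.commute)
    from order_tendstoD(1)[OF this, of "pi\<^sup>2 / 6 - e"] e
    show ?thesis using that by (auto simp: eventually_sequentially)
  qed
  define A where "A = int_encode ` {- int N..int N}"
  define q where "q = (\<lambda>m::int. if m = 0 then 1 / 4 else 1 / (4 * pi\<^sup>2 * (of_int m)\<^sup>2) :: real)"
  have "(\<Sum>j\<in>A. (cmod (fcoef (\<lambda>y. of_real y) j))\<^sup>2) = (\<Sum>j\<in>A. q (freq j))"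
    by (intro sum.cong) (auto simp: fcoef_sawtooth q_def norm_divide norm_mult power_divide power_mult_distrib)
  also have "\<dots> = sum q {- int N..int N}"
    unfolding A_def by (subst sum.reindex[OF inj_int_encode]) (simp add: freq_def comp_def)
  also have "\<dots> = 1 / 4 + 2 * (\<Sum>n=1..N. q (int n))"
    by (subst sum_symmetric_int) (auto simp: q_def)
  also have "(\<Sum>n=1..N. q (int n)) = (\<Sum>n=1..N. 1 / (4 * pi\<^sup>2) * (1 / (real n)\<^sup>2))"
    by (intro sum.cong) (auto simp: q_def)
  also have "\<dots> = 1 / (4 * pi\<^sup>2) * (\<Sum>n<N. 1 / (real n + 1)\<^sup>2)"
    unfolding sum_distrib_left
    by (rule sum.reindex_bij_witness[of _ Suc "\<lambda>n. n - 1"]) auto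
  \<comment> \<open>With Euler's value of the sum the right-hand side becomes 1/4 + 1/12 = 1/3, the
    number in \<open>n\<close>.\<close>
  finally have S: "(\<Sum>j\<in>A. (cmod (fcoef (\<lambda>y. of_real y) j))\<^sup>2) =
      1 / 4 + 1 / (2 * pi\<^sup>2) * (\<Sum>n<N. 1 / (real n + 1)\<^sup>2)"
    by simp
  have "1 / (2 * pi\<^sup>2) * (pi\<^sup>2 / 6 - e) \<le> 1 / (2 * pi\<^sup>2) * (\<Sum>n<N. 1 / (real n + 1)\<^sup>2)"
    using N by (intro mult_left_mono) auto
  moreover have "1 / (2 * pi\<^sup>2) * (pi\<^sup>2 / 6 - e) = 1 / 12 - e / (2 * pi\<^sup>2)"
    by (simp add: field_simps)
  moreover have "e / (2 * pi\<^sup>2) \<le> e"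
  proof -
    have "1 \<le> pi" using pi_gt3 by simp
    then have "1 \<le> pi\<^sup>2" by (rule one_le_power)
    then have "1 \<le> 2 * pi\<^sup>2" by linarith
    then show ?thesis using e by (simp add: field_simps)
  qed
  ultimately have "norm_sq circ (\<lambda>y. complex_of_real y) - e \<le> (\<Sum>j\<in>A. (cmod (fcoef (\<lambda>y. of_real y) j))\<^sup>2)"
    unfolding S n by simp
  then show "\<exists>A. finite A \<and> norm_sq circ (\<lambda>y. complex_of_real y) - e \<le> (\<Sum>j\<in>A. (cmod (fcoef (\<lambda>y. of_real y) j))\<^sup>2)"
    by (intro exI[of _ A]) (auto simp: A_def)
qed

lemma parseval_indicator_lessThan: "parseval (indicator {..<a})"
proof -
  consider "a \<le> 0" | "a \<ge> 1" | "0 < a" "a < 1" by linarith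
  then show ?thesis
  proof cases
    case 1
    show ?thesis by (rule parseval_cong[OF parseval_const[of 0]]) (use 1 in auto)
  next
    case 2
    show ?thesis by (rule parseval_cong[OF parseval_const[of 1]]) (use 2 in auto)
  next
    case 3
    define g where "g = (\<lambda>y. complex_of_real (frac y))"
    have g: "parseval g"
      by (rule parseval_cong[OF parseval_sawtooth]) (auto simp: g_def frac_eq)
    have per: "periodic1 g" by (simp add: periodic1_def g_def frac_1_eq)
    have m: "g \<in> borel_measurable borel" unfolding g_def frac_def by measurable
    have sq: "sq_int circ g" using g by (simp add: parseval_def)
    have "0 \<le> 1 - a" "1 - a \<le> 1" using 3 by auto
    note sh = sq_int_norm_sq_shift[OF per m sq this]
    have "parseval (\<lambda>y. g (y + (1 - a)))"
      using g by (simp add: parseval_def sh norm_mult)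
    \<comment> \<open>The translate minus \<open>y\<close> equals 1 - a to the left of
      \<open>a\<close> and -a from \<open>a\<close> on; adding the constant \<open>a\<close> leaves
      the indicator.\<close>
    from parseval_add[OF parseval_add[OF this parseval_cmult[OF parseval_sawtooth, of "-1"]] parseval_const[of "of_real a"]]
    show ?thesis
    proof (rule parseval_cong)
      fix y :: real assume y: "y \<in> {0..<1}"
      have "frac (y + (1 - a)) = (if y < a then y + 1 - a else y - a)"
      proof (cases "y < a")
        case True
        then have "frac (y + (1 - a)) = y + (1 - a)" using y 3 by (subst frac_eq) auto
        then show ?thesis using True by simp
      next
        case False
        have "frac (y - a + 1) = frac (y - a)" by (rule frac_1_eq)
        also have "\<dots> = y - a" using False y 3 by (subst frac_eq) auto
        finally show ?thesis using False by (simp add: algebra_simps)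
      qed
      then show "g (y + (1 - a)) + - 1 * complex_of_real y + complex_of_real a = indicator {..<a} y"
        by (auto simp: g_def)
    qed
  qed
qed

text \<open>Dynkin's argument. Half-lines form an intersection-stable generator, complements are
  linear combinations with a constant, and disjoint unions are limits of finite sums dominated by 1.
  Products of functions, for which \<open>parseval\<close> has no closure property, never
  occur.\<close>

lemma parseval_indicator:
  assumes "A \<in> sets borel"
  shows "parseval (indicator A)"
proof -
  have A: "A \<in> sigma_sets UNIV (range lessThan)"
    using assms by (simp add: borel_Iio)
  have st: "Int_stable (range (lessThan :: real \<Rightarrow> _))"
  proof (rule Int_stableI, elim rangeE, hypsubst)
    fix a b :: real
    have "{..<a} \<inter> {..<b} = {..<min a b}" by auto
    then show "{..<a} \<inter> {..<b} \<in> range lessThan" by simp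
  qed
  have sub: "range lessThan \<subseteq> Pow (UNIV :: real set)" by simp
  have "parseval (indicator A) \<and> A \<in> sets borel"
    using st sub A
  proof (induction rule: sigma_sets_induct_disjoint)
    case (basic A)
    then show ?case using parseval_indicator_lessThan by auto
  next
    case empty
    then show ?case using parseval_const[of 0] by (simp add: indicator_def)
  next
    case (compl A)
    have "parseval (\<lambda>y. 1 + - 1 * indicator A y)"
      using compl by (intro parseval_add parseval_cmult parseval_const) auto
    then show ?case using compl by (auto elim!: parseval_cong simp: indicator_def)
  next
    case (union A)
    have "parseval (indicator (\<Union>i. A i))"
    proof (rule parseval_limit[where s = "\<lambda>n y. \<Sum>i<n. indicator (A i) y" and h = "\<lambda>_. 1"])
      show "parseval (\<lambda>y. \<Sum>i<n. indicator (A i) y)" for n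
        using union by (intro parseval_sum) auto
      show "indicator (\<Union>i. A i) \<in> borel_measurable circ"
        using union by (intro measurable_circ borel_measurable_indicator) auto
      have eq: "(\<Sum>i<n. indicator (A i) y) = (indicator (\<Union>i<n. A i) y :: complex)" for n y
        using union.hyps(1)
        by (intro indicator_UN_disjoint[symmetric]) (auto simp: disjoint_family_on_def)
      show "(\<lambda>n. \<Sum>i<n. indicator (A i) y) \<longlonglongrightarrow> (indicator (\<Union>i. A i) y :: complex)" for y
        unfolding eq by (rule LIMSEQ_indicator_UN)
      show "cmod (\<Sum>i<n. indicator (A i) y) \<le> 1" for n y
        unfolding eq by (simp add: indicator_def)
    qed simp
    then show ?case using union by auto
  qed
  then show ?thesis by simp
qed

text \<open>Simple functions converge to \<open>g\<close> pointwise and are dominated by 2 |g|, so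
  the class of functions with Parseval's identity contains \<open>g\<close>.\<close>

theorem parseval_sq_int:
  assumes g: "sq_int circ g"
  shows "parseval g"
proof -
  have gm: "g \<in> borel_measurable circ" using g by (simp add: sq_int_def)
  obtain s where s: "\<And>i. simple_function circ (s i)" "\<And>x. x \<in> space circ \<Longrightarrow> (\<lambda>i. s i x) \<longlonglongrightarrow> g x"
    "\<And>i x. x \<in> space circ \<Longrightarrow> dist (s i x) 0 \<le> 2 * dist (g x) 0"
    using borel_measurable_implies_sequence_metric[OF gm, of 0] by metis
  have "parseval (s i)" for i
  proof -
    have fin: "finite (s i ` space circ)" using s(1) by (auto simp: simple_function_def)
    have *: "parseval (indicator (s i -` {z} \<inter> space circ))" for z
    proof -
      have "s i -` {z} \<inter> space circ \<in> sets circ"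
        by (rule simple_functionD(2)[OF s(1)])
      then have "s i -` {z} \<inter> space circ \<in> sets borel"
        by (auto simp: circ_def sets_restrict_space)
      then show ?thesis by (rule parseval_indicator)
    qed
    have "parseval (\<lambda>y. \<Sum>z\<in>s i ` space circ. z * indicator (s i -` {z} \<inter> space circ) y)"
      by (intro parseval_sum parseval_cmult *)
    then show ?thesis
    proof (rule parseval_cong)
      fix y :: real assume y: "y \<in> {0..<1}"
      have "(\<Sum>z\<in>s i ` space circ. z * indicator (s i -` {z} \<inter> space circ) y) =
          (\<Sum>z\<in>s i ` space circ. if z = s i y then z else 0)"
        using y by (intro sum.cong) (auto simp: indicator_def)
      then show "(\<Sum>z\<in>s i ` space circ. z * indicator (s i -` {z} \<inter> space circ) y) = s i y"
        using fin y by (simp add: sum.delta)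
    qed
  qed
  then show ?thesis
  proof (rule parseval_limit[OF _ gm, of s "\<lambda>y. 2 * cmod (g y)"])
    show "integrable circ (\<lambda>y. (2 * cmod (g y))\<^sup>2)"
      using g by (simp add: sq_int_def power_mult_distrib)
  qed (use s in auto)
qed

lemma parseval_sums: "sq_int circ g \<Longrightarrow> (\<lambda>j. (cmod (fcoef g j))\<^sup>2) sums norm_sq circ g"
  using parseval_sq_int by (simp add: parseval_def)

text \<open>Pairing with a partial sum of \<open>h\<close> is a finite sum of coefficient products,
  so by Cauchy-Schwarz the error is controlled by the residual of \<open>h\<close>.\<close>

lemma parseval_inner_sums:
  assumes g: "sq_int circ g" and h: "sq_int circ h"
  shows "(\<lambda>j. fcoef g j * cnj (fcoef h j)) sums (\<integral>y. g y * cnj (h y) \<partial>circ)"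
proof -
  let ?I = "\<integral>y. g y * cnj (h y) \<partial>circ"
  let ?r = "\<lambda>n. norm_sq circ (\<lambda>y. h y - fsum n (fcoef h) y)"
  have bd: "cmod ((\<Sum>j<n. fcoef g j * cnj (fcoef h j)) - ?I) \<le> sqrt (norm_sq circ g) * sqrt (?r n)" for n
  proof -
    have "(\<Sum>j<n. fcoef g j * cnj (fcoef h j)) - ?I =
        - (\<integral>y. g y * cnj (h y - fsum n (fcoef h) y) \<partial>circ)"
      unfolding integral_mult_cnj_fsum[OF g, symmetric]
      by (simp add: right_diff_distrib sq_int_mult_cnj_integrable[OF g h]
          sq_int_mult_cnj_integrable[OF g sq_int_fsum])
    then show ?thesis
      using Cauchy_Schwarz_integral_cnj[OF g sq_int_diff[OF h sq_int_fsum]] by simp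
  qed
  have "(\<lambda>n. sqrt (norm_sq circ g) * sqrt (?r n)) \<longlonglongrightarrow> sqrt (norm_sq circ g) * sqrt 0"
    using parseval_sq_int[OF h] by (intro tendsto_intros) (simp add: parseval_residual)
  then have lim: "(\<lambda>n. sqrt (norm_sq circ g) * sqrt (?r n)) \<longlonglongrightarrow> 0" by simp
  have "(\<lambda>n. (\<Sum>j<n. fcoef g j * cnj (fcoef h j)) - ?I) \<longlonglongrightarrow> 0"
    by (rule Lim_null_comparison[OF _ lim]) (use bd in simp)
  then show ?thesis by (simp add: sums_def LIM_zero_iff)
qed

subsection \<open>The resolvent estimate\<close>

lemma Cauchy_Schwarz_suminf:
  fixes a b :: "nat \<Rightarrow> complex"
  assumes a: "summable (\<lambda>j. (cmod (a j))\<^sup>2)" and b: "summable (\<lambda>j. (cmod (b j))\<^sup>2)"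
  shows "summable (\<lambda>j. cmod (a j * b j))"
    "cmod (\<Sum>j. a j * b j) \<le> sqrt (\<Sum>j. (cmod (a j))\<^sup>2) * sqrt (\<Sum>j. (cmod (b j))\<^sup>2)"
proof -
  let ?A = "\<Sum>j. (cmod (a j))\<^sup>2" and ?B = "\<Sum>j. (cmod (b j))\<^sup>2"
  have le: "(\<Sum>j<n. cmod (a j * b j)) \<le> sqrt ?A * sqrt ?B" for n
  proof -
    have "(\<Sum>j<n. cmod (a j) * cmod (b j))\<^sup>2 \<le> (\<Sum>j<n. (cmod (a j))\<^sup>2) * (\<Sum>j<n. (cmod (b j))\<^sup>2)"
      by (rule Cauchy_Schwarz_ineq_sum)
    also have "\<dots> \<le> ?A * ?B"
      using a b by (intro mult_mono sum_le_suminf suminf_nonneg sum_nonneg) auto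
    finally show ?thesis
      by (simp add: norm_mult real_le_rsqrt flip: real_sqrt_mult)
  qed
  show s: "summable (\<lambda>j. cmod (a j * b j))"
    by (rule bounded_imp_summable[OF _ le[of "Suc _", unfolded lessThan_Suc_atMost]]) auto
  have "cmod (\<Sum>j. a j * b j) \<le> (\<Sum>j. cmod (a j * b j))"
    by (rule summable_norm[OF s])
  also have "\<dots> \<le> sqrt ?A * sqrt ?B"
    by (rule suminf_le_const[OF s le])
  finally show "cmod (\<Sum>j. a j * b j) \<le> sqrt ?A * sqrt ?B" .
qed

text \<open>Each summand is at most the increment of arctan over the preceding interval of length r,
  divided by r; the bounds telescope.\<close>

lemma sum_inverse_one_plus_square_le:
  fixes r :: real
  assumes "0 < r"
  shows "(\<Sum>n=1..N. 1 / (1 + (r * real n)\<^sup>2)) \<le> arctan (r * real N) / r"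
proof (induction N)
  case (Suc N)
  have "\<exists>z>r * real N. z < r * real (Suc N) \<and>
      arctan (r * real (Suc N)) - arctan (r * real N) = (r * real (Suc N) - r * real N) * inverse (1 + z\<^sup>2)"
    using assms by (intro MVT2) (auto intro!: DERIV_arctan simp: distrib_left)
  then obtain z where z: "r * real N < z" "z < r * real (Suc N)"
    "arctan (r * real (Suc N)) - arctan (r * real N) = (r * real (Suc N) - r * real N) * inverse (1 + z\<^sup>2)"
    by blast
  have "0 \<le> r * real N" using assms by simp
  then have "z\<^sup>2 \<le> (r * real (Suc N))\<^sup>2" using z by (intro power_mono) auto
  then have "1 / (1 + (r * real (Suc N))\<^sup>2) \<le> inverse (1 + z\<^sup>2)"
    by (simp add: inverse_eq_divide frac_le add_pos_nonneg)
  also have "\<dots> = arctan (r * real (Suc N)) / r - arctan (r * real N) / r"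
  proof -
    have "r * real (Suc N) - r * real N = r" by (simp add: algebra_simps)
    then show ?thesis using z(3) assms by (simp flip: diff_divide_distrib)
  qed
  finally show ?case using Suc by simp
qed simp

text \<open>The zero frequency gives 1 \<le> 1/r, the positive and the negative ones at most 2/r
  each, because arctan < pi/2 < 2.\<close>

lemma sum_inverse_weight_le:
  fixes r :: real
  assumes r: "0 < r" "r \<le> 1"
  shows "(\<Sum>j<n. 1 / (1 + (r * of_int (freq j))\<^sup>2)) \<le> 5 / r"
proof -
  define w where "w = (\<lambda>m::int. 1 / (1 + (r * real_of_int m)\<^sup>2))"
  have w0: "0 \<le> w m" for m by (simp add: w_def)
  have "finite (freq ` {..<n})" by simp
  then obtain N :: nat where N: "freq ` {..<n} \<subseteq> {- int N..int N}"
  proof -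
    assume *: "\<And>N. freq ` {..<n} \<subseteq> {- int N..int N} \<Longrightarrow> thesis"
    define N where "N = (\<Sum>j<n. nat \<bar>freq j\<bar>)"
    have "nat \<bar>freq j\<bar> \<le> N" if "j < n" for j
      unfolding N_def using that by (intro member_le_sum) auto
    then have "freq ` {..<n} \<subseteq> {- int N..int N}" by fastforce
    then show thesis by (rule *)
  qed
  have "(\<Sum>j<n. 1 / (1 + (r * of_int (freq j))\<^sup>2)) = sum w (freq ` {..<n})"
    by (subst sum.reindex) (auto simp: inj_on_def w_def)
  also have "\<dots> \<le> sum w {- int N..int N}"
    by (rule sum_mono2[OF _ N]) (auto simp: w0)
  also have "\<dots> = w 0 + 2 * (\<Sum>n=1..N. w (int n))"
    by (rule sum_symmetric_int) (simp add: w_def)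
  also have "(\<Sum>n=1..N. w (int n)) = (\<Sum>n=1..N. 1 / (1 + (r * real n)\<^sup>2))"
    by (simp add: w_def)
  also have "\<dots> \<le> arctan (r * real N) / r"
    by (rule sum_inverse_one_plus_square_le[OF r(1)])
  also have "\<dots> \<le> 2 / r"
    using arctan_ubound[of "r * real N"] pi_less_4 r by (intro divide_right_mono) auto
  also have "w 0 \<le> 1 / r" using r by (simp add: w_def)
  finally show ?thesis by (simp add: field_simps)
qed

text \<open>A pointwise sum, meant for absolutely summable coefficients. It provides an everywhere
  defined periodic Borel function, to which translations and sup bounds apply.\<close>

definition fser :: "(nat \<Rightarrow> complex) \<Rightarrow> real \<Rightarrow> complex" where
  "fser c y = (\<Sum>j. c j * fmode (freq j) y)"

lemma fser_summable:
  "summable (\<lambda>j. cmod (c j)) \<Longrightarrow> summable (\<lambda>j. c j * fmode (freq j) y)"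
  by (rule summable_norm_cancel) (simp add: norm_mult)

lemma cmod_fser_le: "summable (\<lambda>j. cmod (c j)) \<Longrightarrow> cmod (fser c y) \<le> (\<Sum>j. cmod (c j))"
  unfolding fser_def using summable_norm[of "\<lambda>j. c j * fmode (freq j) y"] by (simp add: norm_mult)

lemma periodic1_fser: "periodic1 (fser c)"
  using periodic1_fmode by (simp add: periodic1_def fser_def)

lemma fser_measurable:
  assumes "summable (\<lambda>j. cmod (c j))"
  shows "fser c \<in> borel_measurable borel"
proof -
  have "(\<lambda>n. \<Sum>j<n. c j * fmode (freq j) y) \<longlonglongrightarrow> fser c y" for y
    unfolding fser_def by (rule summable_LIMSEQ[OF fser_summable[OF assms]])
  moreover have "(\<lambda>y. \<Sum>j<n. c j * fmode (freq j) y) \<in> borel_measurable borel" for n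
    by measurable
  ultimately show ?thesis
    using borel_measurable_LIMSEQ_metric[of "\<lambda>n y. \<Sum>j<n. c j * fmode (freq j) y" borel "fser c"] by blast
qed

lemma sq_int_fser: "summable (\<lambda>j. cmod (c j)) \<Longrightarrow> sq_int circ (fser c)"
  by (rule sq_int_of_bounded[OF finite_measure_circ measurable_circ[OF fser_measurable] cmod_fser_le])

text \<open>Besides identifying the coefficients of \<open>fser c\<close>, this expresses those of
  \<open>b\<close> times \<open>fser c\<close> through the matrix elements of
  \<open>b\<close>.\<close>

lemma integral_mult_fser_sums:
  assumes c: "summable (\<lambda>j. cmod (c j))" and h: "sq_int circ h"
  shows "(\<lambda>i. c i * (\<integral>y. h y * fmode (freq i) y \<partial>circ)) sums (\<integral>y. h y * fser c y \<partial>circ)"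
proof -
  have i: "integrable circ (\<lambda>y. h y * fmode m y)" for m
    using h sq_int_fmode by (rule sq_int_mult_integrable)
  have h': "integrable circ (\<lambda>y. cmod (h y))"
    using sq_int_integrable[OF finite_measure_circ h] by (rule integrable_norm)
  have "(\<lambda>i. \<integral>y. c i * (h y * fmode (freq i) y) \<partial>circ) sums (\<integral>y. (\<Sum>i. c i * (h y * fmode (freq i) y)) \<partial>circ)"
  proof (rule sums_integral)
    show "integrable circ (\<lambda>y. c i * (h y * fmode (freq i) y))" for i
      using i by (rule Bochner_Integration.integrable_mult_right)
    show "AE y in circ. summable (\<lambda>i. cmod (c i * (h y * fmode (freq i) y)))"
      using c by (simp add: norm_mult summable_mult2)
    show "summable (\<lambda>i. \<integral>y. cmod (c i * (h y * fmode (freq i) y)) \<partial>circ)"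
      using c h' by (simp add: norm_mult summable_mult2)
  qed
  moreover have "(\<Sum>i. c i * (h y * fmode (freq i) y)) = h y * fser c y" for y
    unfolding fser_def suminf_mult[OF fser_summable[OF c], symmetric] by (simp add: mult_ac)
  ultimately show ?thesis by simp
qed

lemma fcoef_fser:
  assumes c: "summable (\<lambda>j. cmod (c j))"
  shows "fcoef (fser c) j = c j"
proof -
  have "sq_int circ (\<lambda>y. cnj (fmode (freq j) y))" by (simp add: sq_int_fmode)
  from integral_mult_fser_sums[OF c this]
  have "(\<lambda>i. c i * (\<integral>y. fmode (freq i) y * cnj (fmode (freq j) y) \<partial>circ)) sums fcoef (fser c) j"
    by (simp add: fcoef_def mult.commute)
  also have "(\<lambda>i. c i * (\<integral>y. fmode (freq i) y * cnj (fmode (freq j) y) \<partial>circ)) =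
      (\<lambda>i. if i = j then c i else 0)"
    by (auto simp: integral_fmode_cnj fun_eq_iff)
  finally show ?thesis
    using sums_single[of j c] sums_unique2 by blast
qed

lemma norm_sq_fser:
  assumes c: "summable (\<lambda>j. cmod (c j))"
  shows "(\<lambda>j. (cmod (c j))\<^sup>2) sums norm_sq circ (fser c)"
  using parseval_sums[OF sq_int_fser[OF c]] by (simp add: fcoef_fser[OF c])

text \<open>Weighting the coefficients by \<open>1 + r\<^sup>2q\<^sup>2\<close> keeps the constant \<open>1/r\<close> of the
  one-dimensional Agmon inequality explicit.\<close>

lemma summable_coef_weighted:
  assumes X: "summable (\<lambda>j. (cmod (c j))\<^sup>2)"
    and D: "summable (\<lambda>j. (of_int (freq j))\<^sup>2 * (cmod (c j))\<^sup>2)"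
  shows "summable (\<lambda>j. cmod (c j))"
    and "0 < r \<Longrightarrow> r \<le> 1 \<Longrightarrow> (\<Sum>j. cmod (c j))\<^sup>2 \<le>
      5 / r * ((\<Sum>j. (cmod (c j))\<^sup>2) + r\<^sup>2 * (\<Sum>j. (of_int (freq j))\<^sup>2 * (cmod (c j))\<^sup>2))"
proof -
  define Q where "Q = (\<lambda>r. (\<Sum>j. (cmod (c j))\<^sup>2) + r\<^sup>2 * (\<Sum>j. (of_int (freq j))\<^sup>2 * (cmod (c j))\<^sup>2))"
  have Q0: "0 \<le> Q r" for r
    unfolding Q_def using X D by (intro add_nonneg_nonneg mult_nonneg_nonneg suminf_nonneg) auto
  have le: "(\<Sum>j<n. cmod (c j)) \<le> sqrt (5 / r * Q r)" if r: "0 < r" "r \<le> 1" for n and r :: real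
  proof -
    define w where "w = (\<lambda>j. 1 + (r * of_int (freq j))\<^sup>2)"
    have w: "0 < w j" for j by (simp add: w_def add_pos_nonneg)
    have "(\<Sum>j<n. cmod (c j))\<^sup>2 = (\<Sum>j<n. (1 / sqrt (w j)) * (sqrt (w j) * cmod (c j)))\<^sup>2"
      using w by (simp add: order_less_imp_not_eq2)
    also have "\<dots> \<le> (\<Sum>j<n. (1 / sqrt (w j))\<^sup>2) * (\<Sum>j<n. (sqrt (w j) * cmod (c j))\<^sup>2)"
      by (rule Cauchy_Schwarz_ineq_sum)
    also have "(\<Sum>j<n. (1 / sqrt (w j))\<^sup>2) = (\<Sum>j<n. 1 / w j)"
      using w by (simp add: power_divide order_less_imp_le)
    also have "(\<Sum>j<n. (sqrt (w j) * cmod (c j))\<^sup>2) =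
        (\<Sum>j<n. (cmod (c j))\<^sup>2) + r\<^sup>2 * (\<Sum>j<n. (of_int (freq j))\<^sup>2 * (cmod (c j))\<^sup>2)"
      using w by (simp add: power_mult_distrib order_less_imp_le sum_distrib_left flip: sum.distrib)
        (simp add: w_def algebra_simps power_mult_distrib)
    also have "(\<Sum>j<n. 1 / w j) * \<dots> \<le> 5 / r * Q r"
      unfolding Q_def w_def
    proof (rule mult_mono[OF sum_inverse_weight_le[OF r]])
      show "(\<Sum>j<n. (cmod (c j))\<^sup>2) + r\<^sup>2 * (\<Sum>j<n. (of_int (freq j))\<^sup>2 * (cmod (c j))\<^sup>2)
        \<le> (\<Sum>j. (cmod (c j))\<^sup>2) + r\<^sup>2 * (\<Sum>j. (of_int (freq j))\<^sup>2 * (cmod (c j))\<^sup>2)"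
        using X D by (intro add_mono mult_left_mono sum_le_suminf) auto
    qed (use r in \<open>auto intro!: add_nonneg_nonneg mult_nonneg_nonneg sum_nonneg\<close>)
    finally show ?thesis by (rule real_le_rsqrt)
  qed
  show s: "summable (\<lambda>j. cmod (c j))"
    by (rule bounded_imp_summable[OF _ le[of 1 "Suc _", unfolded lessThan_Suc_atMost]]) auto
  assume r: "0 < r" "r \<le> 1"
  have "(\<Sum>j. cmod (c j)) \<le> sqrt (5 / r * Q r)"
    by (rule suminf_le_const[OF s le[OF r]])
  then have "(\<Sum>j. cmod (c j))\<^sup>2 \<le> (sqrt (5 / r * Q r))\<^sup>2"
    by (intro power_mono suminf_nonneg s) auto
  then show "(\<Sum>j. cmod (c j))\<^sup>2 \<le>
      5 / r * ((\<Sum>j. (cmod (c j))\<^sup>2) + r\<^sup>2 * (\<Sum>j. (of_int (freq j))\<^sup>2 * (cmod (c j))\<^sup>2))"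
    using r Q0[of r] by (simp add: Q_def)
qed

text \<open>From |cis t - 1| = 2 |sin (t/2)| \<le> |t|.\<close>

lemma cmod_fmode_minus_1:
  "(cmod (fmode m h - 1))\<^sup>2 \<le> (2 * pi * real_of_int m * h)\<^sup>2"
proof -
  define t where "t = 2 * pi * real_of_int m * h"
  have "(cmod (cis t - 1))\<^sup>2 = (cos t - 1)\<^sup>2 + (sin t)\<^sup>2"
    by (simp add: cmod_power2)
  also have "\<dots> = 2 - 2 * cos t"
    by (simp add: power2_diff sin_squared_eq)
  also have "\<dots> = (2 * sin (t / 2))\<^sup>2"
    using cos_double_sin[of "t / 2"] by (simp add: power_mult_distrib)
  also have "\<dots> = 4 * \<bar>sin (t / 2)\<bar>\<^sup>2"
    by (simp add: power_mult_distrib)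
  also have "\<dots> \<le> 4 * \<bar>t / 2\<bar>\<^sup>2"
    by (intro mult_left_mono power_mono abs_sin_x_le_abs_x) auto
  also have "\<dots> = t\<^sup>2"
    by (simp add: power_divide)
  finally show ?thesis by (simp add: fmode_def t_def)
qed

text \<open>The termwise limit for Tannery's theorem when difference quotients are passed to
  derivatives. The squared modulus appears because two differences with the same step are paired, so
  that the phases cancel.\<close>

lemma fmode_difference_quotient:
  "(\<lambda>n. (cmod (fmode m (1 / real (Suc n)) - 1))\<^sup>2 * (real (Suc n))\<^sup>2) \<longlonglongrightarrow> (2 * pi * real_of_int m)\<^sup>2"
proof -
  define a where "a = 2 * pi * of_int m * \<i>"
  have eq: "fmode m h = exp (a * of_real h)" for h
    by (simp add: fmode_def cis_conv_exp a_def mult_ac)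
  have "((\<lambda>z. exp (a * z)) has_field_derivative a) (at 0)"
    by (auto intro!: derivative_eq_intros)
  then have lim: "((\<lambda>z. (exp (a * z) - 1) / z) \<longlongrightarrow> a) (at 0)"
    by (simp add: DERIV_def)
  have "(\<lambda>n. complex_of_real (1 / real (Suc n))) \<longlonglongrightarrow> complex_of_real 0"
    by (intro tendsto_of_real LIMSEQ_Suc lim_1_over_n)
  then have "filterlim (\<lambda>n. complex_of_real (1 / real (Suc n))) (at 0) sequentially"
    by (simp add: filterlim_at del: of_real_divide of_nat_Suc)
  from filterlim_compose[OF lim this]
  have "(\<lambda>n. (fmode m (1 / real (Suc n)) - 1) * of_real (real (Suc n))) \<longlonglongrightarrow> a"
    by (simp add: eq del: of_nat_Suc)
  then have "(\<lambda>n. (cmod ((fmode m (1 / real (Suc n)) - 1) * of_real (real (Suc n))))\<^sup>2) \<longlonglongrightarrow> (cmod a)\<^sup>2"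
    by (intro tendsto_intros)
  moreover have "(cmod a)\<^sup>2 = (2 * pi * real_of_int m)\<^sup>2"
    by (simp add: a_def norm_mult power_mult_distrib)
  ultimately show ?thesis
    by (simp add: norm_mult power_mult_distrib del: of_nat_Suc)
qed

text \<open>The pairing on the left is \<open>\<langle>g', (\<theta> g)'\<rangle>\<close> for \<open>g = fser c\<close>; its imaginary part only sees
  \<open>\<langle>g', \<theta>' g\<rangle>\<close>. Difference quotients make this rigorous for Lipschitz \<open>\<theta>\<close>.\<close>

lemma Lipschitz_multiplier_commutator:
  fixes \<theta> :: "real \<Rightarrow> real"
  assumes per: "periodic1 \<theta>" and \<theta>m: "\<theta> \<in> borel_measurable borel" and \<theta>1: "\<And>y. \<bar>\<theta> y\<bar> \<le> 1"
    and lip: "\<And>y h. \<bar>\<theta> (y + h) - \<theta> y\<bar> \<le> L * \<bar>h\<bar>"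
    and X: "summable (\<lambda>j. (cmod (c j))\<^sup>2)"
    and D: "summable (\<lambda>j. (of_int (freq j))\<^sup>2 * (cmod (c j))\<^sup>2)"
    and H: "summable (\<lambda>j. ((of_int (freq j))\<^sup>2 * cmod (c j))\<^sup>2)"
  defines "w \<equiv> fcoef (\<lambda>y. of_real (\<theta> y) * fser c y)"
  shows "summable (\<lambda>j. of_real ((2 * pi * of_int (freq j))\<^sup>2) * c j * cnj (w j))"
    and "\<bar>Im (\<Sum>j. of_real ((2 * pi * of_int (freq j))\<^sup>2) * c j * cnj (w j))\<bar> \<le>
      L * (2 * pi) * sqrt (\<Sum>j. (of_int (freq j))\<^sup>2 * (cmod (c j))\<^sup>2) * sqrt (\<Sum>j. (cmod (c j))\<^sup>2)"
proof -
  let ?z = "\<lambda>j. of_real ((2 * pi * of_int (freq j))\<^sup>2) * c j * cnj (w j)"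
  note \<theta>m[measurable]
  define D2 where "D2 = (\<Sum>j. (of_int (freq j))\<^sup>2 * (cmod (c j))\<^sup>2)"
  define g where "g = fser c"
  define W where "W = (\<lambda>y. of_real (\<theta> y) * g y)"
  have w: "w = fcoef W" by (simp add: w_def W_def g_def)
  note c = summable_coef_weighted(1)[OF X D]
  have gm[measurable]: "g \<in> borel_measurable borel" unfolding g_def by (rule fser_measurable[OF c])
  have gs: "sq_int circ g" unfolding g_def by (rule sq_int_fser[OF c])
  have gp: "periodic1 g" unfolding g_def by (rule periodic1_fser)
  have ng: "norm_sq circ g = (\<Sum>j. (cmod (c j))\<^sup>2)"
    unfolding g_def using norm_sq_fser[OF c] by (simp add: sums_iff)
  have fg: "fcoef g = c" unfolding g_def using fcoef_fser[OF c] by (simp add: fun_eq_iff)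
  have Ws: "sq_int circ W"
    unfolding W_def by (rule sq_int_bounded_mult(1)[OF gs, where B = 1]) (use \<theta>1 in auto)
  have Wp: "periodic1 W" using per gp by (simp add: periodic1_def W_def)
  have Wm: "W \<in> borel_measurable borel" unfolding W_def by measurable
  have ww: "summable (\<lambda>j. (cmod (w j))\<^sup>2)"
    unfolding w using parseval_sums[OF Ws] by (simp add: sums_iff)
  \<comment> \<open>Majorant for Tannery's theorem; it is summable because both \<open>w\<close> and
    the coefficients weighted by the squared frequency are square summable.\<close>
  define M where "M = (\<lambda>j. 4 * pi\<^sup>2 * cmod (of_real ((of_int (freq j))\<^sup>2) * c j * cnj (w j)))"
  have "summable (\<lambda>j. cmod (of_real ((of_int (freq j))\<^sup>2) * c j * cnj (w j)))"
    by (rule Cauchy_Schwarz_suminf(1)) (use H ww in \<open>simp_all add: norm_mult norm_power\<close>)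
  then have sM: "summable M" unfolding M_def by (intro summable_mult)
  show "summable (\<lambda>j. ?z j)"
    by (rule summable_comparison_test'[OF sM, of 0])
      (simp add: M_def norm_mult norm_power power_mult_distrib)
  \<comment> \<open>By Parseval, the sum of \<open>a h\<close> over \<open>j\<close> is the pairing
    of the differences of \<open>g\<close> and \<open>W\<close> with step \<open>h\<close>.\<close>
  define a where "a = (\<lambda>h j. of_real ((cmod (fmode (freq j) h - 1))\<^sup>2) * c j * cnj (w j))"
  let ?R = "L * (2 * pi) * sqrt D2 * sqrt (norm_sq circ g)"
  have bound: "\<bar>Im (\<Sum>j. a h j)\<bar> \<le> h\<^sup>2 * (?R)"
    if h: "0 < h" "h \<le> 1" for h
  proof -
    have h0: "0 \<le> h" using h by simp
    note gsh = sq_int_norm_sq_shift[OF gp gm gs h0 h(2)]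
    note Wsh = sq_int_norm_sq_shift[OF Wp Wm Ws h0 h(2)]
    define Dg where "Dg = (\<lambda>y. g (y + h) - g y)"
    define DW where "DW = (\<lambda>y. W (y + h) - W y)"
    define E where "E = (\<lambda>y. of_real (\<theta> (y + h) - \<theta> y) * g y)"
    have Dgs: "sq_int circ Dg" unfolding Dg_def by (rule sq_int_diff[OF gsh(1) gs])
    have DWs: "sq_int circ DW" unfolding DW_def by (rule sq_int_diff[OF Wsh(1) Ws])
    have fDg: "fcoef Dg j = (fmode (freq j) h - 1) * c j" for j
      unfolding Dg_def fcoef_diff[OF gsh(1) gs] gsh(3) fg by (simp add: algebra_simps)
    have fDW: "fcoef DW j = (fmode (freq j) h - 1) * w j" for j
      unfolding DW_def fcoef_diff[OF Wsh(1) Ws] Wsh(3) w by (simp add: algebra_simps)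
    have Es: "sq_int circ E" "norm_sq circ E \<le> (L * h)\<^sup>2 * norm_sq circ g"
    proof -
      have m: "(\<lambda>y. complex_of_real (\<theta> (y + h) - \<theta> y)) \<in> borel_measurable circ" by measurable
      have "cmod (complex_of_real (\<theta> (y + h) - \<theta> y)) \<le> L * h" for y
        using lip[of y h] h by (simp flip: of_real_diff)
      then show "sq_int circ E" "norm_sq circ E \<le> (L * h)\<^sup>2 * norm_sq circ g"
        unfolding E_def by (rule sq_int_bounded_mult[OF gs m])+
    qed
    have \<theta>D: "sq_int circ (\<lambda>y. of_real (\<theta> (y + h)) * Dg y)"
      by (rule sq_int_bounded_mult(1)[OF Dgs, where B = 1]) (use \<theta>1 in auto)
    have "(\<lambda>j. fcoef Dg j * cnj (fcoef DW j)) sums (\<integral>y. Dg y * cnj (DW y) \<partial>circ)"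
      by (rule parseval_inner_sums[OF Dgs DWs])
    also have "(\<lambda>j. fcoef Dg j * cnj (fcoef DW j)) = a h"
      by (simp add: fun_eq_iff a_def fDg fDW complex_norm_square del: of_real_power)
    finally have "(\<Sum>j. a h j) = (\<integral>y. Dg y * cnj (DW y) \<partial>circ)"
      by (rule sums_unique[symmetric])
    \<comment> \<open>Discrete Leibniz rule \<open>DW y = \<theta> (y + h) * Dg y + E y\<close>: the
      first part paired with \<open>Dg\<close> is real and is lost in the imaginary part, and
      \<open>E\<close> is at most L h |g|.\<close>
    also have "\<dots> = (\<integral>y. of_real (\<theta> (y + h) * (cmod (Dg y))\<^sup>2) + Dg y * cnj (E y) \<partial>circ)"
      by (rule Bochner_Integration.integral_cong)
        (simp_all add: DW_def W_def E_def Dg_def complex_norm_square algebra_simps del: of_real_power)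
    also have "\<dots> = (\<integral>y. of_real (\<theta> (y + h) * (cmod (Dg y))\<^sup>2) \<partial>circ) + (\<integral>y. Dg y * cnj (E y) \<partial>circ)"
    proof (rule Bochner_Integration.integral_add)
      have "integrable circ (\<lambda>y. of_real (\<theta> (y + h)) * Dg y * cnj (Dg y))"
        by (rule sq_int_mult_cnj_integrable[OF \<theta>D Dgs])
      then show "integrable circ (\<lambda>y. complex_of_real (\<theta> (y + h) * (cmod (Dg y))\<^sup>2))"
        by (simp add: complex_norm_square mult.assoc del: of_real_power)
    qed (rule sq_int_mult_cnj_integrable[OF Dgs Es(1)])
    finally have "\<bar>Im (\<Sum>j. a h j)\<bar> \<le> cmod (\<integral>y. Dg y * cnj (E y) \<partial>circ)"
      by (simp only: integral_complex_of_real plus_complex.sel Im_complex_of_real add_0_left abs_Im_le_cmod)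
    also have "\<dots> \<le> sqrt (norm_sq circ Dg) * sqrt (norm_sq circ E)"
      by (rule Cauchy_Schwarz_integral_cnj[OF Dgs Es(1)])
    also have "\<dots> \<le> (2 * pi * h * sqrt D2) * (L * h * sqrt (norm_sq circ g))"
    proof (rule mult_mono)
      have s: "(\<lambda>j. (cmod (fcoef Dg j))\<^sup>2) sums norm_sq circ Dg" by (rule parseval_sums[OF Dgs])
      have "norm_sq circ Dg \<le> (\<Sum>j. (2 * pi * h)\<^sup>2 * ((of_int (freq j))\<^sup>2 * (cmod (c j))\<^sup>2))"
        unfolding sums_unique[OF s]
      proof (rule suminf_le)
        show "(cmod (fcoef Dg j))\<^sup>2 \<le> (2 * pi * h)\<^sup>2 * ((of_int (freq j))\<^sup>2 * (cmod (c j))\<^sup>2)" for j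
          using mult_right_mono[OF cmod_fmode_minus_1[of "freq j" h], of "(cmod (c j))\<^sup>2"]
          by (simp add: fDg norm_mult power_mult_distrib mult_ac)
      qed (use s D in \<open>auto simp: sums_iff intro: summable_mult\<close>)
      also have "\<dots> = (2 * pi * h)\<^sup>2 * D2"
        unfolding D2_def by (rule suminf_mult[OF D])
      finally have "sqrt (norm_sq circ Dg) \<le> sqrt ((2 * pi * h)\<^sup>2 * D2)" by simp
      then show "sqrt (norm_sq circ Dg) \<le> 2 * pi * h * sqrt D2"
        using h by (simp add: real_sqrt_mult)
      have "0 \<le> L * h" using lip[of 0 h] h by (simp add: order_trans[OF abs_ge_zero])
      moreover have "sqrt (norm_sq circ E) \<le> sqrt ((L * h)\<^sup>2 * norm_sq circ g)" using Es(2) by simp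
      ultimately show "sqrt (norm_sq circ E) \<le> L * h * sqrt (norm_sq circ g)"
        by (simp add: real_sqrt_mult)
    qed (use h D in \<open>auto simp: D2_def intro!: mult_nonneg_nonneg suminf_nonneg\<close>)
    finally show ?thesis by (simp add: power2_eq_square mult_ac)
  qed
  let ?a = "\<lambda>n j. of_real ((real (Suc n))\<^sup>2) * a (1 / real (Suc n)) j"
  have "((\<lambda>n. \<Sum>j. ?a n j) \<longlongrightarrow>
      (\<Sum>j. ?z j)) sequentially"
  proof (rule tannerys_theorem[where M = M, THEN conjunct2, THEN conjunct2])
    fix j
    have "(\<lambda>n. complex_of_real ((cmod (fmode (freq j) (1 / real (Suc n)) - 1))\<^sup>2 * (real (Suc n))\<^sup>2) * c j * cnj (w j))
        \<longlonglongrightarrow> ?z j"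
      by (intro tendsto_mult tendsto_of_real fmode_difference_quotient tendsto_const)
    then show "(\<lambda>n. ?a n j)
        \<longlonglongrightarrow> ?z j"
      by (simp add: a_def mult_ac)
  next
    have "cmod (?a n j) \<le> M j" for j n
    proof -
      have "(real (Suc n))\<^sup>2 * (cmod (fmode (freq j) (1 / real (Suc n)) - 1))\<^sup>2 \<le>
          (real (Suc n))\<^sup>2 * (2 * pi * of_int (freq j) * (1 / real (Suc n)))\<^sup>2"
        by (intro mult_left_mono cmod_fmode_minus_1) auto
      also have "\<dots> = 4 * pi\<^sup>2 * (of_int (freq j))\<^sup>2"
        by (simp add: power_mult_distrib power_divide del: of_nat_Suc)
      finally have "(real (Suc n))\<^sup>2 * (cmod (fmode (freq j) (1 / real (Suc n)) - 1))\<^sup>2 * (cmod (c j) * cmod (w j))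
          \<le> 4 * pi\<^sup>2 * (of_int (freq j))\<^sup>2 * (cmod (c j) * cmod (w j))"
        by (rule mult_right_mono) auto
      then show ?thesis
        by (simp add: a_def M_def norm_mult norm_power mult_ac del: of_nat_Suc)
    qed
    then show "\<forall>\<^sub>F (j, n) in at_top \<times>\<^sub>F sequentially. cmod (?a n j) \<le> M j"
      by (auto intro!: always_eventually)
  qed (use sM in auto)
  then have lim: "(\<lambda>n. Im (of_real ((real (Suc n))\<^sup>2) * (\<Sum>j. a (1 / real (Suc n)) j))) \<longlonglongrightarrow>
      Im (\<Sum>j. ?z j)"
  proof -
    have sa: "summable (a h)" for h
    proof (rule summable_comparison_test'[where N = 0])
      show "summable (\<lambda>j. h\<^sup>2 * M j)" using sM by (rule summable_mult)
      show "cmod (a h j) \<le> h\<^sup>2 * M j" for j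
        using mult_right_mono[OF cmod_fmode_minus_1[of "freq j" h], of "cmod (c j) * cmod (w j)"]
        by (simp add: a_def M_def norm_mult norm_power power_mult_distrib mult_ac)
    qed
    assume "(\<lambda>n. \<Sum>j. ?a n j) \<longlonglongrightarrow>
      (\<Sum>j. ?z j)"
    then show ?thesis
      unfolding suminf_mult[OF sa] by (rule tendsto_Im)
  qed
  have "\<bar>Im (of_real ((real (Suc n))\<^sup>2) * (\<Sum>j. a (1 / real (Suc n)) j))\<bar> \<le> ?R" for n
  proof -
    have "\<bar>Im (\<Sum>j. a (1 / real (Suc n)) j)\<bar> \<le> (1 / real (Suc n))\<^sup>2 * (?R)"
      by (rule bound) auto
    then have "(real (Suc n))\<^sup>2 * \<bar>Im (\<Sum>j. a (1 / real (Suc n)) j)\<bar> \<le>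
        (real (Suc n))\<^sup>2 * ((1 / real (Suc n))\<^sup>2 * (?R))"
      by (rule mult_left_mono) auto
    also have "\<dots> = ?R"
      by (simp add: power_divide del: of_nat_Suc)
    finally show ?thesis
      by (simp add: abs_mult del: of_nat_Suc of_real_power)
  qed
  then have "\<bar>Im (\<Sum>j. ?z j)\<bar> \<le> ?R"
    by (intro LIMSEQ_le_const2[OF tendsto_rabs[OF lim]]) blast
  then show "\<bar>Im (\<Sum>j. ?z j)\<bar> \<le>
      L * (2 * pi) * sqrt (\<Sum>j. (of_int (freq j))\<^sup>2 * (cmod (c j))\<^sup>2) * sqrt (\<Sum>j. (cmod (c j))\<^sup>2)"
    by (simp add: D2_def ng)
qed

text \<open>\<open>\<theta>\<close> plays the role of the sign of \<open>b - \<mu>\<close>, mollified at scale \<open>\<delta>\<close> around its jumps.\<close>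

definition nondegenerate :: "(real \<Rightarrow> real) \<Rightarrow> real \<Rightarrow> real \<Rightarrow> bool" where
  "nondegenerate b m K \<longleftrightarrow> (\<forall>\<mu>. \<forall>\<delta>\<in>{0<..1}. \<exists>\<theta> E.
     periodic1 \<theta> \<and> \<theta> \<in> borel_measurable borel \<and> (\<forall>y. \<bar>\<theta> y\<bar> \<le> 1) \<and>
     (\<forall>y h. \<bar>\<theta> (y + h) - \<theta> y\<bar> \<le> 1 / \<delta> * \<bar>h\<bar>) \<and> (\<forall>y. 0 \<le> (b y - \<mu>) * \<theta> y) \<and>
     E \<in> sets borel \<and> measure circ (E \<inter> {0..<1}) \<le> K * \<delta> \<and>
     (\<forall>y\<in>{0..<1} - E. m * \<delta> \<le> (b y - \<mu>) * \<theta> y))"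

text \<open>Here \<open>e\<close> is the ratio of the multiplier scale to r. The sup bound carries
  the factor 5 / r and the bad set has measure at most K e r, so e \<le> 1 / (10 K) makes the
  product at most 1/2. The number 2 / (m e^2) is the coefficient of the commutator term, and half
  its square comes from Young's inequality; 1 and 1 / (m e) come from the gradient and from the
  forcing.\<close>

definition resolvent_const :: "real \<Rightarrow> real \<Rightarrow> real" where
  "resolvent_const m K =
     (let e = min 1 (1 / (10 * K)) in 2 * (1 + 1 / (m * e) + (2 / (m * e\<^sup>2))\<^sup>2 / 2))"

lemma resolvent_const_pos: "0 < m \<Longrightarrow> 0 < K \<Longrightarrow> 0 < resolvent_const m K"
  unfolding resolvent_const_def Let_def by (intro mult_pos_pos add_pos_nonneg) auto

text \<open>Here \<open>r\<close> stands for \<open>\<nu>\<^bsup>1/3\<^esup>\<close>, and \<open>V\<close> for the Fourier coefficients of \<open>b\<close> times \<open>fser c\<close>; the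
  scale of the multiplier is \<open>\<delta> = e r\<close> with \<open>e\<close> as in the constant above.\<close>

lemma resolvent_estimate:
  fixes b :: "real \<Rightarrow> real" and c F V :: "nat \<Rightarrow> complex" and k :: int
  assumes bm: "b \<in> borel_measurable borel" and bB: "\<And>y. \<bar>b y\<bar> \<le> B"
    and nd: "nondegenerate b m K" and m: "0 < m" and K: "0 < K"
    and r: "0 < r" "r \<le> 1" and k: "k \<noteq> 0"
    and c: "summable (\<lambda>j. (cmod (c j))\<^sup>2)" and F: "summable (\<lambda>j. (cmod (F j))\<^sup>2)"
    and V: "summable (\<lambda>j. (cmod (V j))\<^sup>2)"
    and Vsums: "\<And>j. (\<lambda>i. c i * (\<integral>y. of_real (b y) * fmode (freq i) y * cnj (fmode (freq j) y) \<partial>circ)) sums V j"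
    and eq: "\<And>j. (\<i> * of_real \<tau> + of_real (4 * pi\<^sup>2 * r ^ 3 * ((of_int k)\<^sup>2 + (of_int (freq j))\<^sup>2))) * c j
        + 2 * pi * \<i> * of_int k * V j = F j"
  shows "(\<Sum>j. (cmod (c j))\<^sup>2) \<le> (resolvent_const m K / r)\<^sup>2 * (\<Sum>j. (cmod (F j))\<^sup>2)"
proof -
  define e where "e = min 1 (1 / (10 * K))"
  define G where "G = resolvent_const m K"
  note bm[measurable]
  define q where "q = (\<lambda>j. real_of_int (freq j))"
  define X2 where "X2 = (\<Sum>j. (cmod (c j))\<^sup>2)"
  define F2 where "F2 = (\<Sum>j. (cmod (F j))\<^sup>2)"
  define D2 where "D2 = (\<Sum>j. (q j)\<^sup>2 * (cmod (c j))\<^sup>2)"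
  define P where "P = sqrt F2 * sqrt X2"
  define N where "N = 4 * pi\<^sup>2 * r ^ 3"
  have N: "0 < N" using r by (simp add: N_def)
  have k1: "1 \<le> \<bar>real_of_int k\<bar>" using k by linarith
  then have k2: "1 \<le> (real_of_int k)\<^sup>2" using one_le_power[of "\<bar>real_of_int k\<bar>" 2] by simp
  have X20: "0 \<le> X2" and F20: "0 \<le> F2" using c F by (auto simp: X2_def F2_def intro: suminf_nonneg)
  have eq': "(\<i> * of_real \<tau> + of_real (N * ((of_int k)\<^sup>2 + (q j)\<^sup>2))) * c j
        + 2 * pi * \<i> * of_int k * V j = F j" for j
    using eq[of j] by (simp add: N_def q_def)
  \<comment> \<open>Elliptic regularity: the diffusion is the real part of the symbol, and
    \<open>F\<close> and \<open>V\<close> are square summable, so (1 + q^2) c is square summable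
    too.\<close>
  have wt: "(N * (1 + (q j)\<^sup>2) * cmod (c j))\<^sup>2 \<le>
      2 * (cmod (F j))\<^sup>2 + 2 * (2 * pi * \<bar>of_int k\<bar>)\<^sup>2 * (cmod (V j))\<^sup>2" for j
  proof -
    let ?z = "\<i> * of_real \<tau> + complex_of_real (N * ((of_int k)\<^sup>2 + (q j)\<^sup>2))"
    have "N * (1 + (q j)\<^sup>2) \<le> N * ((of_int k)\<^sup>2 + (q j)\<^sup>2)"
      using N k2 by (intro mult_left_mono) auto
    also have "\<dots> = Re ?z" by simp
    also have "\<dots> \<le> cmod ?z" by (rule complex_Re_le_cmod)
    finally have "N * (1 + (q j)\<^sup>2) * cmod (c j) \<le> cmod (?z * c j)"
      by (simp add: norm_mult mult_right_mono)
    also have "?z * c j = F j - 2 * pi * \<i> * of_int k * V j"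
      using eq'[of j] by (simp add: algebra_simps)
    also have "cmod \<dots> \<le> cmod (F j) + 2 * pi * \<bar>of_int k\<bar> * cmod (V j)"
      using norm_triangle_ineq4[of "F j" "2 * pi * \<i> * of_int k * V j"] by (simp add: norm_mult)
    finally have "(N * (1 + (q j)\<^sup>2) * cmod (c j))\<^sup>2 \<le> (cmod (F j) + 2 * pi * \<bar>of_int k\<bar> * cmod (V j))\<^sup>2"
      using N by (intro power_mono) auto
    also have "\<dots> \<le> 2 * (cmod (F j))\<^sup>2 + 2 * (2 * pi * \<bar>of_int k\<bar> * cmod (V j))\<^sup>2"
      using sum_squares_bound[of "cmod (F j)" "2 * pi * \<bar>of_int k\<bar> * cmod (V j)"] by (simp add: power2_sum)
    finally show ?thesis by (simp add: power_mult_distrib)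
  qed
  have "summable (\<lambda>j. 2 * (cmod (F j))\<^sup>2 + 2 * (2 * pi * \<bar>of_int k\<bar>)\<^sup>2 * (cmod (V j))\<^sup>2)"
    using F V by (intro summable_add summable_mult)
  then have "summable (\<lambda>j. (N * (1 + (q j)\<^sup>2) * cmod (c j))\<^sup>2)"
    by (rule summable_comparison_test'[where N = 0]) (use wt in simp)
  then have "summable (\<lambda>j. (1 / N\<^sup>2) * (N * (1 + (q j)\<^sup>2) * cmod (c j))\<^sup>2)"
    by (rule summable_mult)
  then have wc: "summable (\<lambda>j. ((1 + (q j)\<^sup>2) * cmod (c j))\<^sup>2)"
    using N by (simp add: power_mult_distrib)
  have D: "summable (\<lambda>j. (q j)\<^sup>2 * (cmod (c j))\<^sup>2)"
  proof (rule summable_comparison_test'[OF wc, of 0])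
    fix j
    have "(q j)\<^sup>2 \<le> 1 * (1 + (q j)\<^sup>2)" by simp
    also have "\<dots> \<le> (1 + (q j)\<^sup>2) * (1 + (q j)\<^sup>2)" by (intro mult_right_mono) auto
    also have "\<dots> = (1 + (q j)\<^sup>2)\<^sup>2" by (rule power2_eq_square[symmetric])
    finally have "(q j)\<^sup>2 * (cmod (c j))\<^sup>2 \<le> (1 + (q j)\<^sup>2)\<^sup>2 * (cmod (c j))\<^sup>2"
      by (rule mult_right_mono) simp
    then show "norm ((q j)\<^sup>2 * (cmod (c j))\<^sup>2) \<le> ((1 + (q j)\<^sup>2) * cmod (c j))\<^sup>2"
      by (simp add: power_mult_distrib)
  qed
  have H: "summable (\<lambda>j. ((q j)\<^sup>2 * cmod (c j))\<^sup>2)"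
    by (rule summable_comparison_test'[OF wc, of 0]) (auto intro!: power_mono mult_right_mono)
  have D20: "0 \<le> D2" using D by (auto simp: D2_def intro: suminf_nonneg)
  note cn = summable_coef_weighted(1)[OF c D[unfolded q_def]]
  define g where "g = fser c"
  have gm[measurable]: "g \<in> borel_measurable borel" unfolding g_def by (rule fser_measurable[OF cn])
  have gs: "sq_int circ g" unfolding g_def by (rule sq_int_fser[OF cn])
  have ng: "norm_sq circ g = X2"
    unfolding g_def X2_def using norm_sq_fser[OF cn] by (simp add: sums_iff)
  have fg: "fcoef g = c" unfolding g_def using fcoef_fser[OF cn] by (simp add: fun_eq_iff)
  have bg: "sq_int circ (\<lambda>y. of_real (b y) * g y)"
    by (rule sq_int_bounded_mult(1)[OF gs, where B = B]) (use bB in auto)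
  have fV: "fcoef (\<lambda>y. of_real (b y) * g y) j = V j" for j
  proof -
    have "sq_int circ (\<lambda>y. of_real (b y) * cnj (fmode (freq j) y))"
      by (rule sq_int_bounded_mult(1)[where B = B]) (use bB sq_int_fmode in auto)
    from integral_mult_fser_sums[OF cn this]
    have "(\<lambda>i. c i * (\<integral>y. of_real (b y) * fmode (freq i) y * cnj (fmode (freq j) y) \<partial>circ)) sums
        fcoef (\<lambda>y. of_real (b y) * g y) j"
      by (simp add: g_def fcoef_def mult_ac)
    then show ?thesis using Vsums sums_unique2 by blast
  qed
  \<comment> \<open>The equation paired with \<open>w\<close>. The second-derivative pairing
    \<open>Z\<close> is a parameter because it is evaluated differently for \<open>g\<close> and for
    its product with the multiplier.\<close>
  have test: "(\<lambda>j. F j * cnj (fcoef w j)) sums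
      (\<i> * of_real \<tau> * (\<integral>y. g y * cnj (w y) \<partial>circ) + of_real (N * (of_int k)\<^sup>2) * (\<integral>y. g y * cnj (w y) \<partial>circ)
        + of_real N * Z + 2 * pi * \<i> * of_int k * (\<integral>y. of_real (b y) * g y * cnj (w y) \<partial>circ))"
      (is "_ sums ?T")
    if w: "sq_int circ w" and Z: "(\<lambda>j. of_real ((q j)\<^sup>2) * c j * cnj (fcoef w j)) sums Z" for w Z
  proof -
    let ?l = "\<lambda>j. \<i> * of_real \<tau> * (c j * cnj (fcoef w j)) + of_real (N * (of_int k)\<^sup>2) * (c j * cnj (fcoef w j))
        + of_real N * (of_real ((q j)\<^sup>2) * c j * cnj (fcoef w j))
        + 2 * pi * \<i> * of_int k * (V j * cnj (fcoef w j))"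
    have "?l sums
      ?T"
      using parseval_inner_sums[OF gs w] parseval_inner_sums[OF bg w] Z unfolding fg fV
      by (intro sums_add sums_mult)
    moreover have "?l j = F j * cnj (fcoef w j)" for j
      unfolding eq'[of j, symmetric] by (simp add: algebra_simps)
    ultimately show ?thesis by simp
  qed
  have CS: "cmod (\<Sum>j. F j * cnj (fcoef w j)) \<le> P" if w: "sq_int circ w" "norm_sq circ w \<le> X2" for w
  proof -
    have s: "(\<lambda>j. (cmod (cnj (fcoef w j)))\<^sup>2) sums norm_sq circ w" using parseval_sums[OF w(1)] by simp
    have "cmod (\<Sum>j. F j * cnj (fcoef w j)) \<le> sqrt F2 * sqrt (norm_sq circ w)"
      using Cauchy_Schwarz_suminf(2)[OF F sums_summable[OF s]] sums_unique[OF s]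
      by (simp add: F2_def)
    also have "\<dots> \<le> P" unfolding P_def using w(2) F20 by (intro mult_left_mono) auto
    finally show ?thesis .
  qed
  \<comment> \<open>Testing with \<open>g\<close> and taking real parts: the \<tau> term and the
    transport term are purely imaginary and disappear.\<close>
  have E1: "N * D2 \<le> P"
  proof -
    have "(\<lambda>j. complex_of_real ((q j)\<^sup>2 * (cmod (c j))\<^sup>2)) sums of_real D2"
      unfolding sums_of_real_iff D2_def using D by (rule summable_sums)
    then have Z: "(\<lambda>j. of_real ((q j)\<^sup>2) * c j * cnj (fcoef g j)) sums of_real D2"
      by (simp add: fg complex_norm_square mult.assoc del: of_real_power)
    have I1: "(\<integral>y. g y * cnj (g y) \<partial>circ) = of_real X2"
      using norm_sq_eq_integral[of circ g] ng by simp
    have I2: "(\<integral>y. of_real (b y) * g y * cnj (g y) \<partial>circ) = of_real (\<integral>y. b y * (cmod (g y))\<^sup>2 \<partial>circ)"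
      by (simp add: complex_norm_square mult.assoc flip: integral_complex_of_real of_real_power)
    have "Re (\<Sum>j. F j * cnj (fcoef g j)) = N * (of_int k)\<^sup>2 * X2 + N * D2"
      unfolding sums_unique[OF test[OF gs Z], symmetric] I1 I2 by simp
    moreover have "Re (\<Sum>j. F j * cnj (fcoef g j)) \<le> P"
      using CS[OF gs] ng complex_Re_le_cmod order_trans by fastforce
    ultimately show ?thesis using N X20 by (smt (verit) mult_nonneg_nonneg zero_le_power2)
  qed
  have e: "0 < e" "e \<le> 1" using K by (simp_all add: e_def)
  define \<delta> where "\<delta> = e * r"
  have \<delta>: "0 < \<delta>" "\<delta> \<le> 1" using e r by (auto simp: \<delta>_def intro: mult_le_one)
  define \<mu> where "\<mu> = - \<tau> / (2 * pi * of_int k)"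
  obtain s E where s: "periodic1 s" "s \<in> borel_measurable borel" "\<And>y. \<bar>s y\<bar> \<le> 1"
      "\<And>y h. \<bar>s (y + h) - s y\<bar> \<le> 1 / \<delta> * \<bar>h\<bar>" "\<And>y. 0 \<le> (b y - \<mu>) * s y"
    and E: "E \<in> sets borel" "measure circ (E \<inter> {0..<1}) \<le> K * \<delta>"
      "\<And>y. y \<in> {0..<1} - E \<Longrightarrow> m * \<delta> \<le> (b y - \<mu>) * s y"
    using nd[unfolded nondegenerate_def, rule_format, of \<delta> \<mu>] \<delta> by auto
  note s(2)[measurable] E(1)[measurable]
  \<comment> \<open>This is (\<tau> + 2 pi k b) \<theta>, the weight of |g|^2 in the imaginary part
    of the tested equation. The factor sgn k keeps it nonnegative for negative k as well.\<close>
  define p where "p = (\<lambda>y. (2 * pi * of_int k) * ((b y - \<mu>) * (sgn (of_int k) * s y)))"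
  define \<theta> where "\<theta> = (\<lambda>y. sgn (of_int k) * s y)"
  have p: "p y = (\<tau> + 2 * pi * of_int k * b y) * \<theta> y" for y
    using k by (simp add: p_def \<theta>_def \<mu>_def field_simps)
  have p': "p y = 2 * pi * \<bar>of_int k\<bar> * ((b y - \<mu>) * s y)" for y
    unfolding p_def by (simp add: mult.assoc abs_sgn mult.left_commute mult.commute)
  have p0: "0 \<le> p y" for y unfolding p' by (intro mult_nonneg_nonneg s(5)) auto
  have pE: "2 * pi * m * \<delta> \<le> p y" if "y \<in> {0..<1} - E" for y
  proof -
    have "2 * pi * m * \<delta> * 1 \<le> 2 * pi * m * \<delta> * \<bar>of_int k\<bar>"
      using k1 m \<delta> by (intro mult_left_mono) auto
    also have "\<dots> = 2 * pi * \<bar>of_int k\<bar> * (m * \<delta>)" by simp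
    also have "\<dots> \<le> p y" unfolding p' by (intro mult_left_mono E(3) that) auto
    finally show ?thesis by simp
  qed
  have pB: "\<bar>p y\<bar> \<le> \<bar>\<tau>\<bar> + 2 * pi * \<bar>of_int k\<bar> * B" for y
  proof -
    have "\<bar>sgn (real_of_int k)\<bar> = 1" using k by (simp add: abs_sgn_eq)
    then have "\<bar>p y\<bar> \<le> \<bar>\<tau> + 2 * pi * of_int k * b y\<bar> * 1"
      unfolding p abs_mult \<theta>_def using s(3)[of y] by (intro mult_left_mono) auto
    also have "\<dots> \<le> \<bar>\<tau>\<bar> + 2 * pi * \<bar>of_int k\<bar> * \<bar>b y\<bar>"
      using abs_triangle_ineq[of \<tau> "2 * pi * of_int k * b y"] by (simp add: abs_mult)
    also have "\<dots> \<le> \<bar>\<tau>\<bar> + 2 * pi * \<bar>of_int k\<bar> * B"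
      using bB by (intro add_left_mono mult_left_mono) auto
    finally show ?thesis .
  qed
  have pm[measurable]: "p \<in> borel_measurable borel" unfolding p_def by measurable
  have ig: "integrable circ (\<lambda>y. (cmod (g y))\<^sup>2)" using gs by (simp add: sq_int_def)
  have ip: "integrable circ (\<lambda>y. p y * (cmod (g y))\<^sup>2)"
  proof (rule Bochner_Integration.integrable_bound)
    show "integrable circ (\<lambda>y. (\<bar>\<tau>\<bar> + 2 * pi * \<bar>of_int k\<bar> * B) * (cmod (g y))\<^sup>2)" using ig by simp
    show "AE y in circ. norm (p y * (cmod (g y))\<^sup>2) \<le> norm ((\<bar>\<tau>\<bar> + 2 * pi * \<bar>of_int k\<bar> * B) * (cmod (g y))\<^sup>2)"
    proof (rule AE_I2)
      fix y
      have "\<bar>p y\<bar> * (cmod (g y))\<^sup>2 \<le> \<bar>\<bar>\<tau>\<bar> + 2 * pi * \<bar>of_int k\<bar> * B\<bar> * (cmod (g y))\<^sup>2"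
        using pB[of y] by (intro mult_right_mono) auto
      then show "norm (p y * (cmod (g y))\<^sup>2) \<le> norm ((\<bar>\<tau>\<bar> + 2 * pi * \<bar>of_int k\<bar> * B) * (cmod (g y))\<^sup>2)"
        by (simp add: abs_mult)
    qed
  qed measurable
  \<comment> \<open>Testing with \<theta> g and taking imaginary parts: the k^2 term is real and
    drops out, and of the second-derivative term only the commutator remains.\<close>
  have E2: "(\<integral>y. p y * (cmod (g y))\<^sup>2 \<partial>circ) \<le> P + r ^ 3 * (1 / \<delta> * (2 * pi) * sqrt D2 * sqrt X2)"
  proof -
    have sg: "\<bar>sgn (real_of_int k)\<bar> = 1" using k by (simp add: abs_sgn_eq)
    have th1: "\<bar>\<theta> y\<bar> \<le> 1" for y using s(3)[of y] by (simp add: \<theta>_def abs_mult sg)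
    have th2: "\<bar>\<theta> (y + h) - \<theta> y\<bar> \<le> 1 / \<delta> * \<bar>h\<bar>" for y h
      using s(4)[of y h] k by (simp add: \<theta>_def abs_mult sg flip: right_diff_distrib)
    have th3: "periodic1 \<theta>" using s(1) by (simp add: periodic1_def \<theta>_def)
    have th4[measurable]: "\<theta> \<in> borel_measurable borel" unfolding \<theta>_def by measurable
    define w where "w = (\<lambda>y. of_real (\<theta> y) * g y)"
    have ws: "sq_int circ w" "norm_sq circ w \<le> 1\<^sup>2 * norm_sq circ g"
    proof -
      have "(\<lambda>y. complex_of_real (\<theta> y)) \<in> borel_measurable circ" by measurable
      moreover have "cmod (complex_of_real (\<theta> y)) \<le> 1" for y using th1 by simp
      ultimately show "sq_int circ w" "norm_sq circ w \<le> 1\<^sup>2 * norm_sq circ g"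
        unfolding w_def by (rule sq_int_bounded_mult[OF gs])+
    qed
    have qj: "of_int (freq j) = q j" for j by (simp add: q_def)
    note comm = Lipschitz_multiplier_commutator[OF th3 th4 th1 th2 c D[unfolded q_def] H[unfolded q_def],
        folded g_def, folded w_def, unfolded qj, folded X2_def D2_def]
    define Z where "Z = (\<Sum>j. of_real ((2 * pi * q j)\<^sup>2) * c j * cnj (fcoef w j))"
    have "(\<lambda>j. (1 / (4 * pi\<^sup>2)) * (of_real ((2 * pi * q j)\<^sup>2) * c j * cnj (fcoef w j))) sums ((1 / (4 * pi\<^sup>2)) * Z)"
      unfolding Z_def by (intro sums_mult summable_sums comm(1))
    then have Z: "(\<lambda>j. of_real ((q j)\<^sup>2) * c j * cnj (fcoef w j)) sums ((1 / (4 * pi\<^sup>2)) * Z)"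
      by (simp add: power_mult_distrib mult.assoc)
    have I1: "(\<integral>y. g y * cnj (w y) \<partial>circ) = of_real (\<integral>y. \<theta> y * (cmod (g y))\<^sup>2 \<partial>circ)"
      by (simp add: w_def complex_norm_square mult_ac flip: integral_complex_of_real of_real_power)
    have I2: "(\<integral>y. of_real (b y) * g y * cnj (w y) \<partial>circ) = of_real (\<integral>y. b y * (\<theta> y * (cmod (g y))\<^sup>2) \<partial>circ)"
      by (simp add: w_def complex_norm_square mult_ac flip: integral_complex_of_real of_real_power)
    have i1: "integrable circ (\<lambda>y. \<theta> y * (cmod (g y))\<^sup>2)"
    proof (rule Bochner_Integration.integrable_bound[OF ig])
      show "AE y in circ. norm (\<theta> y * (cmod (g y))\<^sup>2) \<le> norm ((cmod (g y))\<^sup>2)"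
        by (rule AE_I2) (use th1 in \<open>simp add: abs_mult mult_left_le_one_le\<close>)
    qed measurable
    have i2: "integrable circ (\<lambda>y. b y * (\<theta> y * (cmod (g y))\<^sup>2))"
    proof (rule Bochner_Integration.integrable_bound)
      show "integrable circ (\<lambda>y. B * (cmod (g y))\<^sup>2)" using ig by simp
      show "AE y in circ. norm (b y * (\<theta> y * (cmod (g y))\<^sup>2)) \<le> norm (B * (cmod (g y))\<^sup>2)"
      proof (rule AE_I2)
        fix y
        have "\<bar>b y\<bar> * (\<bar>\<theta> y\<bar> * (cmod (g y))\<^sup>2) \<le> \<bar>B\<bar> * (1 * (cmod (g y))\<^sup>2)"
          using th1[of y] bB[of y] by (intro mult_mono) auto
        then show "norm (b y * (\<theta> y * (cmod (g y))\<^sup>2)) \<le> norm (B * (cmod (g y))\<^sup>2)"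
          by (simp add: abs_mult)
      qed
    qed measurable
    have "(\<integral>y. p y * (cmod (g y))\<^sup>2 \<partial>circ) =
        (\<integral>y. \<tau> * (\<theta> y * (cmod (g y))\<^sup>2) + 2 * pi * of_int k * (b y * (\<theta> y * (cmod (g y))\<^sup>2)) \<partial>circ)"
      by (rule Bochner_Integration.integral_cong) (auto simp: p algebra_simps)
    also have "\<dots> = \<tau> * (\<integral>y. \<theta> y * (cmod (g y))\<^sup>2 \<partial>circ) + 2 * pi * of_int k * (\<integral>y. b y * (\<theta> y * (cmod (g y))\<^sup>2) \<partial>circ)"
      using i1 i2 by simp
    also have "\<dots> = Im (\<Sum>j. F j * cnj (fcoef w j)) - Im (of_real N * ((1 / (4 * pi\<^sup>2)) * Z))"
      unfolding sums_unique[OF test[OF ws(1) Z], symmetric] I1 I2 by simp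
    also have "of_real N * ((1 / (4 * pi\<^sup>2)) * Z) = of_real (r ^ 3) * Z"
      by (simp add: N_def)
    also have "Im (of_real (r ^ 3) * Z) = r ^ 3 * Im Z" by (simp del: of_real_power)
    also have "Im (\<Sum>j. F j * cnj (fcoef w j)) - r ^ 3 * Im Z \<le> P + r ^ 3 * \<bar>Im Z\<bar>"
    proof -
      have "Im (\<Sum>j. F j * cnj (fcoef w j)) \<le> P"
        using CS[OF ws(1)] ws(2) ng abs_Im_le_cmod[of "\<Sum>j. F j * cnj (fcoef w j)"] by simp
      moreover have "- (r ^ 3 * Im Z) \<le> r ^ 3 * \<bar>Im Z\<bar>"
        using r mult_left_mono[of "- Im Z" "\<bar>Im Z\<bar>" "r ^ 3"] by simp
      ultimately show ?thesis by simp
    qed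
    also have "\<dots> \<le> P + r ^ 3 * (1 / \<delta> * (2 * pi) * sqrt D2 * sqrt X2)"
      using comm(2) r by (intro add_left_mono mult_left_mono) (auto simp: Z_def)
    finally show ?thesis .
  qed
  \<comment> \<open>Outside \<open>E\<close> the weight is at least 2 pi m \<delta>. On
    \<open>E\<close> it is merely nonnegative, and subtracting the sup bound of |g|^2 there makes
    the comparison function nonpositive; by the choice of \<open>e\<close> the total subtracted is
    at most half of X2 + r^2 D2, before the factor 2 pi m \<delta>.\<close>
  have E3: "2 * pi * m * \<delta> * (X2 - (X2 + r\<^sup>2 * D2) / 2) \<le> (\<integral>y. p y * (cmod (g y))\<^sup>2 \<partial>circ)"
  proof -
    let ?S = "\<Sum>j. cmod (c j)" and ?g = "\<lambda>y. 2 * pi * m * \<delta> * ((cmod (g y))\<^sup>2 - 5 / r * (X2 + r\<^sup>2 * D2) * indicator E y)"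
    have "?S\<^sup>2 \<le> 5 / r * (X2 + r\<^sup>2 * D2)"
      using summable_coef_weighted(2)[OF c D[unfolded q_def] r] by (simp add: X2_def D2_def q_def)
    moreover have "(cmod (g y))\<^sup>2 \<le> ?S\<^sup>2" for y
      unfolding g_def using cmod_fser_le[OF cn] by (intro power_mono) auto
    ultimately have sup: "(cmod (g y))\<^sup>2 \<le> 5 / r * (X2 + r\<^sup>2 * D2)" for y using order_trans by blast
    have iE: "integrable circ (indicator E :: real \<Rightarrow> real)"
      by (rule circ.integrable_const_bound[where B = 1]) (auto simp: indicator_def)
    have ind: "(\<integral>y. indicator E y \<partial>circ) = measure circ (E \<inter> {0..<1})"
    proof -
      have "(\<integral>y. indicator E y \<partial>circ) = (\<integral>y. indicator (E \<inter> {0..<1}) y \<partial>circ :: real)"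
        by (rule Bochner_Integration.integral_cong) (auto simp: indicator_def)
      then show ?thesis using sets_circ[OF E(1)] by simp
    qed
    have "5 * K * e \<le> 1 / 2"
      using K mult_left_mono[of e "1 / (10 * K)" "5 * K"] by (simp add: e_def)
    then have mE: "5 / r * (\<integral>y. indicator E y \<partial>circ) \<le> 1 / 2"
    proof -
      have "5 / r * measure circ (E \<inter> {0..<1}) \<le> 5 / r * (K * \<delta>)"
        using E(2) r by (intro mult_left_mono) auto
      also have "\<dots> = 5 * K * e" using r by (simp add: \<delta>_def)
      finally show ?thesis using \<open>5 * K * e \<le> 1 / 2\<close> ind by simp
    qed
    have "2 * pi * m * \<delta> * (X2 - (X2 + r\<^sup>2 * D2) / 2) \<le>
        2 * pi * m * \<delta> * (X2 - 5 / r * (X2 + r\<^sup>2 * D2) * (\<integral>y. indicator E y \<partial>circ))"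
    proof (intro mult_left_mono diff_left_mono)
      show "5 / r * (X2 + r\<^sup>2 * D2) * (\<integral>y. indicator E y \<partial>circ) \<le> (X2 + r\<^sup>2 * D2) / 2"
      proof -
        have "0 \<le> X2 + r\<^sup>2 * D2" using X20 D20 by simp
        from mult_right_mono[OF mE this] show ?thesis
          by (simp only: mult.assoc mult.commute[of "X2 + r\<^sup>2 * D2"] mult_1 times_divide_eq_left)
      qed
    qed (use m \<delta> in simp)
    also have "\<dots> = (\<integral>y. ?g y \<partial>circ)"
      using ig iE ng by (simp add: norm_sq_def)
    also have "\<dots> \<le> (\<integral>y. p y * (cmod (g y))\<^sup>2 \<partial>circ)"
    proof (rule integral_mono)
      show "integrable circ (\<lambda>y. ?g y)"
        using ig iE by simp
      fix y assume y: "y \<in> space circ"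
      show "?g y \<le> p y * (cmod (g y))\<^sup>2"
      proof (cases "y \<in> E")
        case True
        then have "?g y \<le> 0"
          using sup[of y] m \<delta> by (intro mult_nonneg_nonpos) auto
        also have "0 \<le> p y * (cmod (g y))\<^sup>2" using p0 by simp
        finally show ?thesis .
      next
        case False
        then show ?thesis using pE[of y] y by (simp add: mult_right_mono)
      qed
    qed (rule ip)
    finally show ?thesis .
  qed
  \<comment> \<open>\<open>Y\<close> measures the gradient in units of the layer width r, up to 2
    pi, which makes it comparable to \<open>X\<close>.\<close>
  define X Y where "X = sqrt X2" and "Y = r * sqrt D2"
  define M where "M = 2 / (m * e\<^sup>2)"
  have X: "X\<^sup>2 = X2" "0 \<le> X" using X20 by (simp_all add: X_def)
  have Y: "Y\<^sup>2 = r\<^sup>2 * D2" "0 \<le> Y" using D20 r by (simp_all add: Y_def power_mult_distrib)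
  have P0: "0 \<le> P" using X20 F20 by (simp add: P_def)
  have Yle: "Y\<^sup>2 \<le> P / r"
  proof -
    have "1 \<le> pi\<^sup>2" using pi_gt3 by (intro one_le_power) simp
    then have "1 \<le> 4 * pi\<^sup>2" by linarith
    then have "r ^ 3 * D2 \<le> 4 * pi\<^sup>2 * (r ^ 3 * D2)"
      using mult_right_mono[of 1 "4 * pi\<^sup>2" "r ^ 3 * D2"] r D20 by simp
    also have "\<dots> \<le> P" using E1 by (simp add: N_def mult_ac)
    finally show ?thesis using r unfolding Y(1) by (simp add: field_simps power3_eq_cube power2_eq_square)
  qed
  have main: "X\<^sup>2 - Y\<^sup>2 \<le> P / (m * e * r) + M * Y * X"
  proof -
    have "pi * m * \<delta> * (X\<^sup>2 - Y\<^sup>2) \<le> P + r ^ 3 * (1 / \<delta> * (2 * pi) * sqrt D2 * sqrt X2)"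
    proof -
      have "2 * pi * m * \<delta> * (X2 - (X2 + r\<^sup>2 * D2) / 2) = pi * m * \<delta> * (X\<^sup>2 - Y\<^sup>2)"
        unfolding X Y by (simp add: field_simps)
      then show ?thesis using order_trans[OF E3 E2] by argo
    qed
    then have "X\<^sup>2 - Y\<^sup>2 \<le> (P + r ^ 3 * (1 / \<delta> * (2 * pi) * sqrt D2 * sqrt X2)) / (pi * m * \<delta>)"
      using m \<delta> by (subst pos_le_divide_eq) (auto simp: mult.commute)
    also have "\<dots> = P / (m * e * r) / pi + M * Y * X"
      using m e r by (simp add: \<delta>_def M_def X_def Y_def field_simps power3_eq_cube power2_eq_square)
    also have "\<dots> \<le> P / (m * e * r) / 1 + M * Y * X"
      using m e r P0 pi_gt3 by (intro add_right_mono divide_left_mono divide_nonneg_nonneg) auto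
    finally show ?thesis by simp
  qed
  \<comment> \<open>Young's inequality lets half of X^2 be absorbed on the left; \<open>Yle\<close>
    turns the remaining Y^2 into P / r.\<close>
  have "M * Y * X \<le> X\<^sup>2 / 2 + (M * Y)\<^sup>2 / 2"
    using sum_squares_bound[of "M * Y" X] by simp
  also have "(M * Y)\<^sup>2 / 2 = M\<^sup>2 / 2 * Y\<^sup>2" by (simp add: power_mult_distrib)
  finally have "X\<^sup>2 / 2 \<le> P / (m * e * r) + (1 + M\<^sup>2 / 2) * Y\<^sup>2"
    using main unfolding distrib_right by linarith
  also have "\<dots> \<le> P / (m * e * r) + (1 + M\<^sup>2 / 2) * (P / r)"
    using Yle by (intro add_left_mono mult_left_mono) auto
  also have "\<dots> = G / r * P / 2"
  proof -
    have G: "G = 2 * (1 + 1 / (m * e) + M\<^sup>2 / 2)" by (simp add: G_def M_def e_def resolvent_const_def Let_def)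
    show ?thesis unfolding G using m e r by (simp add: field_simps)
  qed
  finally have fin: "X\<^sup>2 \<le> G / r * P" by simp
  have "X \<le> G / r * sqrt F2"
  proof (cases "X = 0")
    case True
    have "0 \<le> G" using resolvent_const_pos[OF m K] by (simp add: G_def)
    then show ?thesis using True r F20 by simp
  next
    case False
    then have "X > 0" using X(2) by simp
    moreover have "X * X \<le> G / r * sqrt F2 * X"
      using fin by (simp add: P_def power2_eq_square mult.assoc flip: X_def)
    ultimately show ?thesis by (intro mult_right_le_imp_le[of X X])
  qed
  then have "X\<^sup>2 \<le> (G / r * sqrt F2)\<^sup>2" using X(2) by (rule power_mono)
  then show ?thesis
    using F20 by (simp add: X power_mult_distrib power_divide X2_def F2_def G_def)
qed

subsection \<open>Fourier modes of solutions\<close>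

lemma has_vector_derivative_cmod_square:
  assumes "(f has_vector_derivative f') (at t within S)"
  shows "((\<lambda>t. (cmod (f t))\<^sup>2) has_vector_derivative 2 * Re (cnj (f t) * f')) (at t within S)"
  using bounded_bilinear.has_vector_derivative[OF bounded_bilinear_inner assms assms]
  by (simp add: power2_norm_eq_inner inner_complex_def algebra_simps)

lemma cmod_mult_le_half_sum: "cmod (a * b) \<le> ((cmod a)\<^sup>2 + (cmod b)\<^sup>2) / 2"
  using sum_squares_bound[of "cmod a" "cmod b"] by (simp add: norm_mult)

text \<open>Bessel's inequality for a function with values in the sequence space l2, bounded there
  by C. It is done coordinatewise with finite sums, which avoids integrating l2-valued
  functions.\<close>

lemma Bessel_family:
  assumes a: "\<And>j. a j \<in> borel_measurable circ"
    and C: "\<And>J x. x \<in> {0..<1} \<Longrightarrow> (\<Sum>j<J. (cmod (a j x))\<^sup>2) \<le> C"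
  shows "sq_int circ (a j)" "summable (\<lambda>j. (cmod (fcoef (a j) n))\<^sup>2)"
    "(\<Sum>n<N. \<Sum>j. (cmod (fcoef (a j) n))\<^sup>2) \<le> C"
proof -
  have le: "(cmod (a j x))\<^sup>2 \<le> C" if "x \<in> {0..<1}" for j x
  proof -
    have "(cmod (a j x))\<^sup>2 \<le> (\<Sum>j<Suc j. (cmod (a j x))\<^sup>2)" by (simp add: sum_nonneg)
    then show ?thesis using C[OF that, of "Suc j"] by linarith
  qed
  have sq: "sq_int circ (a j)" for j
    by (rule sq_int_of_bounded[OF finite_measure_circ a, where B = "sqrt C"])
      (use le in \<open>auto intro: real_le_rsqrt\<close>)
  then show "sq_int circ (a j)" .
  have "(\<Sum>j<J. norm_sq circ (a j)) \<le> C" for J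
  proof -
    have "(\<Sum>j<J. norm_sq circ (a j)) = (\<integral>x. (\<Sum>j<J. (cmod (a j x))\<^sup>2) \<partial>circ)"
      unfolding norm_sq_def using sq by (subst Bochner_Integration.integral_sum) (auto simp: sq_int_def)
    also have "\<dots> \<le> (\<integral>x. C \<partial>circ)"
      using sq C by (intro integral_mono) (auto simp: sq_int_def)
    finally show ?thesis by (simp add: measure_circ)
  qed
  moreover have "(\<Sum>j<J. \<Sum>n\<in>A. (cmod (fcoef (a j) n))\<^sup>2) \<le> (\<Sum>j<J. norm_sq circ (a j))"
    if "finite A" for A J
    by (intro sum_mono Bessel_finite sq that)
  ultimately have fin: "(\<Sum>j<J. \<Sum>n\<in>A. (cmod (fcoef (a j) n))\<^sup>2) \<le> C" if "finite A" for A J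
    using that order_trans by blast
  show s: "summable (\<lambda>j. (cmod (fcoef (a j) n))\<^sup>2)" for n
    by (rule bounded_imp_summable[where B = C]) (use fin[of "{n}" "Suc _"] in \<open>auto simp: lessThan_Suc_atMost\<close>)
  have "(\<Sum>n<N. \<Sum>j. (cmod (fcoef (a j) n))\<^sup>2) = (\<Sum>j. \<Sum>n<N. (cmod (fcoef (a j) n))\<^sup>2)"
    by (rule suminf_sum[symmetric]) (rule s)
  also have "\<dots> \<le> C"
    by (rule suminf_le_const) (use fin s in \<open>auto intro: summable_sum\<close>)
  finally show "(\<Sum>n<N. \<Sum>j. (cmod (fcoef (a j) n))\<^sup>2) \<le> C" .
qed

lemma integral_sin_pi_square: "(\<integral>x. (sin (pi * x))\<^sup>2 \<partial>circ) = 1 / 2"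
proof -
  have "(\<integral>x. (sin (pi * x))\<^sup>2 \<partial>circ) = (1 / 2 - sin (2 * pi * 1) / (4 * pi)) - (0 / 2 - sin (2 * pi * 0) / (4 * pi))"
  proof (rule integral_circ_FTC)
    fix x :: real
    have "((\<lambda>x. x / 2 - sin (2 * pi * x) / (4 * pi)) has_real_derivative 1 / 2 - cos (2 * (pi * x)) / 2) (at x within {0..1})"
      by (auto intro!: derivative_eq_intros simp: field_simps)
    then show "((\<lambda>x. x / 2 - sin (2 * pi * x) / (4 * pi)) has_vector_derivative (sin (pi * x))\<^sup>2) (at x within {0..1})"
      by (simp add: cos_double_sin diff_divide_distrib has_real_derivative_iff_has_vector_derivative)
  qed (intro continuous_intros)
  then show ?thesis by simp
qed

locale shear_mode =
  fixes b :: "real \<Rightarrow> real" and B m K r :: real and k :: int and G :: "real \<Rightarrow> real \<Rightarrow> complex"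
  assumes b_meas: "b \<in> borel_measurable borel" and b_bound: "\<And>y. \<bar>b y\<bar> \<le> B"
    and nondeg: "nondegenerate b m K" and m: "0 < m" and K: "0 < K"
    and r: "0 < r" "r \<le> 1"
    and G_sq: "\<And>t. 0 \<le> t \<Longrightarrow> sq_int circ (G t)"
    and G_cont: "\<And>j. continuous_on {0..} (\<lambda>t. fcoef (G t) j)"
    and bG_cont: "\<And>j. continuous_on {0..} (\<lambda>t. fcoef (\<lambda>y. of_real (b y) * G t y) j)"
    and ode: "\<And>t j. 0 \<le> t \<Longrightarrow> ((\<lambda>t. fcoef (G t) j) has_vector_derivative
        - (2 * pi * \<i> * of_int k) * fcoef (\<lambda>y. of_real (b y) * G t y) j
        - of_real (4 * pi\<^sup>2 * r ^ 3 * ((of_int k)\<^sup>2 + (of_int (freq j))\<^sup>2)) * fcoef (G t) j) (at t within {0..})"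
    and G_bounded: "\<And>T. \<exists>C. \<forall>t\<in>{0..T}. norm_sq circ (G t) \<le> C"
begin

definition u :: "real \<Rightarrow> nat \<Rightarrow> complex" where "u t j = fcoef (G t) j"
definition v :: "real \<Rightarrow> nat \<Rightarrow> complex" where "v t j = fcoef (\<lambda>y. of_real (b y) * G t y) j"
definition damping :: "nat \<Rightarrow> real" where
  "damping j = 4 * pi\<^sup>2 * r ^ 3 * ((of_int k)\<^sup>2 + (of_int (freq j))\<^sup>2)"
definition u' :: "real \<Rightarrow> nat \<Rightarrow> complex" where
  "u' t j = - (2 * pi * \<i> * of_int k) * v t j - of_real (damping j) * u t j"
definition energy :: "real \<Rightarrow> real" where "energy t = norm_sq circ (G t)"

lemma damping_nonneg: "0 \<le> damping j"
  using r by (simp add: damping_def)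

lemma u_cont: "continuous_on {0..} (\<lambda>t. u t j)" and v_cont: "continuous_on {0..} (\<lambda>t. v t j)"
  using G_cont bG_cont by (simp_all add: u_def v_def)

lemma u'_cont: "continuous_on {0..} (\<lambda>t. u' t j)"
  unfolding u'_def by (intro continuous_intros u_cont v_cont)

lemma u_deriv: "0 \<le> t \<Longrightarrow> ((\<lambda>t. u t j) has_vector_derivative u' t j) (at t within {0..})"
  using ode by (simp add: u_def v_def u'_def damping_def)

lemma bG_sq: "0 \<le> t \<Longrightarrow> sq_int circ (\<lambda>y. of_real (b y) * G t y)"
  and norm_sq_bG: "0 \<le> t \<Longrightarrow> norm_sq circ (\<lambda>y. of_real (b y) * G t y) \<le> B\<^sup>2 * energy t"
  unfolding energy_def
  using sq_int_bounded_mult[OF G_sq, of t "\<lambda>y. of_real (b y)" B] b_bound b_meas by auto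

lemma u_sums: "0 \<le> t \<Longrightarrow> (\<lambda>j. (cmod (u t j))\<^sup>2) sums energy t"
  unfolding u_def energy_def by (rule parseval_sums[OF G_sq])

lemma u_Bessel: "0 \<le> t \<Longrightarrow> (\<Sum>j<n. (cmod (u t j))\<^sup>2) \<le> energy t"
  unfolding u_def energy_def by (rule Bessel[OF G_sq])

lemma v_Bessel: "0 \<le> t \<Longrightarrow> (\<Sum>j<n. (cmod (v t j))\<^sup>2) \<le> B\<^sup>2 * energy t"
  unfolding v_def using Bessel[OF bG_sq] norm_sq_bG order_trans by blast

lemma energy_nonneg [simp]: "0 \<le> energy t"
  by (simp add: energy_def)

text \<open>The energy series cannot be differentiated termwise without further regularity, so
  finite truncations are used. Damping has a sign and is discarded. The truncated transport term
  need not vanish, but it converges to the imaginary part of the real number \<integral> b |G|^2,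
  and it is dominated by means of Bessel's inequality.\<close>

lemma energy_mono:
  assumes st: "0 \<le> s" "s \<le> t"
  shows "energy t \<le> energy s"
proof -
  obtain C where C: "\<And>x. x \<in> {0..t} \<Longrightarrow> energy x \<le> C"
    using G_bounded[of t] unfolding energy_def by blast
  define P where "P = (\<lambda>n x. \<Sum>j<n. (cmod (u x j))\<^sup>2)"
  define P' where "P' = (\<lambda>n x. \<Sum>j<n. 2 * Re (cnj (u x j) * u' x j))"
  define h where "h = (\<lambda>n x. 4 * pi * of_int k * Im (\<Sum>j<n. v x j * cnj (u x j)))"
  let ?h = "\<lambda>n x. indicator {s..t} x *\<^sub>R h n x" and ?Q = "4 * pi * \<bar>of_int k\<bar> * ((B\<^sup>2 * C + C) / 2)"
  have sub: "{s..t} \<subseteq> {0..}" using st by auto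
  note cont = continuous_on_subset[OF u_cont sub] continuous_on_subset[OF v_cont sub]
    continuous_on_subset[OF u'_cont sub]
  have P'cont: "continuous_on {s..t} (P' n)" for n unfolding P'_def by (intro continuous_intros cont)
  have hcont: "continuous_on {s..t} (h n)" for n unfolding h_def by (intro continuous_intros cont)
  have le: "P n t - P n s \<le> (\<integral>x. ?h n x \<partial>lborel)" for n
  proof -
    have "P n t - P n s = (\<integral>x. indicator {s..t} x *\<^sub>R P' n x \<partial>lborel)"
    proof (rule integral_FTC_atLeastAtMost[symmetric, OF st(2) _ P'cont])
      fix x assume "s \<le> x" "x \<le> t"
      then have "0 \<le> x" using st by simp
      from has_vector_derivative_within_subset[OF u_deriv[OF this] sub]
      show "(P n has_vector_derivative P' n x) (at x within {s..t})"
        unfolding P_def P'_def by (intro has_vector_derivative_sum has_vector_derivative_cmod_square)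
    qed
    also have "\<dots> \<le> (\<integral>x. ?h n x \<partial>lborel)"
    proof (rule integral_mono)
      show "integrable lborel (\<lambda>x. indicator {s..t} x *\<^sub>R P' n x)"
        using borel_integrable_atLeastAtMost'[OF P'cont] by (simp add: set_integrable_def)
      show "integrable lborel (?h n)"
        using borel_integrable_atLeastAtMost'[OF hcont] by (simp add: set_integrable_def)
      fix x
      have "2 * Re (cnj (u x j) * u' x j) \<le> 4 * pi * of_int k * Im (v x j * cnj (u x j))" for j
      proof -
        have "2 * Re (cnj (u x j) * u' x j) =
            4 * pi * of_int k * Im (v x j * cnj (u x j)) - 2 * damping j * (cmod (u x j))\<^sup>2"
          by (simp only: cmod_power2) (simp add: u'_def algebra_simps power2_eq_square)
        then show ?thesis using damping_nonneg[of j] by simp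
      qed
      then have "P' n x \<le> h n x"
        unfolding P'_def h_def Im_sum sum_distrib_left by (rule sum_mono)
      then show "indicator {s..t} x *\<^sub>R P' n x \<le> ?h n x"
        by (simp add: indicator_def)
    qed
    finally show ?thesis .
  qed
  have "(\<lambda>n. \<integral>x. ?h n x \<partial>lborel) \<longlonglongrightarrow> (\<integral>x. 0 \<partial>(lborel :: real measure))"
  proof (rule integral_dominated_convergence[where w = "\<lambda>x. indicator {s..t} x *\<^sub>R (?Q)"])
    show "(?h n) \<in> borel_measurable lborel" for n
      using borel_integrable_atLeastAtMost'[OF hcont] by (simp add: set_integrable_def borel_measurable_integrable)
    show "integrable lborel (\<lambda>x. indicator {s..t} x *\<^sub>R (?Q))"
      using borel_integrable_atLeastAtMost'[OF continuous_on_const, of s t "?Q"]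
      by (simp only: set_integrable_def)
    show "AE x in lborel. (\<lambda>n. ?h n x) \<longlonglongrightarrow> 0"
    proof (rule AE_I2)
      fix x :: real
      show "(\<lambda>n. ?h n x) \<longlonglongrightarrow> 0"
      proof (cases "x \<in> {s..t}")
        case True
        then have x: "0 \<le> x" using st by simp
        have "(\<lambda>n. \<Sum>j<n. v x j * cnj (u x j)) \<longlonglongrightarrow> (\<integral>y. of_real (b y) * G x y * cnj (G x y) \<partial>circ)"
          using parseval_inner_sums[OF bG_sq[OF x] G_sq[OF x]] by (simp add: sums_def u_def v_def)
        also have "(\<integral>y. of_real (b y) * G x y * cnj (G x y) \<partial>circ) = of_real (\<integral>y. b y * (cmod (G x y))\<^sup>2 \<partial>circ)"
          by (simp add: complex_norm_square mult.assoc flip: integral_complex_of_real of_real_power)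
        finally have "(\<lambda>n. h n x) \<longlonglongrightarrow> 4 * pi * of_int k * Im (of_real (\<integral>y. b y * (cmod (G x y))\<^sup>2 \<partial>circ))"
          unfolding h_def by (intro tendsto_intros)
        then show ?thesis using True by simp
      qed simp
    qed
    show "AE x in lborel. norm (?h n x) \<le> indicator {s..t} x *\<^sub>R (?Q)" for n
    proof (rule AE_I2)
      fix x :: real
      show "norm (?h n x) \<le> indicator {s..t} x *\<^sub>R (?Q)"
      proof (cases "x \<in> {s..t}")
        case True
        then have x: "0 \<le> x" "energy x \<le> C" using st C by auto
        have BC: "B\<^sup>2 * energy x \<le> B\<^sup>2 * C" by (rule mult_left_mono[OF x(2)]) simp
        have "cmod (\<Sum>j<n. v x j * cnj (u x j)) \<le> (\<Sum>j<n. cmod (v x j * cnj (u x j)))"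
          by (rule norm_sum)
        also have "\<dots> \<le> (\<Sum>j<n. ((cmod (v x j))\<^sup>2 + (cmod (u x j))\<^sup>2) / 2)"
          using cmod_mult_le_half_sum[of "v x _" "cnj (u x _)"] by (intro sum_mono) simp
        also have "\<dots> = ((\<Sum>j<n. (cmod (v x j))\<^sup>2) + (\<Sum>j<n. (cmod (u x j))\<^sup>2)) / 2"
          by (simp only: sum_divide_distrib[symmetric] sum.distrib)
        also have "\<dots> \<le> (B\<^sup>2 * C + C) / 2"
          using order_trans[OF v_Bessel[OF x(1)] BC] order_trans[OF u_Bessel[OF x(1)] x(2)]
          by (intro divide_right_mono add_mono) auto
        finally have "\<bar>Im (\<Sum>j<n. v x j * cnj (u x j))\<bar> \<le> (B\<^sup>2 * C + C) / 2"
          using abs_Im_le_cmod order_trans by blast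
        then have "4 * pi * \<bar>of_int k\<bar> * \<bar>Im (\<Sum>j<n. v x j * cnj (u x j))\<bar> \<le>
            ?Q"
          by (rule mult_left_mono) simp
        then show ?thesis
          using True by (simp add: h_def abs_mult del: Im_sum)
      qed simp
    qed
  qed simp
  then have H: "(\<lambda>n. \<integral>x. ?h n x \<partial>lborel) \<longlonglongrightarrow> 0" by simp
  have "(\<lambda>n. P n t - P n s) \<longlonglongrightarrow> energy t - energy s"
    unfolding P_def using u_sums[of t] u_sums[of s] st by (intro tendsto_diff) (auto simp: sums_def)
  from LIMSEQ_le[OF this H] le show ?thesis by auto
qed


text \<open>Multiplying the mode by \<open>sin (\<pi> x)\<close>, \<open>x = (t - s) / S\<close>, makes it periodic in time, so that its
  Fourier coefficients in time solve the resolvent equation with forcing \<open>(\<pi> / S) cos (\<pi> x) u\<close>.\<close>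

lemma energy_decay:
  assumes k: "k \<noteq> 0" and s: "0 \<le> s"
  defines "A \<equiv> resolvent_const m K"
  defines "S \<equiv> 4 * pi * A / r"
  shows "energy (s + S) \<le> exp (- 2) * energy s"
proof -
  have "0 < A" unfolding A_def by (rule resolvent_const_pos[OF m K])
  then have A: "0 < A" and S: "0 < S" using r by (auto simp: S_def)
  define C where "C = energy s"
  have C0: "0 \<le> C" by (simp add: C_def)
  define t where "t = (\<lambda>x. s + S * x)"
  have t0: "0 \<le> t x" if "0 \<le> x" for x using that s S by (simp add: t_def)
  have tC: "energy (t x) \<le> C" if "0 \<le> x" for x
    unfolding C_def using energy_mono[OF s, of "t x"] that S by (simp add: t_def)
  define U where "U = (\<lambda>j x. of_real (sin (pi * x)) * u (t x) j)"
  define W where "W = (\<lambda>j x. of_real (cos (pi * x)) * u (t x) j)"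
  define V where "V = (\<lambda>j x. of_real (sin (pi * x)) * v (t x) j)"
  have "continuous_on {0..1} t" unfolding t_def by (intro continuous_intros)
  moreover have "t ` {0..1} \<subseteq> {0..}" using t0 by force
  ultimately have tcont: "continuous_on {0..1} t" "t ` {0..1} \<subseteq> {0..}" .
  note ucont = continuous_on_compose2[OF u_cont tcont] and vcont = continuous_on_compose2[OF v_cont tcont]
    and u'cont = continuous_on_compose2[OF u'_cont tcont]
  have Um: "U j \<in> borel_measurable circ" and Wm: "W j \<in> borel_measurable circ"
    and Vm: "V j \<in> borel_measurable circ" for j
    unfolding U_def W_def V_def
    by (intro borel_measurable_circ_continuous_on continuous_intros ucont vcont)+
  have small: "(\<Sum>j<J. (cmod (of_real w * a j))\<^sup>2) \<le> D" if "\<bar>w\<bar> \<le> 1" "(\<Sum>j<J. (cmod (a j))\<^sup>2) \<le> D"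
    for w and a :: "nat \<Rightarrow> complex" and J :: nat and D
  proof -
    have "(cmod (of_real w * a j))\<^sup>2 \<le> (cmod (a j))\<^sup>2" for j
      using that(1) by (intro power_mono) (auto simp: norm_mult mult_left_le_one_le)
    then have "(\<Sum>j<J. (cmod (of_real w * a j))\<^sup>2) \<le> (\<Sum>j<J. (cmod (a j))\<^sup>2)" by (intro sum_mono)
    with that(2) show ?thesis by linarith
  qed
  have UB: "(\<Sum>j<J. (cmod (U j x))\<^sup>2) \<le> C" and WB: "(\<Sum>j<J. (cmod (W j x))\<^sup>2) \<le> C"
    and VB: "(\<Sum>j<J. (cmod (V j x))\<^sup>2) \<le> B\<^sup>2 * C" if "x \<in> {0..<1}" for J x
  proof -
    have x: "0 \<le> x" using that by simp
    have 1: "(\<Sum>j<J. (cmod (u (t x) j))\<^sup>2) \<le> C" using u_Bessel[OF t0[OF x]] tC[OF x] order_trans by blast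
    have "B\<^sup>2 * energy (t x) \<le> B\<^sup>2 * C" using tC[OF x] by (intro mult_left_mono) auto
    then have 2: "(\<Sum>j<J. (cmod (v (t x) j))\<^sup>2) \<le> B\<^sup>2 * C" using v_Bessel[OF t0[OF x]] order_trans by blast
    show "(\<Sum>j<J. (cmod (U j x))\<^sup>2) \<le> C" "(\<Sum>j<J. (cmod (W j x))\<^sup>2) \<le> C" "(\<Sum>j<J. (cmod (V j x))\<^sup>2) \<le> B\<^sup>2 * C"
      unfolding U_def W_def V_def by (intro small 1 2; simp)+
  qed
  note UF = Bessel_family[of U, OF Um UB] and WF = Bessel_family[of W, OF Wm WB] and VF = Bessel_family[of V, OF Vm VB]
  define c where "c = (\<lambda>n j. fcoef (U j) n)"
  define F where "F = (\<lambda>n j. of_real (pi / S) * fcoef (W j) n)"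
  \<comment> \<open>The index \<open>n\<close> is the frequency in time and \<open>j\<close> that in
    y, so that \<tau> = 2 pi freq n / S. The sine kills the boundary terms at 0 and 1.\<close>
  have by_parts: "(\<i> * of_real (2 * pi * of_int (freq n) / S) + of_real (damping j)) * c n j
      + 2 * pi * \<i> * of_int k * fcoef (V j) n = F n j" for n j
  proof -
    define a where "a = 2 * pi * of_int (freq n) * \<i>"
    let ?f = "\<lambda>x. fmode (- freq n) x"
    let ?d = "\<lambda>x. of_real pi * (W j x * ?f x) + of_real S * (- (2 * pi * \<i> * of_int k) * (V j x * ?f x)
        - of_real (damping j) * (U j x * ?f x)) - a * (U j x * ?f x)"
    let ?D = "of_real pi * fcoef (W j) n + of_real S * (- (2 * pi * \<i> * of_int k) * fcoef (V j) n
        - of_real (damping j) * c n j) - a * c n j"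
    let ?r = "(\<i> * of_real (2 * pi * of_int (freq n) / S) + of_real (damping j)) * c n j
        + 2 * pi * \<i> * of_int k * fcoef (V j) n - F n j"
    have int: "integrable circ (\<lambda>x. w x * ?f x)" if "sq_int circ w" for w
      using fcoef_integrable[OF that] by (simp add: cnj_fmode)
    have "(\<integral>x. ?d x \<partial>circ) = U j 1 * ?f 1 - U j 0 * ?f 0"
    proof (rule integral_circ_FTC)
      fix x :: real assume x: "0 \<le> x" "x \<le> 1"
      have "(t has_vector_derivative S) (at x within {0..1})"
        unfolding t_def by (auto intro!: derivative_eq_intros)
      moreover have "((\<lambda>y. u y j) has_vector_derivative u' (t x) j) (at (t x) within t ` {0..1})"
        using u_deriv[OF t0[OF x(1)]] tcont(2) by (rule has_vector_derivative_within_subset)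
      ultimately have 1: "((\<lambda>x. u (t x) j) has_vector_derivative of_real S * u' (t x) j) (at x within {0..1})"
        using vector_diff_chain_within[of t S x "{0..1}" "\<lambda>y. u y j" "u' (t x) j"]
        by (simp add: o_def scaleR_conv_of_real)
      have 2: "((\<lambda>x. complex_of_real (sin (pi * x))) has_vector_derivative of_real (pi * cos (pi * x))) (at x within {0..1})"
        by (rule has_vector_derivative_of_real)
          (auto intro!: derivative_eq_intros simp flip: has_real_derivative_iff_has_vector_derivative)
      have 3: "(?f has_vector_derivative (2 * pi * of_int (- freq n) * \<i>) * ?f x) (at x within {0..1})"
        by (rule fmode_has_vector_derivative)
      from has_vector_derivative_mult[OF has_vector_derivative_mult[OF 2 1] 3]
      show "((\<lambda>x. U j x * ?f x) has_vector_derivative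
          ?d x) (at x within {0..1})"
        by (simp add: U_def W_def V_def u'_def a_def algebra_simps)
    qed (unfold U_def W_def V_def fmode_def, intro continuous_intros ucont vcont)
    moreover have "U j 1 = 0" "U j 0 = 0" by (simp_all add: U_def)
    moreover have "(\<integral>x. ?d x \<partial>circ) =
        ?D"
      unfolding c_def fcoef_def cnj_fmode
      using int[OF UF(1)] int[OF VF(1)] int[OF WF(1)] by simp
    ultimately have z: "?D = 0" by simp
    have "of_real S * (?r) =
      - (?D)"
      using S by (simp add: F_def a_def field_simps)
    then have "of_real S * (?r) = 0"
      unfolding z by simp
    then show ?thesis using S by simp
  qed
  \<comment> \<open>Multiplication by \<open>b\<close> acts on the y-coefficients through the matrix
    elements \<beta>; it has to be shown that expanding in y commutes with taking time
    coefficients.\<close>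
  have Vsums: "(\<lambda>i. c n i * (\<integral>y. of_real (b y) * fmode (freq i) y * cnj (fmode (freq j) y) \<partial>circ)) sums fcoef (V j) n" for n j
  proof -
    define \<beta> where "\<beta> = (\<lambda>i. \<integral>y. of_real (b y) * fmode (freq i) y * cnj (fmode (freq j) y) \<partial>circ)"
    let ?h = "\<lambda>y. of_real (b y) * fmode (freq j) y"
    let ?s = "\<lambda>I x. (\<Sum>i<I. U i x * \<beta> i) * cnj (fmode (freq n) x)"
    have hs: "sq_int circ ?h" "norm_sq circ ?h \<le> B\<^sup>2 * norm_sq circ (fmode (freq j))"
      using sq_int_bounded_mult[OF sq_int_fmode, of "\<lambda>y. of_real (b y)" B "freq j"] b_meas b_bound by auto
    have h\<beta>: "cnj (fcoef ?h i) = \<beta> i" for i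
      unfolding fcoef_def \<beta>_def Bochner_Integration.integral_cnj[symmetric] by (simp add: mult_ac)
    have \<beta>B: "(\<Sum>i<I. (cmod (\<beta> i))\<^sup>2) \<le> B\<^sup>2" for I
    proof -
      have "(\<Sum>i<I. (cmod (\<beta> i))\<^sup>2) = (\<Sum>i<I. (cmod (fcoef ?h i))\<^sup>2)"
        by (simp flip: h\<beta>)
      also have "\<dots> \<le> norm_sq circ ?h" by (rule Bessel[OF hs(1)])
      finally show ?thesis using hs(2) by (simp add: norm_sq_def measure_circ)
    qed
    have vs: "(\<lambda>i. u (t x) i * \<beta> i) sums v (t x) j" if "0 \<le> x" for x
    proof -
      have "(\<integral>y. G (t x) y * cnj (?h y) \<partial>circ) = v (t x) j"
        by (simp add: v_def fcoef_def mult_ac)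
      then show ?thesis
        using parseval_inner_sums[OF G_sq[OF t0[OF that]] hs(1)] by (simp add: h\<beta> u_def)
    qed
    have int: "integrable circ (\<lambda>x. U i x * cnj (fmode (freq n) x))" for i
      by (rule fcoef_integrable[OF UF(1)])
    have lim: "(\<lambda>I. \<integral>x. ?s I x \<partial>circ) \<longlonglongrightarrow>
        (\<integral>x. V j x * cnj (fmode (freq n) x) \<partial>circ)"
    proof (rule integral_dominated_convergence[where w = "\<lambda>_. (C + B\<^sup>2) / 2"])
      show "(\<lambda>x. V j x * cnj (fmode (freq n) x)) \<in> borel_measurable circ"
        using fcoef_integrable[OF VF(1)] by (rule borel_measurable_integrable)
      show "(\<lambda>x. ?s I x) \<in> borel_measurable circ" for I
        unfolding cnj_fmode
        by (intro borel_measurable_times borel_measurable_sum Um borel_measurable_const measurable_circ fmode_measurable)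
      show "AE x in circ. (\<lambda>I. ?s I x) \<longlonglongrightarrow> V j x * cnj (fmode (freq n) x)"
      proof (rule AE_I2)
        fix x assume "x \<in> space circ"
        then have "(\<lambda>i. of_real (sin (pi * x)) * (u (t x) i * \<beta> i)) sums V j x"
          unfolding V_def by (intro sums_mult vs) auto
        then have "(\<lambda>I. \<Sum>i<I. U i x * \<beta> i) \<longlonglongrightarrow> V j x" by (simp add: sums_def U_def mult.assoc)
        then show "(\<lambda>I. ?s I x) \<longlonglongrightarrow> V j x * cnj (fmode (freq n) x)"
          by (intro tendsto_intros)
      qed
      show "AE x in circ. norm (?s I x) \<le> (C + B\<^sup>2) / 2" for I
      proof (rule AE_I2)
        fix x assume x: "x \<in> space circ"
        have "cmod (\<Sum>i<I. U i x * \<beta> i) \<le> (\<Sum>i<I. cmod (U i x * \<beta> i))" by (rule norm_sum)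
        also have "\<dots> \<le> (\<Sum>i<I. ((cmod (U i x))\<^sup>2 + (cmod (\<beta> i))\<^sup>2) / 2)"
          by (intro sum_mono cmod_mult_le_half_sum)
        also have "\<dots> = ((\<Sum>i<I. (cmod (U i x))\<^sup>2) + (\<Sum>i<I. (cmod (\<beta> i))\<^sup>2)) / 2"
          by (simp only: sum_divide_distrib[symmetric] sum.distrib)
        also have "\<dots> \<le> (C + B\<^sup>2) / 2" using UB[of x I] x \<beta>B[of I] by (intro divide_right_mono add_mono) auto
        finally show "norm (?s I x) \<le> (C + B\<^sup>2) / 2"
          by (simp add: norm_mult)
      qed
    qed simp
    have "(\<integral>x. ?s I x \<partial>circ) = (\<Sum>i<I. c n i * \<beta> i)" for I
    proof -
      have "(\<integral>x. ?s I x \<partial>circ) =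
          (\<integral>x. (\<Sum>i<I. \<beta> i * (U i x * cnj (fmode (freq n) x))) \<partial>circ)"
        by (intro Bochner_Integration.integral_cong refl) (subst sum_distrib_right, intro sum.cong refl, simp)
      also have "\<dots> = (\<Sum>i<I. \<integral>x. \<beta> i * (U i x * cnj (fmode (freq n) x)) \<partial>circ)"
        by (rule Bochner_Integration.integral_sum) (rule Bochner_Integration.integrable_mult_right, rule int)
      also have "\<dots> = (\<Sum>i<I. c n i * \<beta> i)" by (simp add: c_def fcoef_def mult.commute)
      finally show ?thesis .
    qed
    then show ?thesis using lim by (simp add: sums_def \<beta>_def fcoef_def)
  qed
  \<comment> \<open>The length \<open>S\<close> is chosen such that (A / r) (pi / S) = 1/4, whose
    square is the constant here.\<close>
  have res: "(\<Sum>j. (cmod (c n j))\<^sup>2) \<le> 1 / 16 * (\<Sum>j. (cmod (fcoef (W j) n))\<^sup>2)" for n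
  proof -
    have Fs: "summable (\<lambda>j. (cmod (F n j))\<^sup>2)"
      unfolding F_def norm_mult power_mult_distrib by (intro summable_mult WF(2))
    have "(\<Sum>j. (cmod (c n j))\<^sup>2) \<le> (A / r)\<^sup>2 * (\<Sum>j. (cmod (F n j))\<^sup>2)"
      unfolding A_def
    proof (rule resolvent_estimate[OF b_meas b_bound nondeg m K r k _ Fs VF(2) Vsums by_parts[unfolded damping_def]])
      show "summable (\<lambda>j. (cmod (c n j))\<^sup>2)" unfolding c_def by (rule UF(2))
    qed
    also have "(\<Sum>j. (cmod (F n j))\<^sup>2) = (pi / S)\<^sup>2 * (\<Sum>j. (cmod (fcoef (W j) n))\<^sup>2)"
    proof -
      have "(cmod (F n j))\<^sup>2 = (pi / S)\<^sup>2 * (cmod (fcoef (W j) n))\<^sup>2" for j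
        unfolding F_def norm_mult norm_of_real power_mult_distrib power2_abs ..
      then show ?thesis by (simp only: suminf_mult[OF WF(2)])
    qed
    also have "(A / r)\<^sup>2 * \<dots> = ((A / r) * (pi / S))\<^sup>2 * (\<Sum>j. (cmod (fcoef (W j) n))\<^sup>2)"
      by (simp only: power_mult_distrib mult.assoc)
    also have "(A / r) * (pi / S) = 1 / 4" using A r by (simp add: S_def)
    finally show ?thesis by (simp add: power2_eq_square)
  qed
  \<comment> \<open>The estimates for the single time frequencies are added up by Parseval in time
    for \<open>U\<close> and by the vector-valued Bessel inequality for \<open>W\<close>; keeping
    \<open>J\<close> finite makes the interchange of sums elementary.\<close>
  have fin: "(\<integral>x. (\<Sum>j<J. (cmod (U j x))\<^sup>2) \<partial>circ) \<le> C / 16" for J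
  proof -
    have "(\<integral>x. (\<Sum>j<J. (cmod (U j x))\<^sup>2) \<partial>circ) = (\<Sum>j<J. norm_sq circ (U j))"
      unfolding norm_sq_def using UF(1) by (intro Bochner_Integration.integral_sum) (auto simp: sq_int_def)
    also have "\<dots> \<le> C / 16"
    proof (rule LIMSEQ_le_const2)
      show "(\<lambda>N. \<Sum>j<J. \<Sum>n<N. (cmod (c n j))\<^sup>2) \<longlonglongrightarrow> (\<Sum>j<J. norm_sq circ (U j))"
        unfolding c_def using parseval_sums[OF UF(1)] by (intro tendsto_sum) (simp add: sums_def)
      have "(\<Sum>j<J. \<Sum>n<N. (cmod (c n j))\<^sup>2) \<le> C / 16" for N
      proof -
        have "(\<Sum>j<J. \<Sum>n<N. (cmod (c n j))\<^sup>2) = (\<Sum>n<N. \<Sum>j<J. (cmod (c n j))\<^sup>2)"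
          by (rule sum.swap)
        also have "\<dots> \<le> (\<Sum>n<N. \<Sum>j. (cmod (c n j))\<^sup>2)"
          unfolding c_def by (intro sum_mono sum_le_suminf UF(2)) auto
        also have "\<dots> \<le> (\<Sum>n<N. 1 / 16 * (\<Sum>j. (cmod (fcoef (W j) n))\<^sup>2))"
          by (intro sum_mono res)
        also have "\<dots> = 1 / 16 * (\<Sum>n<N. \<Sum>j. (cmod (fcoef (W j) n))\<^sup>2)"
          by (rule sum_distrib_left[symmetric])
        also have "\<dots> \<le> 1 / 16 * C" by (intro mult_left_mono WF(3)) auto
        finally show ?thesis by simp
      qed
      then show "\<exists>N. \<forall>n\<ge>N. (\<Sum>j<J. \<Sum>n<n. (cmod (c n j))\<^sup>2) \<le> C / 16" by blast
    qed
    finally show ?thesis .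
  qed
  have lim: "(\<lambda>J. \<Sum>j<J. (cmod (U j x))\<^sup>2) \<longlonglongrightarrow> (sin (pi * x))\<^sup>2 * energy (t x)" if "0 \<le> x" for x
  proof -
    have "(\<lambda>j. (sin (pi * x))\<^sup>2 * (cmod (u (t x) j))\<^sup>2) sums ((sin (pi * x))\<^sup>2 * energy (t x))"
      by (intro sums_mult u_sums t0 that)
    then show ?thesis by (simp add: sums_def U_def norm_mult power_mult_distrib)
  qed
  have sm: "(\<lambda>x. \<Sum>j<J. (cmod (U j x))\<^sup>2) \<in> borel_measurable circ" for J
    using Um by measurable
  have em: "(\<lambda>x. (sin (pi * x))\<^sup>2 * energy (t x)) \<in> borel_measurable circ"
    by (rule borel_measurable_LIMSEQ_metric[OF sm]) (auto intro: lim)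
  have "(\<lambda>J. \<integral>x. (\<Sum>j<J. (cmod (U j x))\<^sup>2) \<partial>circ) \<longlonglongrightarrow> (\<integral>x. (sin (pi * x))\<^sup>2 * energy (t x) \<partial>circ)"
    by (rule integral_dominated_convergence[where w = "\<lambda>_. C", OF em sm])
      (auto intro!: AE_I2 lim simp: UB sum_nonneg)
  from LIMSEQ_le_const2[OF this] fin
  have 1: "(\<integral>x. (sin (pi * x))\<^sup>2 * energy (t x) \<partial>circ) \<le> C / 16" by blast
  \<comment> \<open>The squared sine has mean 1/2, and monotonicity bounds the energy on the
    interval from below by its final value. Hence half of it is at most 1/16 of the initial energy,
    and 1/8 < exp (-2) because 2.72^2 < 8.\<close>
  have "energy (s + S) / 2 = (\<integral>x. (sin (pi * x))\<^sup>2 * energy (s + S) \<partial>circ)"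
    using integral_sin_pi_square by simp
  also have "\<dots> \<le> (\<integral>x. (sin (pi * x))\<^sup>2 * energy (t x) \<partial>circ)"
  proof (rule integral_mono)
    have s1: "(sin (pi * x))\<^sup>2 \<le> 1" for x by (simp add: abs_square_le_1)
    show "integrable circ (\<lambda>x. (sin (pi * x))\<^sup>2 * energy (s + S))"
      by (rule circ.integrable_const_bound[where B = "energy (s + S)"])
        (auto simp: abs_mult intro!: AE_I2 mult_left_le_one_le s1)
    show "integrable circ (\<lambda>x. (sin (pi * x))\<^sup>2 * energy (t x))"
    proof (rule circ.integrable_const_bound[where B = C, OF _ em], rule AE_I2)
      fix x assume "x \<in> space circ"
      then have "energy (t x) \<le> C" by (intro tC) simp
      moreover have "(sin (pi * x))\<^sup>2 * energy (t x) \<le> energy (t x)"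
        by (intro mult_left_le_one_le s1) auto
      ultimately show "norm ((sin (pi * x))\<^sup>2 * energy (t x)) \<le> C" by simp
    qed
    fix x assume "x \<in> space circ"
    then have "energy (s + S) \<le> energy (t x)"
      using S s by (intro energy_mono) (auto simp: t_def mult_le_cancel_left1)
    then show "(sin (pi * x))\<^sup>2 * energy (s + S) \<le> (sin (pi * x))\<^sup>2 * energy (t x)"
      by (rule mult_left_mono) simp
  qed
  finally have "energy (s + S) \<le> 1 / 8 * energy s" using 1 by (simp add: C_def)
  also have "\<dots> \<le> exp (- 2) * energy s"
  proof (rule mult_right_mono)
    have "exp (2::real) = exp 1 * exp 1" by (simp flip: exp_add)
    also have "\<dots> \<le> (272 / 100) * (272 / 100)" using e_less_272 by (intro mult_mono) auto
    finally have "exp (2::real) \<le> 8" by simp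
    then show "1 / 8 \<le> exp (- 2 :: real)" by (simp add: exp_minus inverse_eq_divide divide_simps)
  qed simp
  finally show ?thesis .
qed

text \<open>Iteration over intervals of length \<open>S\<close>; the unfinished last interval costs
  the factor exp 2.\<close>

lemma energy_exponential_decay:
  assumes k: "k \<noteq> 0" and t: "0 \<le> t"
  defines "A \<equiv> resolvent_const m K"
  shows "energy t \<le> exp (2 - 2 * (r / (4 * pi * A)) * t) * energy 0"
proof -
  define S where "S = 4 * pi * A / r"
  have "0 < A" unfolding A_def by (rule resolvent_const_pos[OF m K])
  then have S: "0 < S" using r by (simp add: S_def)
  have step: "energy (s + S) \<le> exp (- 2) * energy s" if "0 \<le> s" for s
    unfolding S_def A_def by (rule energy_decay[OF k that])
  have it: "energy (real n * S) \<le> exp (- 2 * real n) * energy 0" for n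
  proof (induction n)
    case (Suc n)
    have "energy (real (Suc n) * S) \<le> exp (- 2) * energy (real n * S)"
      using step[of "real n * S"] S by (simp add: algebra_simps)
    also have "\<dots> \<le> exp (- 2) * (exp (- 2 * real n) * energy 0)"
      by (intro mult_left_mono Suc) auto
    also have "\<dots> = exp (- 2 * real (Suc n)) * energy 0"
      by (simp add: algebra_simps flip: exp_add)
    finally show ?case .
  qed simp
  define n where "n = nat \<lfloor>t / S\<rfloor>"
  have n: "real n \<le> t / S" "t / S < real n + 1"
    unfolding n_def using t S by (auto simp: of_nat_nat zero_le_floor)
  have "energy t \<le> energy (real n * S)"
    using n(1) S by (intro energy_mono) (auto simp: field_simps)
  also have "\<dots> \<le> exp (- 2 * real n) * energy 0" by (rule it)
  also have "\<dots> \<le> exp (2 - 2 * (t / S)) * energy 0"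
    using n(2) by (intro mult_right_mono) auto
  also have "2 - 2 * (t / S) = 2 - 2 * (r / (4 * pi * A)) * t" by (simp add: S_def)
  finally show ?thesis .
qed

end

subsection \<open>Steep profiles\<close>

lemma periodic1_of_int:
  assumes "periodic1 g"
  shows "g (y + of_int k) = g y"
proof -
  have *: "g (y + real n) = g y" for n y
  proof (induction n)
    case (Suc n)
    have "g (y + real (Suc n)) = g ((y + real n) + 1)" by (simp add: algebra_simps)
    then show ?case using assms Suc by (simp add: periodic1_def)
  qed simp
  show ?thesis
  proof (cases "k \<ge> 0")
    case True
    then show ?thesis using *[of y "nat k"] by simp
  next
    case False
    then show ?thesis using *[of "y + of_int k" "nat (- k)"] by simp
  qed
qed

lemma continuous_zero_between:
  fixes f :: "real \<Rightarrow> real"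
  assumes "continuous_on UNIV f" "f x \<le> \<mu>" "\<mu> \<le> f y"
  obtains z where "f z = \<mu>" "min x y \<le> z" "z \<le> max x y"
proof (cases "x \<le> y")
  case True
  then show ?thesis
    using IVT'[of f x \<mu> y] assms that continuous_on_subset by fastforce
next
  case False
  then show ?thesis
    using IVT2'[of f x \<mu> y] assms that continuous_on_subset by fastforce
qed

text \<open>\<open>S\<close> is the lift of the singular points to the real line. The window [-2, 2]
  covers one period, a margin of 1 on both sides for the \<delta>-neighbourhoods, and one more
  period to the left in which a preceding singular point is found.\<close>

locale piecewise_steep =
  fixes b :: "real \<Rightarrow> real" and S :: "real set" and c :: real
  assumes per: "periodic1 b" and cont: "continuous_on UNIV b" and c: "0 < c"
    and S_per: "\<And>y. y + 1 \<in> S \<longleftrightarrow> y \<in> S" and S_fin: "finite (S \<inter> {- 2..2})"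
    and diff: "\<And>y. y \<notin> S \<Longrightarrow> b differentiable (at y)"
    and deriv: "\<And>y. b differentiable (at y) \<Longrightarrow> c \<le> \<bar>deriv b y\<bar>"
begin

text \<open>Mean value theorem; the endpoints may be singular, as only continuity is required
  there.\<close>

lemma expanding:
  assumes "p < q" "{p<..<q} \<inter> S = {}"
  shows "c * (q - p) \<le> \<bar>b q - b p\<bar>"
proof -
  have "b differentiable (at x)" if "p < x" "x < q" for x
    using that assms(2) by (intro diff) auto
  then obtain l z where z: "p < z" "z < q" "DERIV b z :> l" "b q - b p = (q - p) * l"
    using MVT[OF assms(1) continuous_on_subset[OF cont subset_UNIV]] by blast
  have "c \<le> \<bar>l\<bar>"
    using deriv[of z] DERIV_imp_deriv[OF z(3)] z(3) by (auto simp: real_differentiable_def)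
  then show ?thesis
    using z(4) assms(1) by (simp add: abs_mult mult.commute mult_left_mono)
qed

lemma S_int: "y + of_int k \<in> S \<longleftrightarrow> y \<in> S"
  using periodic1_of_int[of "\<lambda>y. y \<in> S"] S_per by (simp add: periodic1_def)

text \<open>Otherwise \<open>b\<close> would expand distances over a whole period, against
  periodicity. So the case of no singular points is contradictory, and \<open>infdist\<close> to a
  set containing \<open>S\<close> is a true distance, not the default 0 for the empty set.\<close>

lemma S_nonempty: "S \<noteq> {}"
proof
  assume "S = {}"
  then have "c * (1 - 0) \<le> \<bar>b 1 - b 0\<bar>" by (intro expanding) auto
  moreover have "b (0 + 1) = b 0" using per by (simp add: periodic1_def del: add_0_left)
  ultimately show False using c by simp
qed

text \<open>Between two consecutive zeros of \<open>b - \<mu>\<close> there is a point of \<open>S\<close>.\<close>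

lemma card_level_set_le:
  "finite ((S \<union> {y. b y = \<mu>}) \<inter> {- 1..2})"
  "card ((S \<union> {y. b y = \<mu>}) \<inter> {- 1..2}) \<le> 2 * card (S \<inter> {- 2..2})"
proof -
  let ?T = "S \<inter> {- 2..2}" and ?L = "({y. b y = \<mu>} - S) \<inter> {- 1..2}"
  \<comment> \<open>The last singular point not to the right of \<open>z\<close>. Two level points
    sharing it would bound an interval free of singularities, on which \<open>b\<close> expands.
    Level points in \<open>S\<close> are counted with \<open>S\<close>, whence the factor 2 in
    total.\<close>
  define p where "p = (\<lambda>z. Max {s \<in> ?T. s \<le> z})"
  obtain s0 where s0: "s0 \<in> S" using S_nonempty by blast
  have fin: "finite {s \<in> ?T. s \<le> z}" for z using S_fin by (rule rev_finite_subset) auto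
  have ne: "{s \<in> ?T. s \<le> z} \<noteq> {}" if "z \<in> ?L" for z
  proof -
    obtain n :: int where "of_int n \<le> z - s0" "z - s0 < of_int n + 1"
      using floor_exists[of "z - s0"] by auto
    then have "s0 + of_int n \<in> ?T" "s0 + of_int n \<le> z"
      using that s0 unfolding Int_iff S_int by auto
    then show ?thesis by blast
  qed
  have p: "p z \<in> ?T" "p z \<le> z" "\<And>s. s \<in> ?T \<Longrightarrow> s \<le> z \<Longrightarrow> s \<le> p z" if "z \<in> ?L" for z
    using Max_in[OF fin ne[OF that]] Max_ge[OF fin, of _ z] by (auto simp: p_def)
  have lt: "p z \<noteq> p z'" if "z \<in> ?L" "z' \<in> ?L" "z < z'" for z z'
  proof
    assume eq: "p z = p z'"
    have "{z<..<z'} \<inter> S = {}"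
    proof (rule ccontr)
      assume "{z<..<z'} \<inter> S \<noteq> {}"
      then obtain s where s: "z < s" "s < z'" "s \<in> S" by auto
      have "s \<le> p z'" using s that by (intro p(3)) auto
      then show False using p(2)[OF that(1)] eq s(1) by simp
    qed
    from expanding[OF that(3) this] show False using that c by (auto simp: mult_le_0_iff)
  qed
  then have inj: "inj_on p ?L" by (rule linorder_inj_onI')
  have sub: "p ` ?L \<subseteq> ?T" using p(1) by blast
  have L: "finite ?L" "card ?L \<le> card ?T"
    using inj_on_finite[OF inj sub S_fin] card_inj_on_le[OF inj sub S_fin] by simp_all
  have eq: "(S \<union> {y. b y = \<mu>}) \<inter> {- 1..2} = (S \<inter> {- 1..2}) \<union> ?L" by auto
  have S': "finite (S \<inter> {- 1..2})" "card (S \<inter> {- 1..2}) \<le> card ?T"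
    by (rule finite_subset[OF _ S_fin] card_mono[OF S_fin], force)+
  show "finite ((S \<union> {y. b y = \<mu>}) \<inter> {- 1..2})" unfolding eq using S' L by simp
  show "card ((S \<union> {y. b y = \<mu>}) \<inter> {- 1..2}) \<le> 2 * card (S \<inter> {- 2..2})"
    unfolding eq using card_Un_le[of "S \<inter> {- 1..2}" ?L] S' L by simp
qed

text \<open>If it failed, choose d strictly between |b y - \<mu>| / c and the distance. On
  [y - d, y + d] there is neither a singularity nor a level point, so \<open>b\<close> is injective
  and hence monotone, and it changes by at least c d > |b y - \<mu>| on either side of y. By the
  intermediate value theorem it would take the value \<mu> after all.\<close>

lemma infdist_level_set_le:
  defines "Z \<equiv> \<lambda>\<mu>. S \<union> {y. b y = \<mu>}"
  shows "c * infdist y (Z \<mu>) \<le> \<bar>b y - \<mu>\<bar>"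
proof (rule ccontr)
  assume *: "\<not> ?thesis"
  define d where "d = (infdist y (Z \<mu>) + \<bar>b y - \<mu>\<bar> / c) / 2"
  have lt: "\<bar>b y - \<mu>\<bar> / c < infdist y (Z \<mu>)" using * c by (simp add: field_simps)
  have d: "\<bar>b y - \<mu>\<bar> < c * d" "d < infdist y (Z \<mu>)"
    using lt c by (simp_all add: d_def field_simps)
  have d0: "0 < d" using d(1) c by (smt (verit) abs_ge_zero zero_less_mult_pos)
  have noZ: "z \<notin> Z \<mu>" if "y - d \<le> z" "z \<le> y + d" for z
  proof
    assume "z \<in> Z \<mu>"
    then have "infdist y (Z \<mu>) \<le> dist y z" by (rule infdist_le)
    also have "\<dots> \<le> d" using that by (auto simp: dist_real_def)
    finally show False using d by simp
  qed
  then have noS: "z \<notin> S" and no\<mu>: "b z \<noteq> \<mu>" if "y - d \<le> z" "z \<le> y + d" for z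
    using that by (auto simp: Z_def)
  have inj: "inj_on b {y - d..y + d}"
  proof -
    have "b z \<noteq> b z'" if "z \<in> {y - d..y + d}" "z' \<in> {y - d..y + d}" "z < z'" for z z'
    proof -
      have "{z<..<z'} \<inter> S = {}" using noS that by auto
      from expanding[OF that(3) this] show ?thesis using that c by (auto simp: mult_le_0_iff)
    qed
    then show ?thesis unfolding inj_on_def by (metis linorder_less_linear)
  qed
  have "c * (y - (y - d)) \<le> \<bar>b y - b (y - d)\<bar>" "c * (y + d - y) \<le> \<bar>b (y + d) - b y\<bar>"
    using d0 noS by (intro expanding; auto)+
  then have le: "c * d \<le> \<bar>b y - b (y - d)\<bar>" "c * d \<le> \<bar>b (y + d) - b y\<bar>" by simp_all
  have mono: "b (y - d) < b y \<and> b y < b (y + d) \<or> b (y + d) < b y \<and> b y < b (y - d)"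
    using continuous_inj_imp_mono[OF _ _ continuous_on_subset[OF cont subset_UNIV] inj, of y] d0 by auto
  obtain p q where pq: "p \<in> {y - d..y + d}" "q \<in> {y - d..y + d}" "b p \<le> b y - c * d" "b y + c * d \<le> b q"
    using mono
  proof
    assume "b (y - d) < b y \<and> b y < b (y + d)"
    then show thesis using le d0 by (intro that[of "y - d" "y + d"]) auto
  next
    assume "b (y + d) < b y \<and> b y < b (y - d)"
    then show thesis using le d0 by (intro that[of "y + d" "y - d"]) auto
  qed
  have "b p \<le> \<mu>" "\<mu> \<le> b q" using pq d(1) by linarith+
  then obtain z where "b z = \<mu>" "min p q \<le> z" "z \<le> max p q"
    using continuous_zero_between[OF cont] by blast
  moreover have "y - d \<le> min p q" "max p q \<le> y + d" using pq(1,2) by auto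
  ultimately show False using no\<mu>[of z] by linarith
qed

text \<open>The constant 4 is 2 for the number of points of \<open>Z\<close> times 2 for the
  intervals of length 2 \<delta> around them. For the Lipschitz bound, either a point of
  \<open>Z\<close> lies between the two arguments, and both values of \<theta> are bounded by their
  distances to it, or the sign is the same at both and \<open>infdist\<close> is
  1-Lipschitz.\<close>

theorem nondegenerate: "nondegenerate b c (4 * card (S \<inter> {- 2..2}))"
  unfolding nondegenerate_def
proof (intro allI ballI)
  fix \<mu> \<delta> :: real assume "\<delta> \<in> {0<..1}"
  then have \<delta>: "0 < \<delta>" "\<delta> \<le> 1" by auto
  define Z where "Z = S \<union> {y. b y = \<mu>}"
  have Zne: "Z \<noteq> {}" using S_nonempty by (auto simp: Z_def)
  define \<theta> where "\<theta> = (\<lambda>y. sgn (b y - \<mu>) * min 1 (infdist y Z / \<delta>))"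
  define E where "E = {y. infdist y Z < \<delta>}"
  have i0: "0 \<le> infdist y Z" for y by (rule infdist_nonneg)
  have abs\<theta>: "\<bar>\<theta> y\<bar> \<le> min 1 (infdist y Z / \<delta>)" for y
    using i0[of y] \<delta> by (auto simp: \<theta>_def abs_mult sgn_if)
  have per\<theta>: "periodic1 \<theta>"
  proof -
    have b1: "b (y + 1) = b y" for y using per by (simp add: periodic1_def)
    have "Z = (\<lambda>z. z + 1) ` Z"
    proof (intro set_eqI iffI)
      fix z assume "z \<in> Z"
      then have "z - 1 \<in> Z" using S_per[of "z - 1"] b1[of "z - 1"] by (simp add: Z_def)
      then show "z \<in> (\<lambda>z. z + 1) ` Z" by force
    qed (use S_per b1 in \<open>auto simp: Z_def\<close>)
    then have "infdist (y + 1) Z = (INF z\<in>(\<lambda>z. z + 1) ` Z. dist (y + 1) z)" for y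
      using Zne by (metis infdist_notempty)
    also have "\<dots> y = infdist y Z" for y
      unfolding image_image using Zne by (simp add: infdist_notempty)
    finally show ?thesis by (simp add: periodic1_def \<theta>_def b1)
  qed
  have lip: "\<bar>\<theta> x - \<theta> y\<bar> \<le> 1 / \<delta> * \<bar>x - y\<bar>" for x y
  proof (cases "\<exists>z\<in>Z. min x y \<le> z \<and> z \<le> max x y")
    case True
    then obtain z where z: "z \<in> Z" "min x y \<le> z" "z \<le> max x y" by blast
    have "\<bar>\<theta> x - \<theta> y\<bar> \<le> infdist x Z / \<delta> + infdist y Z / \<delta>"
      using abs\<theta>[of x] abs\<theta>[of y] by linarith
    also have "\<dots> = (infdist x Z + infdist y Z) / \<delta>" by (simp add: add_divide_distrib)
    also have "\<dots> \<le> \<bar>x - y\<bar> / \<delta>"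
      using infdist_le[OF z(1), of x] infdist_le[OF z(1), of y] z(2,3) \<delta>
      by (intro divide_right_mono) (auto simp: dist_real_def)
    finally show ?thesis by simp
  next
    case False
    have "sgn (b x - \<mu>) = sgn (b y - \<mu>)"
    proof (rule ccontr)
      assume "sgn (b x - \<mu>) \<noteq> sgn (b y - \<mu>)"
      then consider "b x \<le> \<mu>" "\<mu> \<le> b y" | "b y \<le> \<mu>" "\<mu> \<le> b x" by (auto simp: sgn_if split: if_splits)
      then obtain z where "b z = \<mu>" "min x y \<le> z" "z \<le> max x y"
        by cases (metis continuous_zero_between[OF cont] min.commute max.commute)+
      then show False using False by (auto simp: Z_def)
    qed
    then have "\<bar>\<theta> x - \<theta> y\<bar> = \<bar>sgn (b y - \<mu>)\<bar> * \<bar>min 1 (infdist x Z / \<delta>) - min 1 (infdist y Z / \<delta>)\<bar>"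
      by (simp add: \<theta>_def abs_mult flip: right_diff_distrib)
    also have "\<dots> \<le> 1 * \<bar>infdist x Z / \<delta> - infdist y Z / \<delta>\<bar>"
      by (intro mult_mono) (auto simp: sgn_if)
    also have "\<dots> = \<bar>infdist x Z - infdist y Z\<bar> / \<delta>"
      using \<delta> by (simp add: abs_divide flip: diff_divide_distrib)
    also have "\<dots> \<le> \<bar>x - y\<bar> / \<delta>"
      using infdist_triangle_abs[of x Z y] \<delta> by (intro divide_right_mono) (auto simp: dist_real_def)
    finally show ?thesis by simp
  qed
  have "continuous_on UNIV \<theta>"
    by (rule lipschitz_on_continuous_on[of "1 / \<delta>"], rule lipschitz_onI)
      (use lip \<delta> in \<open>auto simp: dist_real_def\<close>)
  then have meas: "\<theta> \<in> borel_measurable borel" by (rule borel_measurable_continuous_onI)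
  have eq: "(b y - \<mu>) * \<theta> y = \<bar>b y - \<mu>\<bar> * min 1 (infdist y Z / \<delta>)" for y
    by (simp add: \<theta>_def abs_sgn flip: mult.assoc)
  have "open E" unfolding E_def by (intro open_Collect_less continuous_intros)
  then have Eb: "E \<in> sets borel" by simp
  let ?Z = "Z \<inter> {- 1..2}"
  have Zf: "finite ?Z" "card ?Z \<le> 2 * card (S \<inter> {- 2..2})"
    unfolding Z_def by (rule card_level_set_le)+
  \<comment> \<open>As \<delta> \<le> 1, a point of \<open>Z\<close> closer than \<delta> to the
    unit period lies in [-1, 2], where \<open>Z\<close> has been counted.\<close>
  have cover: "E \<inter> {0..<1} \<subseteq> (\<Union>z\<in>?Z. {z - \<delta>..z + \<delta>})"
  proof
    fix y assume y: "y \<in> E \<inter> {0..<1}"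
    then have "(INF z\<in>Z. dist y z) < \<delta>" using Zne by (simp add: E_def infdist_notempty)
    then obtain z where z: "z \<in> Z" "dist y z < \<delta>"
      using cINF_less_iff[OF Zne bdd_belowI2[of Z 0 "dist y"]] by auto
    then have "z \<in> ?Z" using y \<delta> by (auto simp: dist_real_def)
    then show "y \<in> (\<Union>z\<in>?Z. {z - \<delta>..z + \<delta>})"
      by (rule UN_I) (use z in \<open>auto simp: dist_real_def\<close>)
  qed
  have "measure circ (E \<inter> {0..<1}) = measure lborel (E \<inter> {0..<1})"
    using emeasure_circ[OF Eb] by (simp add: measure_def)
  also have "\<dots> \<le> measure lborel (\<Union>z\<in>?Z. {z - \<delta>..z + \<delta>})"
  proof (rule measure_mono_fmeasurable[OF cover])
    show "(\<Union>z\<in>?Z. {z - \<delta>..z + \<delta>}) \<in> fmeasurable lborel"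
      using Zf(1) by (intro fmeasurable.finite_UN fmeasurable_cbox[of "z - \<delta>" "z + \<delta>" for z, unfolded cbox_interval]) auto
  qed (use Eb in auto)
  also have "\<dots> \<le> (\<Sum>z\<in>?Z. measure lborel {z - \<delta>..z + \<delta>})"
    by (rule measure_UNION_le[OF Zf(1)]) auto
  also have "\<dots> = real (card ?Z) * (2 * \<delta>)" using \<delta> by simp
  also have "\<dots> \<le> real (2 * card (S \<inter> {- 2..2})) * (2 * \<delta>)"
    using Zf(2) \<delta> by (intro mult_right_mono) (auto simp only: of_nat_le_iff)
  finally have mE: "measure circ (E \<inter> {0..<1}) \<le> 4 * card (S \<inter> {- 2..2}) * \<delta>" by simp
  show "\<exists>\<theta> E. periodic1 \<theta> \<and> \<theta> \<in> borel_measurable borel \<and> (\<forall>y. \<bar>\<theta> y\<bar> \<le> 1) \<and>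
     (\<forall>y h. \<bar>\<theta> (y + h) - \<theta> y\<bar> \<le> 1 / \<delta> * \<bar>h\<bar>) \<and> (\<forall>y. 0 \<le> (b y - \<mu>) * \<theta> y) \<and>
     E \<in> sets borel \<and> measure circ (E \<inter> {0..<1}) \<le> real (4 * card (S \<inter> {- 2..2})) * \<delta> \<and>
     (\<forall>y\<in>{0..<1} - E. c * \<delta> \<le> (b y - \<mu>) * \<theta> y)"
  proof (intro exI conjI allI ballI)
    show "\<bar>\<theta> (y + h) - \<theta> y\<bar> \<le> 1 / \<delta> * \<bar>h\<bar>" for y h using lip[of "y + h" y] by simp
    show "\<bar>\<theta> y\<bar> \<le> 1" for y using abs\<theta>[of y] by simp
    show "0 \<le> (b y - \<mu>) * \<theta> y" for y unfolding eq using i0 \<delta> by simp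
    fix y assume "y \<in> {0..<1} - E"
    then have y: "\<delta> \<le> infdist y Z" by (simp add: E_def)
    then have "c * \<delta> \<le> c * infdist y Z" using c by simp
    also have "\<dots> \<le> \<bar>b y - \<mu>\<bar>" unfolding Z_def by (rule infdist_level_set_le)
    also have "\<dots> = (b y - \<mu>) * \<theta> y" unfolding eq using y \<delta> by (simp add: min_def)
    finally show "c * \<delta> \<le> (b y - \<mu>) * \<theta> y" .
  qed (use per\<theta> meas Eb mE in auto)
qed

lemma card_S_pos: "0 < card (S \<inter> {- 2..2})"
proof -
  obtain s where s: "s \<in> S" using S_nonempty by blast
  obtain n :: int where "of_int n \<le> s" "s < of_int n + 1" using floor_exists[of s] by auto
  then have "s + of_int (- n) \<in> S \<inter> {- 2..2}" using s unfolding Int_iff S_int by auto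
  then show ?thesis using S_fin card_gt_0_iff by blast
qed

lemma bounded: obtains B where "\<And>y. \<bar>b y\<bar> \<le> B"
proof -
  have "compact (b ` {0..1})"
    by (intro compact_continuous_image continuous_on_subset[OF cont]) auto
  then obtain B where B: "\<And>x. x \<in> {0..1} \<Longrightarrow> \<bar>b x\<bar> \<le> B"
    using compact_imp_bounded bounded_iff by (metis image_eqI real_norm_def)
  have "\<bar>b y\<bar> \<le> B" for y
  proof -
    obtain n :: int where n: "of_int n \<le> y" "y < of_int n + 1" using floor_exists[of y] by auto
    have "b y = b (y + of_int (- n))" by (rule periodic1_of_int[OF per, symmetric])
    also have "\<bar>\<dots>\<bar> \<le> B" using n by (intro B) auto
    finally show ?thesis .
  qed
  then show thesis by (rule that)
qed

end

section \<open>From the cusp condition to a steep profile\<close>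

lemma isCont_power_log_cusp:
  fixes b :: "real \<Rightarrow> real"
  assumes \<alpha>: "0 < \<alpha>" and h0: "0 < h\<^sub>0"
    and eq: "\<And>h. h \<in> {- h\<^sub>0..h\<^sub>0} - {0} \<Longrightarrow> b (p + h) - b p = c * \<bar>h\<bar> powr \<alpha> * ln (1 / \<bar>h\<bar>) powr \<beta>"
  shows "isCont b p"
proof -
  \<comment> \<open>A positive power beats any power of the logarithm, whatever the sign of
    \<beta>.\<close>
  have lim: "((\<lambda>x. c * (x powr \<alpha> * ln (1 / x) powr \<beta>)) \<longlongrightarrow> c * 0) (at_right 0)"
    using \<alpha> by (intro tendsto_mult tendsto_const) real_asymp
  have "filterlim (\<lambda>h::real. \<bar>h\<bar>) (at_right 0) (at 0)"
    by (auto simp: filterlim_at eventually_at_filter intro!: tendsto_eq_intros)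
  from filterlim_compose[OF lim this]
  have "((\<lambda>h. c * (\<bar>h\<bar> powr \<alpha> * ln (1 / \<bar>h\<bar>) powr \<beta>)) \<longlongrightarrow> 0) (at 0)" by simp
  moreover have "c * (\<bar>h\<bar> powr \<alpha> * ln (1 / \<bar>h\<bar>) powr \<beta>) = b (p + h) - b p" if "h \<noteq> 0" "\<bar>h\<bar> < h\<^sub>0" for h
    using eq[of h] that by (simp add: mult.assoc abs_le_iff less_imp_le)
  then have "\<forall>\<^sub>F h in at 0. c * (\<bar>h\<bar> powr \<alpha> * ln (1 / \<bar>h\<bar>) powr \<beta>) = b (p + h) - b p"
    unfolding eventually_at using h0 by (intro exI[of _ h\<^sub>0]) (auto simp: dist_real_def)
  ultimately have "((\<lambda>h. b (p + h) - b p) \<longlongrightarrow> 0) (at 0)" by (rule Lim_transform_eventually)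
  then show ?thesis by (simp add: isCont_iff LIM_zero_iff)
qed

lemma piecewise_steep_of_cusps:
  fixes b :: "real \<Rightarrow> real" and N :: nat and ybar :: "nat \<Rightarrow> real"
  defines "S \<equiv> {ybar i + of_int k | i k. i \<in> {1..N} \<and> k \<in> (UNIV :: int set)}"
  assumes per: "periodic1 b" and smooth: "smooth_on b (- S)"
    and c: "0 < c" "\<And>y. b differentiable (at y) \<Longrightarrow> c \<le> \<bar>deriv b y\<bar>"
    and cusp: "\<And>i. i \<in> {1..N} \<Longrightarrow> isCont b (ybar i)"
  shows "piecewise_steep b S c"
proof
  have diff: "b differentiable (at y)" if "y \<notin> S" for y
    using smooth that unfolding smooth_on_def by (metis ComplI funpow_0)
  then show "\<And>y. y \<notin> S \<Longrightarrow> b differentiable (at y)" .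
  have "isCont b y" for y
  proof (cases "y \<in> S")
    case True
    then obtain i k where ik: "i \<in> {1..N}" "y = ybar i + of_int k" by (auto simp: S_def)
    \<comment> \<open>Continuity is given at the representatives \<open>ybar i\<close>; periodicity
      carries it to their integer translates.\<close>
    have "isCont (\<lambda>z. b (z + of_int (- k))) y"
      by (rule isCont_o2[where g = b]) (use cusp[OF ik(1)] ik(2) in \<open>auto intro!: continuous_intros\<close>)
    then show ?thesis by (simp only: periodic1_of_int[OF per])
  next
    case False
    then show ?thesis using diff differentiable_imp_continuous_within by blast
  qed
  then show "continuous_on UNIV b" by (simp add: continuous_at_imp_continuous_on)
  show "y + 1 \<in> S \<longleftrightarrow> y \<in> S" for y
  proof
    assume "y + 1 \<in> S"
    then obtain i k where "i \<in> {1..N}" "y = ybar i + of_int (k - 1)" by (auto simp: S_def algebra_simps)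
    then show "y \<in> S" unfolding S_def by blast
  next
    assume "y \<in> S"
    then obtain i k where "i \<in> {1..N}" "y + 1 = ybar i + of_int (k + 1)" by (auto simp: S_def)
    then show "y + 1 \<in> S" unfolding S_def by blast
  qed
  have "S \<inter> {- 2..2} \<subseteq> (\<Union>i\<in>{1..N}. (\<lambda>k. ybar i + of_int k) ` {\<lfloor>- 2 - ybar i\<rfloor>..\<lceil>2 - ybar i\<rceil>})"
  proof
    fix y assume "y \<in> S \<inter> {- 2..2}"
    then obtain i k where ik: "i \<in> {1..N}" "y = ybar i + of_int k" and y: "- 2 \<le> y" "y \<le> 2" by (auto simp: S_def)
    have "k \<in> {\<lfloor>- 2 - ybar i\<rfloor>..\<lceil>2 - ybar i\<rceil>}" using y ik(2) by (simp add: floor_le_iff le_ceiling_iff)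
    then show "y \<in> (\<Union>i\<in>{1..N}. (\<lambda>k. ybar i + of_int k) ` {\<lfloor>- 2 - ybar i\<rfloor>..\<lceil>2 - ybar i\<rceil>})"
      using ik by blast
  qed
  then show "finite (S \<inter> {- 2..2})" by (rule finite_subset) auto
qed (use per c in auto)

subsection \<open>Reduction to Fourier modes on the torus\<close>

definition torus :: "(real \<times> real) measure" where
  "torus = circ \<Otimes>\<^sub>M circ"

interpretation circ2: pair_sigma_finite circ circ ..

lemma sets_circ_subset: "A \<in> sets circ \<Longrightarrow> A \<in> sets borel \<and> A \<subseteq> {0..<1} \<and> emeasure circ A = emeasure lborel A"
  unfolding circ_def by (auto simp: sets_restrict_space emeasure_restrict_space)

lemma cell_borel: "cell \<in> sets borel"
  unfolding cell_def borel_prod[symmetric] by (intro pair_measureI) auto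

text \<open>Links integrals over \<open>cell\<close> with Fubini's theorem for the product of two
  circles.\<close>

lemma torus_eq: "torus = restrict_space lborel cell"
  unfolding torus_def
proof (rule pair_measure_eqI)
  show "sigma_finite_measure circ" "sigma_finite_measure circ" by unfold_locales
  show "sets (circ \<Otimes>\<^sub>M circ) = sets (restrict_space lborel cell)"
  proof (intro set_eqI iffI)
    fix X assume X: "X \<in> sets (circ \<Otimes>\<^sub>M circ)"
    have "(\<lambda>p. (fst p, snd p)) \<in> measurable (restrict_space lborel cell) (circ \<Otimes>\<^sub>M circ)"
      unfolding circ_def
      by (intro measurable_Pair measurable_restrict_space2 measurable_restrict_space1)
        (auto simp: space_restrict_space cell_def borel_prod[symmetric])
    from measurable_sets[OF this X]
    have "X \<inter> cell \<in> sets (restrict_space lborel cell)"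
      by (simp add: vimage_def space_restrict_space Int_def)
    moreover have "X \<subseteq> cell"
      using sets.sets_into_space[OF X] by (simp add: space_pair_measure cell_def)
    ultimately show "X \<in> sets (restrict_space lborel cell)" by (simp add: Int_absorb2)
  next
    fix X assume "X \<in> sets (restrict_space lborel cell)"
    then obtain Y where Y: "Y \<in> sets borel" "X = Y \<inter> cell" by (auto simp: sets_restrict_space)
    have "(\<lambda>p. (fst p, snd p)) \<in> measurable (circ \<Otimes>\<^sub>M circ) (borel \<Otimes>\<^sub>M borel)"
      by (intro measurable_Pair measurable_compose[OF measurable_fst] measurable_compose[OF measurable_snd]
          measurable_circ) auto
    then have "(\<lambda>p. p) \<in> measurable (circ \<Otimes>\<^sub>M circ) borel" by (simp add: borel_prod)
    from measurable_sets[OF this Y(1)] show "X \<in> sets (circ \<Otimes>\<^sub>M circ)"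
      by (simp add: Y(2) space_pair_measure cell_def)
  qed
  fix A B assume A: "A \<in> sets circ" and B: "B \<in> sets circ"
  note A' = sets_circ_subset[OF A] and B' = sets_circ_subset[OF B]
  have "emeasure (restrict_space lborel cell) (A \<times> B) = emeasure lborel (A \<times> B)"
    using A' B' cell_borel by (subst emeasure_restrict_space) (auto simp: cell_def)
  also have "\<dots> = emeasure lborel A * emeasure lborel B"
    using A' B' by (subst lborel_prod[symmetric], subst lborel.emeasure_pair_measure_Times) auto
  finally show "emeasure circ A * emeasure circ B = emeasure (restrict_space lborel cell) (A \<times> B)"
    using A' B' by simp
qed

lemma measurable_torus: "f \<in> borel_measurable borel \<Longrightarrow> f \<in> borel_measurable torus"
  unfolding torus_eq by (intro measurable_restrict_space1) simp

lemma integral_torus: "(\<integral>p. f p \<partial>torus) = (LINT p:cell|lborel. f p)"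
  for f :: "real \<times> real \<Rightarrow> 'a :: {banach, second_countable_topology}"
  unfolding torus_eq set_lebesgue_integral_def using cell_borel by (subst integral_restrict_space) auto

lemma integrable_torus: "integrable torus f \<longleftrightarrow> set_integrable lborel cell f"
  for f :: "real \<times> real \<Rightarrow> 'a :: {banach, second_countable_topology}"
  unfolding torus_eq set_integrable_def using cell_borel by (subst integrable_restrict_space) auto

lemma finite_measure_torus: "finite_measure torus"
  unfolding torus_def using finite_measure_circ finite_measure_circ by (rule finite_measure_pair_measure)

lemma L2_torus_sq_int: "L2_torus f \<Longrightarrow> sq_int torus f"
  by (simp add: L2_torus_def sq_int_def integrable_torus measurable_torus)

lemma L2_norm_eq: "L2_norm f = sqrt (norm_sq torus f)"
  by (simp add: L2_norm_def norm_sq_def integral_torus)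

lemma pairing_eq: "pairing f \<phi> = (\<integral>p. f p * \<phi> p \<partial>torus)"
  by (simp add: pairing_def integral_torus)

text \<open>Sections of an L2 function are square integrable for almost every \<open>y\<close> only;
  elsewhere the value may be the default 0 of the integral.\<close>

definition xcoef :: "(real \<times> real \<Rightarrow> complex) \<Rightarrow> nat \<Rightarrow> real \<Rightarrow> complex" where
  "xcoef f k y = fcoef (\<lambda>x. f (x, y)) k"

lemma AE_sq_int_section:
  assumes f: "sq_int torus f"
  shows "AE y in circ. sq_int circ (\<lambda>x. f (x, y))"
proof -
  have fm: "f \<in> borel_measurable (circ \<Otimes>\<^sub>M circ)" and fi: "integrable (circ \<Otimes>\<^sub>M circ) (\<lambda>(x, y). (cmod (f (x, y)))\<^sup>2)"
    using f by (auto simp: sq_int_def torus_def case_prod_beta')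
  have m: "(\<lambda>x. f (x, y)) \<in> borel_measurable circ" if "y \<in> space circ" for y
    using fm that by (rule measurable_Pair1)
  show ?thesis
    using circ2.AE_integrable_snd[OF fi] AE_space[of circ] by eventually_elim (simp only: sq_int_def m)
qed

lemma integral_norm_sq_section:
  assumes f: "sq_int torus f"
  shows "integrable circ (\<lambda>y. norm_sq circ (\<lambda>x. f (x, y)))"
    "(\<integral>y. norm_sq circ (\<lambda>x. f (x, y)) \<partial>circ) = norm_sq torus f"
proof -
  have fi: "integrable (circ \<Otimes>\<^sub>M circ) (\<lambda>(x, y). (cmod (f (x, y)))\<^sup>2)"
    using f by (auto simp: sq_int_def torus_def case_prod_beta')
  show "integrable circ (\<lambda>y. norm_sq circ (\<lambda>x. f (x, y)))"
    unfolding norm_sq_def by (rule circ2.integrable_snd[OF fi])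
  show "(\<integral>y. norm_sq circ (\<lambda>x. f (x, y)) \<partial>circ) = norm_sq torus f"
    using circ2.integral_snd[OF fi] by (simp add: norm_sq_def torus_def case_prod_beta')
qed

lemma xcoef_measurable:
  assumes f: "sq_int torus f"
  shows "xcoef f k \<in> borel_measurable circ"
proof -
  have fm: "f \<in> borel_measurable (circ \<Otimes>\<^sub>M circ)" using f by (auto simp: sq_int_def torus_def)
  have "(\<lambda>(y, x). f (x, y)) \<in> borel_measurable (circ \<Otimes>\<^sub>M circ)"
    using measurable_compose[OF measurable_pair_swap' fm] by (simp add: case_prod_beta')
  moreover have "(\<lambda>(y, x). fmode (- freq k) x) \<in> borel_measurable (circ \<Otimes>\<^sub>M circ)"
    using measurable_compose[OF measurable_snd measurable_circ[OF fmode_measurable]] by (simp add: case_prod_beta')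
  ultimately have "(\<lambda>(y, x). f (x, y) * cnj (fmode (freq k) x)) \<in> borel_measurable (circ \<Otimes>\<^sub>M circ)"
    unfolding cnj_fmode case_prod_beta' by (rule borel_measurable_times)
  then show ?thesis
    unfolding xcoef_def fcoef_def
    using circ.borel_measurable_lebesgue_integral[of "\<lambda>y x. f (x, y) * cnj (fmode (freq k) x)" circ] by simp
qed

lemma xcoef_Bessel:
  assumes f: "sq_int torus f"
  shows "AE y in circ. (\<Sum>k<n. (cmod (xcoef f k y))\<^sup>2) \<le> norm_sq circ (\<lambda>x. f (x, y))"
  using AE_sq_int_section[OF f] by eventually_elim (simp add: xcoef_def Bessel)

lemma sq_int_xcoef:
  assumes f: "sq_int torus f"
  shows "sq_int circ (xcoef f k)"
  unfolding sq_int_def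
proof (intro conjI xcoef_measurable[OF f] Bochner_Integration.integrable_bound[OF integral_norm_sq_section(1)[OF f]])
  show "AE y in circ. norm ((cmod (xcoef f k y))\<^sup>2) \<le> norm (norm_sq circ (\<lambda>x. f (x, y)))"
    using xcoef_Bessel[OF f, of "Suc k"]
  proof eventually_elim
    case (elim y)
    moreover have "(cmod (xcoef f k y))\<^sup>2 \<le> (\<Sum>k<Suc k. (cmod (xcoef f k y))\<^sup>2)" by (simp add: sum_nonneg)
    ultimately show ?case by simp
  qed
qed (use xcoef_measurable[OF f] in measurable)

text \<open>Parseval in x on almost every section, then dominated convergence in y with the norm of
  the section as majorant.\<close>

lemma norm_sq_xcoef_sums:
  assumes f: "sq_int torus f"
  shows "(\<lambda>k. norm_sq circ (xcoef f k)) sums norm_sq torus f"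
proof -
  note m = xcoef_measurable[OF f]
  have "(\<lambda>n. \<integral>y. (\<Sum>k<n. (cmod (xcoef f k y))\<^sup>2) \<partial>circ) \<longlonglongrightarrow> (\<integral>y. norm_sq circ (\<lambda>x. f (x, y)) \<partial>circ)"
  proof (rule integral_dominated_convergence[where w = "\<lambda>y. norm_sq circ (\<lambda>x. f (x, y))"])
    show "AE y in circ. (\<lambda>n. \<Sum>k<n. (cmod (xcoef f k y))\<^sup>2) \<longlonglongrightarrow> norm_sq circ (\<lambda>x. f (x, y))"
      using AE_sq_int_section[OF f]
    proof eventually_elim
      case (elim y)
      from parseval_sums[OF this] show ?case by (simp add: sums_def xcoef_def)
    qed
    show "AE y in circ. norm (\<Sum>k<n. (cmod (xcoef f k y))\<^sup>2) \<le> norm_sq circ (\<lambda>x. f (x, y))" for n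
      using xcoef_Bessel[OF f, of n] by (simp add: sum_nonneg)
    show "(\<lambda>y. \<Sum>k<n. (cmod (xcoef f k y))\<^sup>2) \<in> borel_measurable circ" for n
      using m by measurable
  qed (use integral_norm_sq_section(1)[OF f] in auto)
  moreover have "(\<integral>y. (\<Sum>k<n. (cmod (xcoef f k y))\<^sup>2) \<partial>circ) = (\<Sum>k<n. norm_sq circ (xcoef f k))" for n
    unfolding norm_sq_def using sq_int_xcoef[OF f]
    by (intro Bochner_Integration.integral_sum) (auto simp: sq_int_def)
  ultimately show ?thesis
    by (simp add: sums_def integral_norm_sq_section(2)[OF f])
qed

lemma norm_sq_xcoef_le:
  assumes f: "sq_int torus f"
  shows "norm_sq circ (xcoef f k) \<le> norm_sq torus f"
proof -
  have "(\<Sum>i\<in>{k}. norm_sq circ (xcoef f i)) \<le> norm_sq torus f"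
    using norm_sq_xcoef_sums[OF f] by (intro sum_le_suminf[THEN order_trans]) (auto simp: sums_iff)
  then show ?thesis by simp
qed

text \<open>Fubini: pairings on the torus with products of a character in x and a bounded function
  of y reduce to the circle.\<close>

lemma integral_xcoef_mult:
  assumes f: "sq_int torus f" and h: "h \<in> borel_measurable borel" "\<And>y. cmod (h y) \<le> B"
  shows "(\<integral>p. f p * (cnj (fmode (freq k) (fst p)) * h (snd p)) \<partial>torus) = (\<integral>y. xcoef f k y * h y \<partial>circ)"
proof -
  have w: "sq_int torus (\<lambda>p. cnj (fmode (freq k) (fst p)) * h (snd p))"
  proof (rule sq_int_of_bounded[OF finite_measure_torus, where B = B])
    show "(\<lambda>p. cnj (fmode (freq k) (fst p)) * h (snd p)) \<in> borel_measurable torus"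
      unfolding torus_def cnj_fmode
      by (intro borel_measurable_times measurable_compose[OF measurable_fst measurable_circ[OF fmode_measurable]]
          measurable_compose[OF measurable_snd measurable_circ[OF h(1)]])
  qed (simp add: norm_mult h)
  have "integrable (circ \<Otimes>\<^sub>M circ) (\<lambda>(x, y). f (x, y) * (cnj (fmode (freq k) x) * h y))"
    using sq_int_mult_integrable[OF f w] by (simp add: torus_def case_prod_beta')
  from circ2.integral_snd[OF this]
  have "(\<integral>p. f p * (cnj (fmode (freq k) (fst p)) * h (snd p)) \<partial>torus) =
      (\<integral>y. (\<integral>x. (f (x, y) * cnj (fmode (freq k) x)) * h y \<partial>circ) \<partial>circ)"
    by (simp add: torus_def case_prod_beta' mult.assoc)
  then show ?thesis by (simp add: xcoef_def fcoef_def)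
qed

section \<open>Characters as test functions\<close>

definition tmode :: "int \<Rightarrow> int \<Rightarrow> real \<times> real \<Rightarrow> complex" where
  "tmode m n p = fmode m (fst p) * fmode n (snd p)"

lemma partial_x_tmode: "partial_x (\<lambda>p. a * tmode m n p) = (\<lambda>p. (2 * pi * of_int m * \<i>) * a * tmode m n p)"
proof -
  have "((\<lambda>s. a * (fmode m s * fmode n y)) has_vector_derivative (2 * pi * of_int m * \<i>) * a * (fmode m x * fmode n y)) (at x)"
    for x y
    using has_vector_derivative_mult_right[OF fmode_has_vector_derivative[of m x UNIV], of "a * fmode n y"]
    by (simp add: mult_ac)
  then show ?thesis
    by (auto simp: partial_x_def tmode_def fun_eq_iff intro!: vector_derivative_at)
qed

lemma partial_y_tmode: "partial_y (\<lambda>p. a * tmode m n p) = (\<lambda>p. (2 * pi * of_int n * \<i>) * a * tmode m n p)"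
proof -
  have "((\<lambda>s. a * (fmode m x * fmode n s)) has_vector_derivative (2 * pi * of_int n * \<i>) * a * (fmode m x * fmode n y)) (at y)"
    for x y
    using has_vector_derivative_mult_right[OF fmode_has_vector_derivative[of n y UNIV], of "a * fmode m x"]
    by (simp add: mult_ac)
  then show ?thesis
    by (auto simp: partial_y_def tmode_def fun_eq_iff intro!: vector_derivative_at)
qed

lemma funpow_partial_x_tmode:
  "(partial_x ^^ i) (\<lambda>p. a * tmode m n p) = (\<lambda>p. ((2 * pi * of_int m * \<i>) ^ i * a) * tmode m n p)"
proof (induction i)
  case (Suc i)
  show ?case unfolding funpow.simps(2) o_apply Suc partial_x_tmode by (simp only: power_Suc mult.assoc)
qed simp

lemma funpow_partial_y_tmode:
  "(partial_y ^^ j) (\<lambda>p. a * tmode m n p) = (\<lambda>p. ((2 * pi * of_int n * \<i>) ^ j * a) * tmode m n p)"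
proof (induction j)
  case (Suc j)
  show ?case unfolding funpow.simps(2) o_apply Suc partial_y_tmode by (simp only: power_Suc mult.assoc)
qed simp

lemma tmode_differentiable: "(\<lambda>p. a * tmode m n p) differentiable (at p)"
proof -
  have "fmode l differentiable (at x)" for l x
    using fmode_has_vector_derivative[of l x UNIV] unfolding has_vector_derivative_def differentiable_def by blast
  moreover have "(fst :: real \<times> real \<Rightarrow> real) differentiable (at p)" "(snd :: real \<times> real \<Rightarrow> real) differentiable (at p)"
    by (auto intro!: bounded_linear_imp_differentiable bounded_linear_fst bounded_linear_snd)
  ultimately have "(\<lambda>p. fmode m (fst p)) differentiable (at p)" "(\<lambda>p. fmode n (snd p)) differentiable (at p)"
    using differentiable_chain_at[of fst p "fmode m"] differentiable_chain_at[of snd p "fmode n"]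
    by (simp_all add: o_def)
  then show ?thesis
    unfolding tmode_def by (intro differentiable_mult differentiable_const)
qed

lemma test_function_tmode: "test_function (tmode m n)"
proof -
  have "periodic2 (tmode m n)"
    using periodic1_fmode by (simp add: periodic2_def periodic1_def tmode_def)
  moreover have "(partial_x ^^ i) ((partial_y ^^ j) (tmode m n)) differentiable (at p)" for i j p
    using funpow_partial_y_tmode[of j 1 m n, unfolded mult_1] tmode_differentiable
    by (simp only: funpow_partial_x_tmode)
  ultimately show ?thesis unfolding test_function_def by blast
qed

text \<open>Characters are eigenfunctions of \<open>partial_x\<close> and \<open>laplacian\<close>;
  only the factor \<open>b\<close> couples different y-frequencies.\<close>

lemma weak_operator_tmode:
  "of_real \<beta> * partial_x (tmode m n) p + of_real \<nu> * laplacian (tmode m n) p =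
    (2 * pi * \<i> * of_int m) * (of_real \<beta> * tmode m n p) - of_real (4 * pi\<^sup>2 * \<nu> * ((of_int m)\<^sup>2 + (of_int n)\<^sup>2)) * tmode m n p"
proof -
  have 1: "partial_x (tmode m n) = (\<lambda>p. (2 * pi * of_int m * \<i>) * tmode m n p)"
    using partial_x_tmode[of 1 m n] by simp
  have 2: "(partial_x ^^ 2) (tmode m n) = (\<lambda>p. (2 * pi * of_int m * \<i>) ^ 2 * tmode m n p)"
    using funpow_partial_x_tmode[of 2 1 m n] by simp
  have 3: "(partial_y ^^ 2) (tmode m n) = (\<lambda>p. (2 * pi * of_int n * \<i>) ^ 2 * tmode m n p)"
    using funpow_partial_y_tmode[of 2 1 m n] by simp
  show ?thesis
    unfolding laplacian_def 1 2 3 by (simp add: power_mult_distrib algebra_simps)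
qed

section \<open>From weak solutions to single modes\<close>

lemma pairing_continuous_on:
  fixes f :: "real \<Rightarrow> real \<times> real \<Rightarrow> complex"
  assumes f: "\<And>t. 0 \<le> t \<Longrightarrow> sq_int torus (f t)" and w: "sq_int torus w"
    and lim: "\<And>t. 0 \<le> t \<Longrightarrow> ((\<lambda>s. L2_norm (\<lambda>p. f s p - f t p)) \<longlongrightarrow> 0) (at t within {0..})"
  shows "continuous_on {0..} (\<lambda>t. \<integral>p. f t p * w p \<partial>torus)"
  unfolding continuous_on_def
proof
  fix t :: real assume t: "t \<in> {0..}"
  have "((\<lambda>s. (\<integral>p. f s p * w p \<partial>torus) - (\<integral>p. f t p * w p \<partial>torus)) \<longlongrightarrow> 0) (at t within {0..})"
  proof (rule Lim_null_comparison)
    show "((\<lambda>s. L2_norm (\<lambda>p. f s p - f t p) * sqrt (norm_sq torus w)) \<longlongrightarrow> 0) (at t within {0..})"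
      using tendsto_mult_left_zero[OF lim] t by auto
    have "cmod ((\<integral>p. f s p * w p \<partial>torus) - (\<integral>p. f t p * w p \<partial>torus)) \<le> L2_norm (\<lambda>p. f s p - f t p) * sqrt (norm_sq torus w)"
      if "s \<in> {0..}" for s
    proof -
      have s: "0 \<le> s" "0 \<le> t" using that t by auto
      have "(\<integral>p. f s p * w p \<partial>torus) - (\<integral>p. f t p * w p \<partial>torus) = (\<integral>p. (f s p - f t p) * w p \<partial>torus)"
        using sq_int_mult_integrable[OF f w] s by (simp add: left_diff_distrib)
      then show ?thesis
        using Cauchy_Schwarz_integral[OF sq_int_diff[OF f f] w, of s t] s
        by (simp add: L2_norm_eq real_le_rsqrt flip: real_sqrt_mult)
    qed
    then show "\<forall>\<^sub>F s in at t within {0..}. cmod ((\<integral>p. f s p * w p \<partial>torus) - (\<integral>p. f t p * w p \<partial>torus))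
        \<le> L2_norm (\<lambda>p. f s p - f t p) * sqrt (norm_sq torus w)"
      by (auto simp: eventually_at_filter)
  qed
  then show "((\<lambda>t. \<integral>p. f t p * w p \<partial>torus) \<longlongrightarrow> (\<integral>p. f t p * w p \<partial>torus)) (at t within {0..})"
    by (rule LIM_zero_cancel)
qed

lemma norm_sq_locally_bounded:
  fixes f :: "real \<Rightarrow> real \<times> real \<Rightarrow> complex"
  assumes f: "\<And>t. 0 \<le> t \<Longrightarrow> sq_int torus (f t)"
    and lim: "\<And>t. 0 \<le> t \<Longrightarrow> ((\<lambda>s. L2_norm (\<lambda>p. f s p - f t p)) \<longlongrightarrow> 0) (at t within {0..})"
  shows "\<exists>C. \<forall>t\<in>{0..T}. norm_sq torus (f t) \<le> C"
proof -
  have tri: "L2_norm (f s) \<le> L2_norm (\<lambda>p. f s p - f t p) + L2_norm (f t)" if "0 \<le> s" "0 \<le> t" for s t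
    using Minkowski_norm_sq[OF sq_int_diff[OF f f] f, of s t t] that by (simp add: L2_norm_eq)
  have sym: "L2_norm (\<lambda>p. f s p - f t p) = L2_norm (\<lambda>p. f t p - f s p)" for s t
    by (simp only: L2_norm_eq norm_sq_diff_commute[of torus "f s" "f t"])
  have "continuous_on {0..} (\<lambda>t. L2_norm (f t))"
    unfolding continuous_on_def
  proof
    fix t :: real assume t: "t \<in> {0..}"
    have "((\<lambda>s. L2_norm (f s) - L2_norm (f t)) \<longlongrightarrow> 0) (at t within {0..})"
    proof (rule Lim_null_comparison[OF _ lim])
      have "norm (L2_norm (f s) - L2_norm (f t)) \<le> L2_norm (\<lambda>p. f s p - f t p)" if "s \<in> {0..}" for s
        using tri[of s t] tri[of t s] sym[of s t] t that by (simp add: abs_le_iff)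
      then show "\<forall>\<^sub>F s in at t within {0..}. norm (L2_norm (f s) - L2_norm (f t)) \<le> L2_norm (\<lambda>p. f s p - f t p)"
        by (auto simp: eventually_at_filter)
    qed (use t in auto)
    then show "((\<lambda>t. L2_norm (f t)) \<longlongrightarrow> L2_norm (f t)) (at t within {0..})"
      by (rule LIM_zero_cancel)
  qed
  then have "continuous_on {0..T} (\<lambda>t. L2_norm (f t))" by (rule continuous_on_subset) auto
  then have "compact ((\<lambda>t. L2_norm (f t)) ` {0..T})"
    using compact_Icc by (rule compact_continuous_image)
  then obtain C where C: "\<And>t. t \<in> {0..T} \<Longrightarrow> \<bar>L2_norm (f t)\<bar> \<le> C"
    using compact_imp_bounded[of "(\<lambda>t. L2_norm (f t)) ` {0..T}"] unfolding bounded_iff real_norm_def by blast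
  have "norm_sq torus (f t) \<le> C\<^sup>2" if "t \<in> {0..T}" for t
  proof -
    have "norm_sq torus (f t) = \<bar>L2_norm (f t)\<bar>\<^sup>2" by (simp add: L2_norm_eq)
    also have "\<dots> \<le> C\<^sup>2" using C[OF that] by (intro power_mono) auto
    finally show ?thesis .
  qed
  then show ?thesis by blast
qed

text \<open>The pairing is bilinear, so the coefficient at (k, j) comes from the character with both
  frequencies negated. Continuity in L2 makes the integrand of the weak formulation continuous in
  time, and the fundamental theorem of calculus turns it into the ODE; at time 0 it identifies the
  initial coefficients.\<close>

lemma shear_mode_of_solution:
  fixes k :: nat
  assumes ps: "piecewise_steep b S c" and B: "\<And>y. \<bar>b y\<bar> \<le> B"
    and r: "0 < r" "r \<le> 1" and sol: "solution b (r ^ 3) f\<^sub>0 f"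
  shows "shear_mode b B c (4 * card (S \<inter> {- 2..2})) r (freq k) (\<lambda>t. xcoef (f t) k)"
    and "\<And>j. fcoef (xcoef (f 0) k) j = pairing f\<^sub>0 (tmode (- freq k) (- freq j))"
proof -
  interpret piecewise_steep b S c by fact
  note [measurable] = borel_measurable_continuous_onI[OF cont]
  have L2: "\<And>t. 0 \<le> t \<Longrightarrow> sq_int torus (f t)"
    and lim: "\<And>t. 0 \<le> t \<Longrightarrow> ((\<lambda>s. L2_norm (\<lambda>p. f s p - f t p)) \<longlongrightarrow> 0) (at t within {0..})"
    and weak: "\<And>\<phi> t. test_function \<phi> \<Longrightarrow> 0 \<le> t \<Longrightarrow> pairing (f t) \<phi> = pairing f\<^sub>0 \<phi> +
          (LINT s:{0..t}|lborel. pairing (f s)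
             (\<lambda>(x, y). complex_of_real (b y) * partial_x \<phi> (x, y)
                        + complex_of_real (r ^ 3) * laplacian \<phi> (x, y)))"
    using sol L2_torus_sq_int unfolding solution_def by blast+
  define u where "u = (\<lambda>j t. fcoef (xcoef (f t) k) j)"
  define v where "v = (\<lambda>j t. fcoef (\<lambda>y. of_real (b y) * xcoef (f t) k y) j)"
  define w where "w = (\<lambda>j. tmode (- freq k) (- freq j))"
  define a where "a = (\<lambda>j. 4 * pi\<^sup>2 * r ^ 3 * ((of_int (freq k))\<^sup>2 + (of_int (freq j))\<^sup>2))"
  define u' where "u' = (\<lambda>j t. - (2 * pi * \<i> * of_int (freq k)) * v j t - of_real (a j) * u j t)"
  have tm[measurable]: "w j \<in> borel_measurable borel" for j
    unfolding w_def tmode_def borel_prod[symmetric] by measurable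
  have wm: "w j \<in> borel_measurable torus" for j
    by (rule measurable_torus[OF tm])
  have w: "sq_int torus (w j)" for j
    by (rule sq_int_of_bounded[OF finite_measure_torus wm, where B = 1]) (simp add: w_def tmode_def norm_mult)
  have bw: "sq_int torus (\<lambda>p. of_real (b (snd p)) * w j p)" for j
  proof (rule sq_int_bounded_mult(1)[OF w, where B = B])
    show "(\<lambda>p. complex_of_real (b (snd p))) \<in> borel_measurable torus"
      by (rule measurable_torus) (unfold borel_prod[symmetric], measurable)
  qed (use B in simp)
  have u: "u j t = (\<integral>p. f t p * w j p \<partial>torus)" if "0 \<le> t" for j t
    using integral_xcoef_mult[OF L2[OF that], of "\<lambda>y. cnj (fmode (freq j) y)" 1 k]
    by (simp add: u_def fcoef_def w_def tmode_def cnj_fmode)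
  have v: "v j t = (\<integral>p. f t p * (of_real (b (snd p)) * w j p) \<partial>torus)" if "0 \<le> t" for j t
    using integral_xcoef_mult[OF L2[OF that], of "\<lambda>y. of_real (b y) * cnj (fmode (freq j) y)" B k] B
    by (simp add: v_def fcoef_def w_def tmode_def cnj_fmode norm_mult mult_ac)
  have ucont: "continuous_on {0..} (u j)" for j
    using pairing_continuous_on[OF L2 w lim, of j] by (rule continuous_on_cong[THEN iffD1, rotated 2]) (simp_all add: u)
  have vcont: "continuous_on {0..} (v j)" for j
    using pairing_continuous_on[OF L2 bw lim, of j] by (rule continuous_on_cong[THEN iffD1, rotated 2]) (simp_all add: v)
  have u'cont: "continuous_on {0..} (u' j)" for j
    unfolding u'_def by (intro continuous_intros ucont vcont)
  let ?P = "\<lambda>j s. pairing (f s) (\<lambda>(x, y). complex_of_real (b y) * partial_x (w j) (x, y)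
      + complex_of_real (r ^ 3) * laplacian (w j) (x, y))"
  have eq: "?P j s = u' j s" if s: "0 \<le> s" for s j
  proof -
    have "?P j s =
      (\<integral>p. - (2 * pi * \<i> * of_int (freq k)) * (f s p * (of_real (b (snd p)) * w j p)) - of_real (a j) * (f s p * w j p) \<partial>torus)"
      unfolding pairing_eq w_def case_prod_beta' prod.collapse weak_operator_tmode
      by (simp add: a_def algebra_simps)
    also have "\<dots> = u' j s"
      using sq_int_mult_integrable[OF L2[OF s] w, of j] sq_int_mult_integrable[OF L2[OF s] bw, of j]
      by (simp add: u'_def u[OF s] v[OF s])
    finally show ?thesis .
  qed
  have integral_form: "u j t = pairing f\<^sub>0 (w j) + integral {0..t} (u' j)" if t: "0 \<le> t" for j t
  proof -
    have "u j t = pairing f\<^sub>0 (w j) + (LINT s:{0..t}|lborel. ?P j s)"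
      using weak[OF test_function_tmode t] by (simp add: u[OF t] w_def pairing_eq[of "f t"])
    also have "(LINT s:{0..t}|lborel. ?P j s) = (LINT s:{0..t}|lborel. u' j s)"
      by (intro set_lebesgue_integral_cong) (use eq in auto)
    also have "\<dots> = integral {0..t} (u' j)"
      by (intro set_borel_integral_eq_integral borel_integrable_atLeastAtMost'
          continuous_on_subset[OF u'cont]) auto
    finally show ?thesis .
  qed
  show "fcoef (xcoef (f 0) k) j = pairing f\<^sub>0 (tmode (- freq k) (- freq j))" for j
    using integral_form[of 0 j] by (simp add: u_def w_def)
  show "shear_mode b B c (4 * card (S \<inter> {- 2..2})) r (freq k) (\<lambda>t. xcoef (f t) k)"
  proof
    show "((\<lambda>t. fcoef (xcoef (f t) k) j) has_vector_derivative
        - (2 * pi * \<i> * of_int (freq k)) * fcoef (\<lambda>y. of_real (b y) * xcoef (f t) k y) j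
        - of_real (4 * pi\<^sup>2 * r ^ 3 * ((of_int (freq k))\<^sup>2 + (of_int (freq j))\<^sup>2)) * fcoef (xcoef (f t) k) j) (at t within {0..})"
      if t: "0 \<le> t" for t j
    proof -
      have "((\<lambda>t. integral {0..t} (u' j)) has_vector_derivative u' j t) (at t within {0..t + 1})"
        using t by (intro integral_has_vector_derivative continuous_on_subset[OF u'cont]) auto
      \<comment> \<open>The endpoint t + 1 only makes room to the right of t; at t = 0 the
        derivative is one-sided.\<close>
      also have "at t within {0..t + 1} = at t within {0..}"
        by (rule at_within_nhd[of _ "{..<t + 1}"]) auto
      finally have "((\<lambda>t. pairing f\<^sub>0 (w j) + integral {0..t} (u' j)) has_vector_derivative 0 + u' j t) (at t within {0..})"
        by (intro has_vector_derivative_add has_vector_derivative_const)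
      then have "((\<lambda>t. pairing f\<^sub>0 (w j) + integral {0..t} (u' j)) has_vector_derivative u' j t) (at t within {0..})"
        by simp
      then have "(u j has_vector_derivative u' j t) (at t within {0..})"
        by (rule has_vector_derivative_transform[rotated 2]) (use t integral_form in auto)
      then show ?thesis by (simp add: u_def v_def u'_def a_def)
    qed
    show "continuous_on {0..} (\<lambda>t. fcoef (xcoef (f t) k) j)" for j using ucont by (simp add: u_def)
    show "continuous_on {0..} (\<lambda>t. fcoef (\<lambda>y. complex_of_real (b y) * xcoef (f t) k y) j)" for j
      using vcont by (simp add: v_def)
    show "\<exists>C. \<forall>t\<in>{0..T}. norm_sq circ (xcoef (f t) k) \<le> C" for T
      using norm_sq_locally_bounded[OF L2 lim, of T] norm_sq_xcoef_le[OF L2] by (meson atLeastAtMost_iff order_trans)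
    show "nondegenerate b c (real (4 * card (S \<inter> {- 2..2})))" by (rule nondegenerate)
    show "sq_int circ (xcoef (f t) k)" if "0 \<le> t" for t by (rule sq_int_xcoef[OF L2[OF that]])
  qed (use B r c card_S_pos in auto)
qed

lemma norm_sq_xcoef_zero_mode:
  assumes mean: "AE y in lborel. (LINT x:{0..<1}|lborel. f\<^sub>0 (x, y)) = 0" and k: "freq k = 0"
  shows "norm_sq circ (xcoef f\<^sub>0 k) = 0"
proof -
  have "AE y in circ. (LINT x:{0..<1}|lborel. f\<^sub>0 (x, y)) = 0"
    unfolding circ_def using mean by (subst AE_restrict_space_iff) (auto elim: AE_mp)
  then have "AE y in circ. (cmod (xcoef f\<^sub>0 k y))\<^sup>2 = 0"
    by eventually_elim (simp add: xcoef_def fcoef_def k integral_circ)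
  then show ?thesis
    unfolding norm_sq_def by (rule integral_eq_zero_AE)
qed

lemma L2_decay:
  assumes ps: "piecewise_steep b S c" and B: "\<And>y. \<bar>b y\<bar> \<le> B"
    and r: "0 < r" "r \<le> 1" and f0: "L2_torus f\<^sub>0"
    and mean: "AE y in lborel. (LINT x:{0..<1}|lborel. f\<^sub>0 (x, y)) = 0"
    and sol: "solution b (r ^ 3) f\<^sub>0 f" and t: "0 \<le> t"
  defines "A \<equiv> resolvent_const c (4 * card (S \<inter> {- 2..2}))"
  shows "L2_norm (f t) \<le> exp 1 * exp (- (1 / (4 * pi * A)) * r * t) * L2_norm f\<^sub>0"
proof -
  interpret piecewise_steep b S c by fact
  have f0s: "sq_int torus f\<^sub>0" by (rule L2_torus_sq_int[OF f0])
  have fs: "sq_int torus (f t)" and fs0: "sq_int torus (f 0)"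
    using sol t L2_torus_sq_int unfolding solution_def by blast+
  define M where "M = exp (2 - 2 * (r / (4 * pi * A)) * t)"
  have le: "norm_sq circ (xcoef (f t) k) \<le> M * norm_sq circ (xcoef f\<^sub>0 k)" for k
  proof -
    note mode = shear_mode_of_solution[OF ps B r sol, of k]
    interpret m: shear_mode b B c "4 * card (S \<inter> {- 2..2})" r "freq k" "\<lambda>t. xcoef (f t) k"
      by (rule mode(1))
    have "fcoef (xcoef f\<^sub>0 k) j = pairing f\<^sub>0 (tmode (- freq k) (- freq j))" for j
      using integral_xcoef_mult[OF f0s, of "\<lambda>y. cnj (fmode (freq j) y)" 1 k]
      by (simp add: pairing_eq fcoef_def tmode_def cnj_fmode)
    then have "fcoef (xcoef (f 0) k) = fcoef (xcoef f\<^sub>0 k)" using mode(2) by (simp add: fun_eq_iff)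
    \<comment> \<open>\<open>f 0\<close> and \<open>f\<^sub>0\<close> may differ as functions; equal
      coefficients give equal energies by Parseval.\<close>
    then have e0: "m.energy 0 = norm_sq circ (xcoef f\<^sub>0 k)"
      using parseval_sums[OF sq_int_xcoef[OF fs0], of k] parseval_sums[OF sq_int_xcoef[OF f0s], of k]
      by (simp add: m.energy_def sums_iff)
    show ?thesis
    proof (cases "freq k = 0")
      case True
      \<comment> \<open>The zero mode starts from energy 0 by the mean condition and stays there by
        monotonicity; no mixing is involved.\<close>
      have "m.energy t \<le> m.energy 0" using t by (intro m.energy_mono) auto
      then show ?thesis
        using e0 norm_sq_xcoef_zero_mode[OF mean True] by (simp add: m.energy_def M_def)
    next
      case False
      from m.energy_exponential_decay[OF False t] show ?thesis
        unfolding e0 by (simp only: m.energy_def M_def A_def)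
    qed
  qed
  have s: "(\<lambda>k. norm_sq circ (xcoef (f t) k)) sums norm_sq torus (f t)"
    "(\<lambda>k. M * norm_sq circ (xcoef f\<^sub>0 k)) sums (M * norm_sq torus f\<^sub>0)"
    by (intro norm_sq_xcoef_sums fs sums_mult f0s)+
  have "norm_sq torus (f t) \<le> M * norm_sq torus f\<^sub>0"
    using sums_le[OF le s] .
  then have "L2_norm (f t) \<le> sqrt M * L2_norm f\<^sub>0"
    by (simp add: L2_norm_eq flip: real_sqrt_mult)
  also have "M = (exp (1 - (1 / (4 * pi * A)) * r * t))\<^sup>2"
    unfolding M_def exp_double[symmetric] by (rule arg_cong[where f = exp]) (simp add: algebra_simps)
  also have "sqrt \<dots> = exp 1 * exp (- (1 / (4 * pi * A)) * r * t)"
    unfolding real_sqrt_abs abs_exp_cancel exp_add[symmetric] by simp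
  finally show ?thesis .
qed

theorem corollary3:
  fixes b :: "real \<Rightarrow> real" and N :: nat and ybar :: "nat \<Rightarrow> real"
  assumes "periodic1 b"
    and "smooth_on b (- {ybar i + of_int k | i k. i \<in> {1..N} \<and> k \<in> (UNIV :: int set)})"
    and "\<exists>c>0. \<forall>y. b differentiable (at y) \<longrightarrow> \<bar>deriv b y\<bar> \<ge> c"
    and "\<And>i. i \<in> {1..N} \<Longrightarrow>
           \<exists>\<alpha>\<in>{0<..<1}. \<exists>h\<^sub>0\<in>{0<..<1}. \<exists>\<beta> c :: real. \<forall>h\<in>{- h\<^sub>0..h\<^sub>0} - {0}.
             b (ybar i + h) - b (ybar i) = c * \<bar>h\<bar> powr \<alpha> * ln (1 / \<bar>h\<bar>) powr \<beta>"
  shows "dissipation_enhancing b (\<lambda>\<nu>. \<nu> powr (1 / 3))"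
proof -
  define S where "S = {ybar i + of_int k | i k. i \<in> {1..N} \<and> k \<in> (UNIV :: int set)}"
  obtain c where c: "0 < c" "\<And>y. b differentiable (at y) \<Longrightarrow> c \<le> \<bar>deriv b y\<bar>" using assms(3) by blast
  have "isCont b (ybar i)" if i: "i \<in> {1..N}" for i
  proof -
    from assms(4)[OF i] obtain \<alpha> h\<^sub>0 \<beta> c where "\<alpha> \<in> {0<..<1}" "h\<^sub>0 \<in> {0<..<1}"
      "\<forall>h\<in>{- h\<^sub>0..h\<^sub>0} - {0}. b (ybar i + h) - b (ybar i) = c * \<bar>h\<bar> powr \<alpha> * ln (1 / \<bar>h\<bar>) powr \<beta>"
      by blast
    then show ?thesis by (intro isCont_power_log_cusp[of \<alpha> h\<^sub>0 b "ybar i" c \<beta>]) auto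
  qed
  then have ps: "piecewise_steep b S c"
    unfolding S_def by (intro piecewise_steep_of_cusps assms c)
  then interpret piecewise_steep b S c .
  obtain B where B: "\<And>y. \<bar>b y\<bar> \<le> B" using bounded by blast
  define A where "A = resolvent_const c (4 * card (S \<inter> {- 2..2}))"
  have A: "0 < A" unfolding A_def using c card_S_pos by (intro resolvent_const_pos) auto
  have "L2_norm (f t) \<le> exp 1 * exp (- (1 / (4 * pi * A)) * \<nu> powr (1 / 3) * t) * L2_norm f\<^sub>0"
    if "\<nu> \<in> {0<..<1}" "L2_torus f\<^sub>0" "AE y in lborel. (LINT x:{0..<1}|lborel. f\<^sub>0 (x, y)) = 0"
      "solution b \<nu> f\<^sub>0 f" "0 \<le> t" for \<nu> f\<^sub>0 f t
  proof -
    have "(\<nu> powr (1 / 3)) ^ 3 = \<nu>" using that(1) by (simp add: powr_power)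
    moreover have "\<nu> powr (1 / 3) \<le> 1" using that(1) by (intro powr_le1) auto
    ultimately show ?thesis
      using L2_decay[OF ps B _ _ that(2,3) _ that(5), of "\<nu> powr (1 / 3)"] that(1,4)
      by (simp add: A_def)
  qed
  moreover have "((\<lambda>\<nu>::real. \<nu> / \<nu> powr (1 / 3)) \<longlongrightarrow> 0) (at_right 0)" by real_asymp
  ultimately show ?thesis
    unfolding dissipation_enhancing_def using A
    by (intro conjI exI[of _ "exp 1"] exI[of _ "1 / (4 * pi * A)"]) auto
qed

end
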